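(* Let $k$ be a field, $R=k[x_1,\dots,x_n]$, $\mathfrak m=(x_1,\dots,x_n)$, let $I \subseteq R$ be a monomial ideal, and let $i$ be a nonnegative integer. Assume that $\lambda(H^i_{\mathfrak m}(R/\overline{I^{(u)}})) < \infty$ for all rational $u \gg 0$. Then the limit $$\lim_{u \to \infty} \dfrac{\lambda(H^i_{\mathfrak m}(R/\overline{I^{(u)}}))}{u^n}$$ (with $u$ ranging over positive rational numbers) exists and is a rational number.
   Context: $\lambda(\cdot)$ denotes length and $H^i_{\mathfrak m}$ local cohomology. $\mathrm{Ass}(I)$ denotes $\mathrm{Ass}_R(R/I)$. For a positive rational $u=\frac pq$ ($p,q$ positive integers), the $u$-th rational power of $I$ is $\overline{I^u}=\{f\in R \mid f^q\in \overline{I^p}\}$, where $\overline{I^p}$ is the integral closure of $I^p$; it is independent of the presentation of $u$. The $u$-th rational symbolic power of $I$ is $\overline{I^{(u)}}=\bigcap_{\mathfrak p\in \mathrm{Ass}(I)}(\overline{I^u}R_{\mathfrak p}\cap R)$, also for integer $u$. *)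

theory Defs
  imports
    Complex_Main
    "HOL-Algebra.Module"
    "HOL-Algebra.Ideal_Product"
    "HOL-Algebra.Algebraic_Closure_Type"
    "HOL-Library.Poly_Mapping"
    "HOL-Library.Extended_Nat"
    "HOL-Library.Cardinality"
begin

section \<open>Modules over a commutative ring\<close>

text \<open>
  The \<^typ>\<open>('a, 'b) module\<close> record inherits the fields \<open>mult\<close> and \<open>one\<close> from the ring record.
  The locale \<^locale>\<open>module\<close> does not constrain them, and they are left \<^const>\<open>undefined\<close> below.
\<close>

definition self_module :: "('a, 'r) ring_scheme \<Rightarrow> ('a, 'a) module" where
  "self_module R =
     \<lparr>carrier = carrier R, monoid.mult = monoid.mult R, one = \<one>\<^bsub>R\<^esub>,
      ring.zero = \<zero>\<^bsub>R\<^esub>, add = ring.add R, module.smult = monoid.mult R\<rparr>"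

definition quotient_module :: "('a, 'b, 'm) module_scheme \<Rightarrow> 'b set \<Rightarrow> ('a, 'b set) module" where
  "quotient_module M N =
     \<lparr>carrier = a_rcosets\<^bsub>M\<^esub> N, monoid.mult = undefined, one = undefined,
      ring.zero = N, add = set_add M,
      module.smult = (\<lambda>r A. \<Union>x\<in>A. N +>\<^bsub>M\<^esub> (r \<odot>\<^bsub>M\<^esub> x))\<rparr>"

definition module_length :: "('a, 'r) ring_scheme \<Rightarrow> ('a, 'b, 'm) module_scheme \<Rightarrow> enat" where
  "module_length R M =
     Sup {enat k | k. \<exists>N :: nat \<Rightarrow> 'b set.
            (\<forall>j\<le>k. submodule (N j) R M) \<and> (\<forall>j<k. N j \<subset> N (Suc j))}"

definition assoc_primes :: "('a, 'r) ring_scheme \<Rightarrow> ('a, 'b, 'm) module_scheme \<Rightarrow> 'a set set" where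
  "assoc_primes R M =
     {P. primeideal P R \<and> (\<exists>m\<in>carrier M. P = {r \<in> carrier R. r \<odot>\<^bsub>M\<^esub> m = \<zero>\<^bsub>M\<^esub>})}"

subsection \<open>Localization at a multiplicative set\<close>

text \<open>\<open>fraction R M W m s\<close> is the element \<open>m/s\<close> of \<open>W\<^sup>-\<^sup>1M\<close>, as an equivalence class of pairs.\<close>

definition fraction ::
    "('a, 'r) ring_scheme \<Rightarrow> ('a, 'b, 'm) module_scheme \<Rightarrow> 'a set \<Rightarrow> 'b \<Rightarrow> 'a \<Rightarrow> ('b \<times> 'a) set" where
  "fraction R M W m s =
     {(m', s') \<in> carrier M \<times> W.
        \<exists>t\<in>W. t \<odot>\<^bsub>M\<^esub> (s' \<odot>\<^bsub>M\<^esub> m) = t \<odot>\<^bsub>M\<^esub> (s \<odot>\<^bsub>M\<^esub> m')}"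

definition localization ::
    "('a, 'r) ring_scheme \<Rightarrow> ('a, 'b, 'm) module_scheme \<Rightarrow> 'a set \<Rightarrow> ('a, ('b \<times> 'a) set) module" where
  "localization R M W =
     \<lparr>carrier = {fraction R M W m s | m s. m \<in> carrier M \<and> s \<in> W},
      monoid.mult = undefined, one = undefined,
      ring.zero = fraction R M W \<zero>\<^bsub>M\<^esub> \<one>\<^bsub>R\<^esub>,
      add = (\<lambda>A B. \<Union>(m, s)\<in>A. \<Union>(m', s')\<in>B.
               fraction R M W ((s' \<odot>\<^bsub>M\<^esub> m) \<oplus>\<^bsub>M\<^esub> (s \<odot>\<^bsub>M\<^esub> m')) (s \<otimes>\<^bsub>R\<^esub> s')),
      module.smult = (\<lambda>r A. \<Union>(m, s)\<in>A. fraction R M W (r \<odot>\<^bsub>M\<^esub> m) s)\<rparr>"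

text \<open>For \<open>W \<subseteq> W'\<close>, the canonical map \<open>W\<^sup>-\<^sup>1M \<rightarrow> W'\<^sup>-\<^sup>1M\<close>, \<open>m/s \<mapsto> m/s\<close>, with \<open>W'\<close> as argument.\<close>

definition localization_map ::
    "('a, 'r) ring_scheme \<Rightarrow> ('a, 'b, 'm) module_scheme \<Rightarrow> 'a set \<Rightarrow> ('b \<times> 'a) set \<Rightarrow> ('b \<times> 'a) set"
  where
  "localization_map R M W' A = (\<Union>(m, s)\<in>A. fraction R M W' m s)"

section \<open>Local cohomology\<close>

text \<open>
  Local cohomology with support in the ideal generated by a finite sequence \<open>(x\<^sub>i)\<close> of elements of
  a Noetherian ring is defined as the cohomology of the Cech complex (as in R. Stanley,
  \<^emph>\<open>Combinatorics and Commutative Algebra\<close>, Chapter I)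
  \<open>0 \<rightarrow> M \<rightarrow> \<Oplus>\<^sub>i M[1/x\<^sub>i] \<rightarrow> \<Oplus>\<^sub>i\<^sub><\<^sub>j M[1/(x\<^sub>ix\<^sub>j)] \<rightarrow> \<dots> \<rightarrow> M[1/\<Prod>\<^sub>ix\<^sub>i] \<rightarrow> 0\<close>.
  The indices of the sequence form a finite linearly ordered type \<open>'i\<close>, and the summands in degree
  \<open>j\<close> are indexed by the \<open>j\<close>-element sets \<open>S\<close> of indices.  The localization
  \<open>M[1/\<Prod>\<^sub>i\<^sub>\<in>\<^sub>S x\<^sub>i]\<close> is taken at the multiplicative set generated by the \<open>x\<^sub>i\<close>, \<open>i \<in> S\<close>, so
  that these sets increase with \<open>S\<close>.
\<close>

definition mult_set :: "('a, 'r) ring_scheme \<Rightarrow> ('i \<Rightarrow> 'a) \<Rightarrow> 'i set \<Rightarrow> 'a set" where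
  "mult_set R x S = {\<Otimes>\<^bsub>R\<^esub>i\<in>S. x i [^]\<^bsub>R\<^esub> e i | e :: 'i \<Rightarrow> nat. True}"

abbreviation cech_summand ::
    "('a, 'r) ring_scheme \<Rightarrow> ('i \<Rightarrow> 'a) \<Rightarrow> ('a, 'b, 'm) module_scheme \<Rightarrow> 'i set \<Rightarrow>
     ('a, ('b \<times> 'a) set) module" where
  "cech_summand R x M S \<equiv> localization R M (mult_set R x S)"

definition cech_module ::
    "('a, 'r) ring_scheme \<Rightarrow> ('i::{finite,linorder} \<Rightarrow> 'a) \<Rightarrow> ('a, 'b, 'm) module_scheme \<Rightarrow> nat \<Rightarrow>
     ('a, 'i set \<Rightarrow> ('b \<times> 'a) set) module" where
  "cech_module R x M j =
     \<lparr>carrier = (\<Pi>\<^sub>E S\<in>{S. card S = j}. carrier (cech_summand R x M S)),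
      monoid.mult = undefined, one = undefined,
      ring.zero = (\<lambda>S\<in>{S. card S = j}. \<zero>\<^bsub>cech_summand R x M S\<^esub>),
      add = (\<lambda>c d. \<lambda>S\<in>{S. card S = j}. c S \<oplus>\<^bsub>cech_summand R x M S\<^esub> d S),
      module.smult = (\<lambda>r c. \<lambda>S\<in>{S. card S = j}. r \<odot>\<^bsub>cech_summand R x M S\<^esub> c S)\<rparr>"

definition cech_diff ::
    "('a, 'r) ring_scheme \<Rightarrow> ('i::{finite,linorder} \<Rightarrow> 'a) \<Rightarrow> ('a, 'b, 'm) module_scheme \<Rightarrow> nat \<Rightarrow>
     ('i set \<Rightarrow> ('b \<times> 'a) set) \<Rightarrow> ('i set \<Rightarrow> ('b \<times> 'a) set)" where
  "cech_diff R x M j c =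
     (\<lambda>T\<in>{T. card T = Suc j}.
        \<Oplus>\<^bsub>cech_summand R x M T\<^esub>i\<in>T.
          ((\<ominus>\<^bsub>R\<^esub> \<one>\<^bsub>R\<^esub>) [^]\<^bsub>R\<^esub> card {l \<in> T. l < i})
            \<odot>\<^bsub>cech_summand R x M T\<^esub> localization_map R M (mult_set R x T) (c (T - {i})))"

definition cech_cocycles ::
    "('a, 'r) ring_scheme \<Rightarrow> ('i::{finite,linorder} \<Rightarrow> 'a) \<Rightarrow> ('a, 'b, 'm) module_scheme \<Rightarrow> nat \<Rightarrow>
     ('i set \<Rightarrow> ('b \<times> 'a) set) set" where
  "cech_cocycles R x M j =
     {c \<in> carrier (cech_module R x M j). cech_diff R x M j c = \<zero>\<^bsub>cech_module R x M (Suc j)\<^esub>}"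

definition cech_coboundaries ::
    "('a, 'r) ring_scheme \<Rightarrow> ('i::{finite,linorder} \<Rightarrow> 'a) \<Rightarrow> ('a, 'b, 'm) module_scheme \<Rightarrow> nat \<Rightarrow>
     ('i set \<Rightarrow> ('b \<times> 'a) set) set" where
  "cech_coboundaries R x M j =
     (case j of 0 \<Rightarrow> {\<zero>\<^bsub>cech_module R x M 0\<^esub>}
      | Suc k \<Rightarrow> cech_diff R x M k ` carrier (cech_module R x M k))"

definition local_cohomology ::
    "('a, 'r) ring_scheme \<Rightarrow> ('i::{finite,linorder} \<Rightarrow> 'a) \<Rightarrow> nat \<Rightarrow> ('a, 'b, 'm) module_scheme \<Rightarrow>
     ('a, ('i set \<Rightarrow> ('b \<times> 'a) set) set) module" where
  "local_cohomology R x j M =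
     quotient_module ((cech_module R x M j)\<lparr>carrier := cech_cocycles R x M j\<rparr>)
       (cech_coboundaries R x M j)"

section \<open>Rational and rational symbolic powers of an ideal\<close>

primrec ideal_power :: "('a, 'r) ring_scheme \<Rightarrow> 'a set \<Rightarrow> nat \<Rightarrow> 'a set" where
  "ideal_power R I 0 = carrier R"
| "ideal_power R I (Suc k) = I \<cdot>\<^bsub>R\<^esub> ideal_power R I k"

definition integral_closure :: "('a, 'r) ring_scheme \<Rightarrow> 'a set \<Rightarrow> 'a set" where
  "integral_closure R I =
     {f \<in> carrier R. \<exists>d\<ge>1. \<exists>a :: nat \<Rightarrow> 'a.
        (\<forall>j\<in>{1..d}. a j \<in> ideal_power R I j) \<and>
        f [^]\<^bsub>R\<^esub> d \<oplus>\<^bsub>R\<^esub> (\<Oplus>\<^bsub>R\<^esub>j\<in>{1..d}. a j \<otimes>\<^bsub>R\<^esub> f [^]\<^bsub>R\<^esub> (d - j)) = \<zero>\<^bsub>R\<^esub>}"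

text \<open>
  The power with exponent \<open>u = p/q > 0\<close>.  It does not depend on the presentation of \<open>u\<close>; here
  \<open>p/q\<close> is in lowest terms.  For \<open>u \<le> 0\<close> the value is meaningless.
\<close>

definition rational_power :: "('a, 'r) ring_scheme \<Rightarrow> 'a set \<Rightarrow> rat \<Rightarrow> 'a set" where
  "rational_power R I u =
     (let (p, q) = quotient_of u in
      {f \<in> carrier R. f [^]\<^bsub>R\<^esub> nat q \<in> integral_closure R (ideal_power R I (nat p))})"

text \<open>\<open>JR\<^sub>P \<inter> R\<close>: the elements \<open>f\<close> of \<open>R\<close> whose image \<open>f/1\<close> in \<open>R\<^sub>P\<close> is some \<open>g/s\<close>, \<open>g \<in> J\<close>.\<close>

definition local_contraction :: "('a, 'r) ring_scheme \<Rightarrow> 'a set \<Rightarrow> 'a set \<Rightarrow> 'a set" where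
  "local_contraction R J P =
     {f \<in> carrier R. \<exists>g\<in>J. \<exists>s\<in>carrier R - P.
        fraction R (self_module R) (carrier R - P) f \<one>\<^bsub>R\<^esub>
          = fraction R (self_module R) (carrier R - P) g s}"

text \<open>The intersection is taken within \<open>R\<close>, so it is \<open>R\<close> if there is no associated prime.\<close>

definition rational_symbolic_power :: "('a, 'r) ring_scheme \<Rightarrow> 'a set \<Rightarrow> rat \<Rightarrow> 'a set" where
  "rational_symbolic_power R I u =
     carrier R \<inter>
     (\<Inter>P\<in>assoc_primes R (quotient_module (self_module R) I).
        local_contraction R (rational_power R I u) P)"

section \<open>Polynomial rings\<close>

text \<open>
  The polynomial ring \<open>k[x\<^sub>1,\<dots>,x\<^sub>n]\<close>, with the variables indexed by a finite linearly ordered type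
  \<open>'n\<close> and \<open>n = CARD('n)\<close>.  A polynomial is a finitely supported map from exponent vectors to \<open>k\<close>,
  and multiplication in \<^typ>\<open>'a \<Rightarrow>\<^sub>0 'b\<close> is the convolution product.
\<close>

type_synonym ('n, 'k) mpoly = "('n \<Rightarrow>\<^sub>0 nat) \<Rightarrow>\<^sub>0 'k"

abbreviation mpoly_ring :: "('n::{finite,linorder}, 'k::field) mpoly ring" where
  "mpoly_ring \<equiv> ring_of_type_algebra"

definition mpoly_var :: "'n \<Rightarrow> ('n::{finite,linorder}, 'k::field) mpoly" where
  "mpoly_var i = Poly_Mapping.single (Poly_Mapping.single i 1) 1"

definition monomial_ideal :: "('n::{finite,linorder}, 'k::field) mpoly set \<Rightarrow> bool" where
  "monomial_ideal I \<longleftrightarrow> (\<exists>A. I = Idl\<^bsub>mpoly_ring\<^esub> ((\<lambda>a. Poly_Mapping.single a 1) ` A))"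

text \<open>
  The \<open>R\<close>-module \<open>H\<^sup>i\<^sub>\<mm>(R/J)\<close> for \<open>R = k[x\<^sub>1,\<dots>,x\<^sub>n]\<close> and \<open>\<mm> = (x\<^sub>1,\<dots>,x\<^sub>n)\<close>.
\<close>

abbreviation local_cohomology_quotient where
  "local_cohomology_quotient i (J :: ('n::{finite,linorder}, 'k::field) mpoly set) \<equiv>
     local_cohomology mpoly_ring mpoly_var i (quotient_module (self_module mpoly_ring) J)"

definition local_cohomology_length ::
    "nat \<Rightarrow> ('n::{finite,linorder}, 'k::field) mpoly set \<Rightarrow> enat" where
  "local_cohomology_length i J = module_length mpoly_ring (local_cohomology_quotient i J)"

end

theory Submission
  imports Defs
    "HOL-Library.Function_Algebras"
    "HOL-Analysis.Interval_Integral"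
    "Jordan_Normal_Form.Char_Poly"
begin

text \<open>
  All the objects are monomial, and the length turns out to be a weighted count of lattice points
  in dilations of rational polyhedra.

  \<^emph>\<open>The length is a count.\<close>  Let \<open>J\<close> be spanned by the monomials with exponents in an up-closed set
  \<open>D\<close>.  The Cech complex of \<open>R/J\<close> is graded by \<open>\<int>\<^sup>n\<close>.  Its strand in degree \<open>a\<close> has one copy of \<open>k\<close> for
  each set \<open>S\<close> of variables such that \<open>x\<^sup>a\<close> is nonzero in the localization of \<open>R/J\<close> at the variables of
  \<open>S\<close>, so it depends on \<open>a\<close> only through the family \<open>surviving D a\<close> of these \<open>S\<close>.  As every variable
  raises the total degree, the length of \<open>H\<^sup>i\<^sub>\<mm>(R/J)\<close> is the sum over \<open>a\<close> of the dimensions of the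
  cohomologies of the strands (\<open>local_cohomology_length_mono_span\<close>).

  \<^emph>\<open>Membership in symbolic powers is linear.\<close>  By Weyl's theorem, the cone over the Newton polyhedron of
  \<open>I\<close> is cut out by finitely many integral forms \<open>\<omega>\<close>.  The \<open>u\<close>-th rational power of \<open>I\<close> is spanned by the
  monomials \<open>x\<^sup>b\<close> with \<open>\<omega>(b, u) \<ge> 0\<close> for all \<open>\<omega>\<close>: monomial valuations bound the power from above, and
  a determinant produces equations of integral dependence (\<open>rational_power_mono_span\<close>).  To contract
  from the localization at a prime \<open>P\<close>, only the variables in \<open>P\<close> matter: the forms involving other
  variables are dropped.  Hence \<open>surviving D a\<close> for the \<open>u\<close>-th rational symbolic power is determined
  by the signs of finitely many forms at \<open>(a, u)\<close> (\<open>rational_symbolic_power_surviving\<close>).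

  \<^emph>\<open>The count is a Riemann sum.\<close>  By homogeneity the length at \<open>u\<close> is the sum over \<open>a \<in> \<int>\<^sup>n\<close> of \<open>f (a/u)\<close>,
  where \<open>f\<close> is constant on the cells of an arrangement of rational hyperplanes.  A cell with
  \<open>f \<noteq> 0\<close> is bounded, because by Minkowski's theorem an unbounded cell has an integral recession
  direction, and then some large dilation contains infinitely many lattice points
  (\<open>cell_bounded\<close>).  So \<open>f\<close> has bounded support, the sums divided by \<open>u\<^sup>n\<close> converge to the integral of \<open>f\<close>
  by dominated convergence (\<open>tendsto_lattice_sum\<close>), and this integral is rational because integrating
  a rational piecewise polynomial function in one variable gives another one
  (\<open>rat_pp_integral_rational\<close>).
\<close>

abbreviation lookup :: "('a \<Rightarrow>\<^sub>0 'b::zero) \<Rightarrow> 'a \<Rightarrow> 'b" where "lookup \<equiv> Poly_Mapping.lookup"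
abbreviation keys :: "('a \<Rightarrow>\<^sub>0 'b::zero) \<Rightarrow> 'a set" where "keys \<equiv> Poly_Mapping.keys"

section \<open>The polynomial ring as a ring record\<close>

lemma ring_of_type_algebra_sel [simp]:
  "carrier (ring_of_type_algebra :: 'a::ring_1 ring) = UNIV"
  "monoid.mult (ring_of_type_algebra :: 'a::ring_1 ring) = (*)"
  "one (ring_of_type_algebra :: 'a::ring_1 ring) = 1"
  "ring.zero (ring_of_type_algebra :: 'a::ring_1 ring) = 0"
  "ring.add (ring_of_type_algebra :: 'a::ring_1 ring) = (+)"
  by (simp_all add: ring_of_type_algebra_def)

lemma cring_ring_of_type_algebra: "cring (ring_of_type_algebra :: 'a::comm_ring_1 ring)"
  by (rule cring_from_type_algebra)

lemma ring_of_type_algebra_pow [simp]: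
  "x [^]\<^bsub>(ring_of_type_algebra :: 'a::comm_ring_1 ring)\<^esub> (m::nat) = x ^ m"
proof -
  interpret cring "ring_of_type_algebra :: 'a ring" by (rule cring_ring_of_type_algebra)
  show ?thesis by (induction m) (simp_all add: mult.commute)
qed

lemma ring_of_type_algebra_a_inv [simp]:
  "\<ominus>\<^bsub>(ring_of_type_algebra :: 'a::comm_ring_1 ring)\<^esub> x = - x"
proof -
  interpret cring "ring_of_type_algebra :: 'a ring" by (rule cring_ring_of_type_algebra)
  show ?thesis
    by (metis UNIV_I add.right_inverse minus_unique ring_of_type_algebra_sel(1) ring_of_type_algebra_sel(4) ring_of_type_algebra_sel(5) r_neg)
qed

lemma ring_of_type_algebra_finprod:
  "finite A \<Longrightarrow> finprod (ring_of_type_algebra :: 'a::comm_ring_1 ring) g A = prod g A"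
proof -
  interpret cring "ring_of_type_algebra :: 'a ring" by (rule cring_ring_of_type_algebra)
  show "finite A \<Longrightarrow> ?thesis" by (induction A rule: finite_induct) simp_all
qed

lemma ring_of_type_algebra_finsum:
  "finite A \<Longrightarrow> finsum (ring_of_type_algebra :: 'a::comm_ring_1 ring) g A = sum g A"
proof -
  interpret cring "ring_of_type_algebra :: 'a ring" by (rule cring_ring_of_type_algebra)
  show "finite A \<Longrightarrow> ?thesis" by (induction A rule: finite_induct) simp_all
qed

abbreviation xpow :: "('n \<Rightarrow>\<^sub>0 nat) \<Rightarrow> ('n::{finite,linorder}, 'k::field) mpoly" where
  "xpow e \<equiv> Poly_Mapping.single e 1"

lemma xpow_add: "xpow a * xpow b = xpow (a + b)"
  by (simp add: mult_single)

lemma mpoly_var_power: "mpoly_var i ^ k = xpow (Poly_Mapping.single i k)"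
  by (induction k) (simp_all add: mpoly_var_def mult_single single_add[symmetric])

lemma prod_xpow: "finite A \<Longrightarrow> (\<Prod>i\<in>A. xpow (g i)) = xpow (\<Sum>i\<in>A. g i)"
  by (induction A rule: finite_induct) (simp_all add: mult_single)

lemma mult_set_mpoly_var:
  "mult_set mpoly_ring mpoly_var S = {xpow e :: ('n::{finite,linorder}, 'k::field) mpoly | e. keys e \<subseteq> S}"
proof -
  have 1: "(\<Otimes>\<^bsub>mpoly_ring\<^esub>i\<in>S. mpoly_var i [^]\<^bsub>mpoly_ring\<^esub> (e i :: nat)) =
      (xpow (\<Sum>i\<in>S. Poly_Mapping.single i (e i)) :: ('n, 'k) mpoly)" for e
    by (simp add: ring_of_type_algebra_finprod mpoly_var_power prod_xpow)
  have 2: "keys (\<Sum>i\<in>S. Poly_Mapping.single i (e i :: nat)) \<subseteq> S" for e :: "'n \<Rightarrow> nat"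
    using keys_sum[of "\<lambda>i. Poly_Mapping.single i (e i)" S] by (auto split: if_splits)
  have 3: "e = (\<Sum>i\<in>S. Poly_Mapping.single i (lookup e i))" if "keys e \<subseteq> S" for e :: "'n \<Rightarrow>\<^sub>0 nat"
    by (rule poly_mapping_eqI)
      (use that in \<open>auto simp: lookup_sum lookup_single when_def in_keys_iff\<close>)
  show ?thesis unfolding mult_set_def 1
  proof (intro Set.set_eqI iffI)
    fix p assume "p \<in> {xpow e :: ('n, 'k) mpoly | e. keys e \<subseteq> S}"
    then obtain e where "p = xpow e" "keys e \<subseteq> S" by blast
    thus "p \<in> {xpow (\<Sum>i\<in>S. Poly_Mapping.single i (e i)) |e. True}"
      by (intro CollectI exI[of _ "lookup e"]) (metis 3)
  qed (use 2 in blast)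
qed

section \<open>Laurent exponents\<close>

definition expo :: "('n \<Rightarrow>\<^sub>0 nat) \<Rightarrow> 'n \<Rightarrow> int" where
  "expo b = (\<lambda>i. int (lookup b i))"

lemma expo_inject [simp]: "expo a = expo b \<longleftrightarrow> a = b"
  by (auto simp: expo_def fun_eq_iff intro: poly_mapping_eqI)

lemma expo_add: "expo (a + b) = expo a + expo b"
  by (auto simp: expo_def lookup_add)

lemma expo_0 [simp]: "expo 0 = 0"
  by (auto simp: expo_def)

lemma expo_nonneg [simp]: "0 \<le> expo b i"
  by (simp add: expo_def)

lemma ex_expo:
  fixes z :: "'n::finite \<Rightarrow> int"
  assumes "\<And>i. 0 \<le> z i"
  obtains b where "expo b = z"
proof
  show "expo (Abs_poly_mapping (\<lambda>i. nat (z i))) = z"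
    using assms by (auto simp: expo_def)
qed

lemma keys_expo: "keys e \<subseteq> S \<longleftrightarrow> (\<forall>i. i \<notin> S \<longrightarrow> expo e i = 0)"
  by (auto simp: expo_def in_keys_iff)

text \<open>
  The coefficients are indexed by \<open>\<int>\<^sup>n\<close> and vanish outside \<open>\<nat>\<^sup>n\<close>, which makes multiplication by a
  monomial a shift for all exponents.
\<close>

definition zcoef :: "('n, 'k::field) mpoly \<Rightarrow> ('n \<Rightarrow> int) \<Rightarrow> 'k" where
  "zcoef f z = (\<Sum>b\<in>keys f. if expo b = z then lookup f b else 0)"

lemma zcoef_expo [simp]: "zcoef f (expo b) = lookup f b"
  by (simp add: zcoef_def sum.delta in_keys_iff)

lemma zcoef_neg: "(\<And>b. z \<noteq> expo b) \<Longrightarrow> zcoef f z = 0"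
  unfolding zcoef_def by (rule sum.neutral) auto

lemma zcoef_neg': "z i < 0 \<Longrightarrow> zcoef f z = 0"
  by (rule zcoef_neg) (metis expo_nonneg not_le)

lemma zcoef_nonzeroE:
  assumes "zcoef f z \<noteq> 0"
  obtains b where "b \<in> keys f" "z = expo b"
  using assms zcoef_expo zcoef_neg by (metis in_keys_iff)

lemma zcoef_add: 
  fixes f :: "('n::finite, 'k::field) mpoly"
  shows "zcoef (f + g) z = zcoef f z + zcoef g z"
  by (cases "\<exists>b. z = expo b") (auto simp: lookup_add zcoef_neg)

lemma zcoef_diff: 
  fixes f :: "('n::finite, 'k::field) mpoly"
  shows "zcoef (f - g) z = zcoef f z - zcoef g z"
  by (cases "\<exists>b. z = expo b") (auto simp: lookup_minus zcoef_neg)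

lemma lookup_single_times:
  fixes f :: "('n, 'k::field) mpoly"
  shows "lookup (Poly_Mapping.single c k * f) (c + b) = k * lookup f b"
  unfolding lookup_mult by (auto simp: lookup_single when_mult)

lemma keys_single_times:
  fixes f :: "('n, 'k::field) mpoly"
  shows "keys (Poly_Mapping.single c k * f) \<subseteq> (+) c ` keys f"
  using keys_mult[of "Poly_Mapping.single c k" f] by (auto split: if_splits)

lemma zcoef_single_times:
  fixes f :: "('n::{finite,linorder}, 'k::field) mpoly"
  shows "zcoef (Poly_Mapping.single c k * f) z = k * zcoef f (z - expo c)"
proof (cases "\<exists>b. z - expo c = expo b")
  case True
  then obtain b where b: "z - expo c = expo b" by auto
  hence z: "z = expo (c + b)" by (simp add: expo_add algebra_simps)
  show ?thesis unfolding b unfolding z by (simp add: lookup_single_times)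
next
  case False
  have "zcoef (Poly_Mapping.single c k * f) z = 0"
  proof (rule ccontr)
    assume "zcoef (Poly_Mapping.single c k * f) z \<noteq> 0"
    then obtain b where "b \<in> keys (Poly_Mapping.single c k * f)" "z = expo b"
      by (rule zcoef_nonzeroE)
    then obtain b' where "b = c + b'" using keys_single_times by blast
    with \<open>z = expo b\<close> False show False by (auto simp: expo_add)
  qed
  thus ?thesis using False by (auto simp: zcoef_neg)
qed

lemma zcoef_xpow_times:
  fixes f :: "('n::{finite,linorder}, 'k::field) mpoly"
  shows "zcoef (xpow c * f) (z + expo c) = zcoef f z"
  by (simp add: zcoef_single_times)

lemma poly_mapping_sum_single:
  "f = (\<Sum>c\<in>keys f. Poly_Mapping.single c (lookup f c))"
  by (rule poly_mapping_eqI) (auto simp: lookup_sum lookup_single when_def in_keys_iff)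

lemma zcoef_sum:
  fixes f :: "'a \<Rightarrow> ('n::finite, 'k::field) mpoly"
  shows "zcoef (sum f A) z = (\<Sum>x\<in>A. zcoef (f x) z)"
  by (induction A rule: infinite_finite_induct) (auto simp: zcoef_add zcoef_def[of 0])

lemma zcoef_times:
  fixes f r :: "('n::{finite,linorder}, 'k::field) mpoly"
  shows "zcoef (r * f) z = (\<Sum>c\<in>keys r. lookup r c * zcoef f (z - expo c))"
  by (subst poly_mapping_sum_single[of r]) (simp add: sum_distrib_right zcoef_sum zcoef_single_times)

lemma finite_zcoef: "finite {a. zcoef f (a + d) \<noteq> 0}"
proof (rule finite_subset)
  show "{a. zcoef f (a + d) \<noteq> 0} \<subseteq> (\<lambda>b. expo b - d) ` keys f"
  proof safe
    fix a assume "zcoef f (a + d) \<noteq> 0"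
    then obtain b where "b \<in> keys f" "a + d = expo b" by (rule zcoef_nonzeroE)
    thus "a \<in> (\<lambda>b. expo b - d) ` keys f" by (auto simp: image_iff algebra_simps intro!: bexI[of _ b])
  qed
qed simp

section \<open>Monomial ideals and localizations of their quotients\<close>

definition up_closed :: "('n \<Rightarrow>\<^sub>0 nat) set \<Rightarrow> bool" where
  "up_closed D \<longleftrightarrow> (\<forall>b\<in>D. \<forall>c. b + c \<in> D)"

definition mono_span :: "('n \<Rightarrow>\<^sub>0 nat) set \<Rightarrow> ('n::{finite,linorder}, 'k::field) mpoly set" where
  "mono_span D = {f. keys f \<subseteq> D}"

lemma mono_span_0 [simp]: "0 \<in> mono_span D"
  by (simp add: mono_span_def)

lemma mono_span_uminus [simp]: "- f \<in> mono_span D \<longleftrightarrow> f \<in> mono_span D"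
  by (simp add: mono_span_def subset_iff in_keys_iff)

lemma mono_span_add: "f \<in> mono_span D \<Longrightarrow> g \<in> mono_span D \<Longrightarrow> f + g \<in> mono_span D"
  using keys_add[of f g] by (auto simp: mono_span_def)

lemma mono_span_diff: "f \<in> mono_span D \<Longrightarrow> g \<in> mono_span D \<Longrightarrow> f - g \<in> mono_span D"
  using mono_span_add[of f D "- g"] by simp

lemma mono_span_times:
  assumes "up_closed D" "f \<in> mono_span D"
  shows "r * f \<in> mono_span D"
proof -
  have "b + c \<in> D" if "c \<in> keys f" for b c
  proof -
    have "c \<in> D" using that assms(2) by (auto simp: mono_span_def)
    hence "c + b \<in> D" using assms(1) by (auto simp: up_closed_def)
    thus ?thesis by (simp add: add.commute)
  qed
  thus ?thesis using keys_mult[of r f] by (auto simp: mono_span_def)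
qed

definition coset :: "'a::ab_group_add set \<Rightarrow> 'a \<Rightarrow> 'a set" where
  "coset J f = (\<lambda>h. h + f) ` J"

lemma coset_eq_iff:
  assumes "0 \<in> J" "\<And>x y. x \<in> J \<Longrightarrow> y \<in> J \<Longrightarrow> x - y \<in> J"
  shows "coset J f = coset J g \<longleftrightarrow> f - g \<in> J"
proof
  assume "coset J f = coset J g"
  moreover have "f \<in> coset J f" using assms(1) by (auto simp: coset_def image_iff intro!: bexI[of _ 0])
  ultimately show "f - g \<in> J" by (auto simp: coset_def)
next
  assume fg: "f - g \<in> J"
  have *: "x + y \<in> J" if "x \<in> J" "y \<in> J" for x y
    using assms(2)[OF that(1) assms(2)[OF assms(1) that(2)]] by simp
  show "coset J f = coset J g" unfolding coset_def
  proof (intro Set.set_eqI iffI)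
    fix x assume "x \<in> (\<lambda>h. h + f) ` J"
    then obtain h where "x = h + f" "h \<in> J" by auto
    thus "x \<in> (\<lambda>h. h + g) ` J"
      using *[OF _ fg, of h] by (intro image_eqI[of _ _ "h + (f - g)"]) auto
  next
    fix x assume "x \<in> (\<lambda>h. h + g) ` J"
    then obtain h where "x = h + g" "h \<in> J" by auto
    thus "x \<in> (\<lambda>h. h + f) ` J"
      using assms(2)[OF _ fg, of h] by (intro image_eqI[of _ _ "h - (f - g)"]) auto
  qed
qed

lemma coset_mono_span_eq_iff:
  "coset (mono_span D) f = coset (mono_span D) g \<longleftrightarrow> f - g \<in> mono_span D"
  by (rule coset_eq_iff) (auto intro: mono_span_diff)

abbreviation quot :: "('n \<Rightarrow>\<^sub>0 nat) set \<Rightarrow> (('n::{finite,linorder}, 'k::field) mpoly, ('n, 'k) mpoly set) module"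
  where "quot D \<equiv> quotient_module (self_module mpoly_ring) (mono_span D)"

lemma self_module_sel [simp]:
  "carrier (self_module R) = carrier R"
  "ring.zero (self_module R) = ring.zero R"
  "ring.add (self_module R) = ring.add R"
  "module.smult (self_module R) = monoid.mult R"
  by (simp_all add: self_module_def)

lemma a_r_coset_self [simp]: "J +>\<^bsub>self_module (ring_of_type_algebra :: 'a::comm_ring_1 ring)\<^esub> f = coset J f"
  by (auto simp: a_r_coset_def r_coset_def coset_def)

lemma a_r_coset_add: "J +>\<^bsub>M\<^esub> f = (\<Union>h\<in>J. {h \<oplus>\<^bsub>M\<^esub> f})"
  by (simp add: a_r_coset_def r_coset_def)

lemma quot_carrier: "carrier (quot D :: (('n::{finite,linorder}, 'k::field) mpoly, _) module) = range (coset (mono_span D))"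
proof -
  have "J #>\<^bsub>add_monoid (self_module mpoly_ring)\<^esub> f = coset J f" for J and f :: "('n, 'k) mpoly"
    by (auto simp: r_coset_def coset_def)
  thus ?thesis by (auto simp: quotient_module_def A_RCOSETS_def RCOSETS_def)
qed

lemma quot_zero: "\<zero>\<^bsub>quot D\<^esub> = coset (mono_span D) 0"
  by (simp add: quotient_module_def coset_def)

lemma quot_add: "coset (mono_span D) f \<oplus>\<^bsub>quot D\<^esub> coset (mono_span D) g = coset (mono_span D) (f + g)"
  (is "?l = ?r")
proof -
  have "?l = {x + y | x y. x \<in> coset (mono_span D) f \<and> y \<in> coset (mono_span D) g}"
    by (auto simp: quotient_module_def set_add_def set_mult_def)
  also have "\<dots> = ?r"
  proof (intro Set.set_eqI iffI)
    fix x assume "x \<in> {x + y | x y. x \<in> coset (mono_span D) f \<and> y \<in> coset (mono_span D) g}"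
    then obtain h k where "x = (h + f) + (k + g)" "h \<in> mono_span D" "k \<in> mono_span D"
      by (auto simp: coset_def)
    thus "x \<in> ?r" using mono_span_add[of h D k]
      by (auto simp: coset_def image_iff algebra_simps intro!: bexI[of _ "h + k"])
  next
    fix x assume "x \<in> ?r"
    then obtain h where h: "h \<in> mono_span D" "x = h + (f + g)" by (auto simp: coset_def)
    hence "x = (h + f) + (0 + g)" by (simp add: algebra_simps)
    thus "x \<in> {x + y | x y. x \<in> coset (mono_span D) f \<and> y \<in> coset (mono_span D) g}"
      using h mono_span_0[of D] unfolding coset_def by blast
  qed
  finally show ?thesis .
qed

lemma quot_smult:
  assumes "up_closed D"
  shows "r \<odot>\<^bsub>quot D\<^esub> coset (mono_span D) f = coset (mono_span D) (r * f)"
proof -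
  have "coset (mono_span D) (r * x) = coset (mono_span D) (r * f)" if "x \<in> coset (mono_span D) f" for x
  proof -
    from that obtain h where "x = h + f" "h \<in> mono_span D" unfolding coset_def by blast
    thus ?thesis using mono_span_times[OF assms, of h r]
      by (simp add: coset_mono_span_eq_iff ring_distribs)
  qed
  moreover have "coset (mono_span D) f \<noteq> {}" 
    unfolding coset_def using mono_span_0 by blast
  moreover have "r \<odot>\<^bsub>quot D\<^esub> coset (mono_span D) f = (\<Union>x\<in>coset (mono_span D) f. coset (mono_span D) (r * x))"
    by (simp add: quotient_module_def)
  ultimately show ?thesis by auto
qed

text \<open>
  The localizations in which the Laurent monomial \<open>x\<^sup>a\<close> is a nonzero element of degree \<open>a\<close>: its negative
  exponents must be at invertible variables, and no multiple by invertible variables may lie in the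
  ideal.
\<close>

definition surviving :: "('n \<Rightarrow>\<^sub>0 nat) set \<Rightarrow> ('n \<Rightarrow> int) \<Rightarrow> 'n set set" where
  "surviving D a = {S. {i. a i < 0} \<subseteq> S \<and> (\<forall>b\<in>D. \<forall>c. keys c \<subseteq> S \<longrightarrow> expo b \<noteq> a + expo c)}"

text \<open>
  The localization of \<open>R/J\<close> at the variables in \<open>S\<close>, in coordinates: a fraction is determined by its
  coefficients at the Laurent monomials that are nonzero there.  The isomorphism is \<open>frac_class\<close>.
\<close>

definition laurent :: "('n \<Rightarrow>\<^sub>0 nat) set \<Rightarrow> 'n set \<Rightarrow> (('n \<Rightarrow> int) \<Rightarrow> 'k::field) set" where
  "laurent D S = {\<phi>. finite {a. \<phi> a \<noteq> 0} \<and> (\<forall>a. \<phi> a \<noteq> 0 \<longrightarrow> S \<in> surviving D a)}"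

text \<open>
  The coefficients of the fraction \<open>f/x\<^sup>e\<close>.
\<close>

definition frac_coef :: "('n \<Rightarrow>\<^sub>0 nat) set \<Rightarrow> 'n set \<Rightarrow> ('n, 'k::field) mpoly \<Rightarrow> ('n \<Rightarrow>\<^sub>0 nat) \<Rightarrow> ('n \<Rightarrow> int) \<Rightarrow> 'k" where
  "frac_coef D S f e a = (if S \<in> surviving D a then zcoef f (a + expo e) else 0)"

definition frac_class :: "('n \<Rightarrow>\<^sub>0 nat) set \<Rightarrow> 'n set \<Rightarrow> (('n \<Rightarrow> int) \<Rightarrow> 'k)
    \<Rightarrow> (('n::{finite,linorder}, 'k::field) mpoly set \<times> ('n, 'k) mpoly) set" where
  "frac_class D S \<phi> = {(coset (mono_span D) f, xpow e) | f e. keys e \<subseteq> S \<and> frac_coef D S f e = \<phi>}"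

lemma frac_coef_laurent: "frac_coef D S f e \<in> laurent D S"
  unfolding laurent_def
  by (auto simp: frac_coef_def intro: finite_subset[OF _ finite_zcoef[of f "expo e"]])

lemma laurent_finite_support: "\<phi> \<in> laurent D S \<Longrightarrow> finite {a. \<phi> a \<noteq> 0}"
  by (simp add: laurent_def)

lemma laurent_surviving: "\<phi> \<in> laurent D S \<Longrightarrow> \<phi> a \<noteq> 0 \<Longrightarrow> S \<in> surviving D a"
  by (simp add: laurent_def)

lemma laurent_0 [simp]: "0 \<in> laurent D S"
  by (simp add: laurent_def)

lemma laurent_add: "\<phi> \<in> laurent D S \<Longrightarrow> \<psi> \<in> laurent D S \<Longrightarrow> \<phi> + \<psi> \<in> laurent D S"
  unfolding laurent_def
  by (auto intro: finite_subset[of _ "{a. \<phi> a \<noteq> 0} \<union> {a. \<psi> a \<noteq> 0}"])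
     (metis add.right_neutral)

lemma laurent_uminus: "\<phi> \<in> laurent D S \<Longrightarrow> - \<phi> \<in> laurent D S"
  by (auto simp: laurent_def)

lemma survivingD: "S \<in> surviving D a \<Longrightarrow> keys c \<subseteq> S \<Longrightarrow> b \<in> D \<Longrightarrow> a + expo c \<noteq> expo b"
  unfolding surviving_def by (metis (mono_tags, lifting) mem_Collect_eq)

lemma surviving_antimono_neg: "S \<subseteq> T \<Longrightarrow> {i. a i < 0} \<subseteq> S \<Longrightarrow> T \<in> surviving D a \<Longrightarrow> S \<in> surviving D a"
  by (auto simp: surviving_def)

text \<open>
  Division by \<open>x\<^sup>c\<close> cannot move a monomial into an ideal, so it can only create negative exponents.
\<close>

lemma surviving_minus:
  fixes D :: "('n \<Rightarrow>\<^sub>0 nat) set"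
  assumes "up_closed D" "S \<in> surviving D a" "{i. a i - expo c i < 0} \<subseteq> S"
  shows "S \<in> surviving D (a - expo c)"
  unfolding surviving_def
proof (intro CollectI conjI ballI allI impI)
  fix b and d :: "'n \<Rightarrow>\<^sub>0 nat" assume b: "b \<in> D" "keys d \<subseteq> S"
  have "b + c \<in> D" using assms(1) b by (auto simp: up_closed_def)
  hence "expo (b + c) \<noteq> a + expo d" using assms(2) b by (auto simp: surviving_def)
  thus "expo b \<noteq> a - expo c + expo d" by (auto simp: expo_add algebra_simps)
qed (use assms in simp)

lemma zcoef_outside_S:
  assumes "keys e \<subseteq> S" "\<not> {i. a i < 0} \<subseteq> S"
  shows "zcoef f (a + expo e) = 0"
proof -
  obtain i where "a i < 0" "i \<notin> S" using assms(2) by auto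
  hence "(a + expo e) i < 0" using assms(1) by (simp add: keys_expo)
  thus ?thesis by (rule zcoef_neg')
qed

text \<open>
  A sufficiently high power of the variables in \<open>S\<close> is a common denominator: the exponents outside \<open>S\<close> are
  nonnegative on the support of \<open>\<phi>\<close>.
\<close>

lemma frac_coef_surj:
  assumes "\<phi> \<in> laurent D S"
  obtains f e where "keys e \<subseteq> S" "frac_coef D S f e = (\<phi> :: ('n::{finite,linorder} \<Rightarrow> int) \<Rightarrow> 'k::field)"
proof -
  define A where "A = {a. \<phi> a \<noteq> 0}"
  have fin: "finite A" using assms by (simp add: A_def laurent_def)
  define z :: "'n \<Rightarrow> int" where "z = (\<lambda>i. if i \<in> S then \<Sum>a\<in>A. \<bar>a i\<bar> else 0)"
  have "0 \<le> z i" for i by (auto simp: z_def sum_nonneg)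
  then obtain e where e: "expo e = z" using ex_expo by blast
  have keys: "keys e \<subseteq> S" unfolding keys_expo e by (simp add: z_def)
  have "\<exists>b. expo b = a + z" if "a \<in> A" for a
  proof -
    have "0 \<le> (a + z) i" for i
    proof (cases "i \<in> S")
      case True
      have "\<bar>a i\<bar> \<le> (\<Sum>a\<in>A. \<bar>a i\<bar>)" by (rule member_le_sum) (use that fin in auto)
      thus ?thesis using True by (auto simp: z_def)
    next
      case False
      thus ?thesis using that laurent_surviving[OF assms, of a] by (force simp: A_def z_def surviving_def)
    qed
    thus ?thesis using ex_expo by metis
  qed
  then obtain g where g: "\<And>a. a \<in> A \<Longrightarrow> expo (g a) = a + z" by metis
  define f where "f = (\<Sum>a\<in>A. Poly_Mapping.single (g a) (\<phi> a))"
  have "zcoef f (a + z) = \<phi> a" for a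
  proof -
    have "zcoef (Poly_Mapping.single (g x) (\<phi> x)) (a + z) = (if x = a then \<phi> a else 0)" if "x \<in> A" for x
      using g[OF that] that by (auto simp: zcoef_def A_def)
    hence "zcoef f (a + z) = (\<Sum>x\<in>A. if x = a then \<phi> a else 0)"
      unfolding f_def zcoef_sum by (intro sum.cong) auto
    thus ?thesis using fin by (simp add: A_def)
  qed
  hence "frac_coef D S f e = \<phi>"
    using laurent_surviving[OF assms] by (auto simp: frac_coef_def e fun_eq_iff)
  with keys that show ?thesis by blast
qed

lemma frac_class_inject:
  assumes "\<phi> \<in> laurent D S" "\<psi> \<in> laurent D S" "up_closed D"
  shows "frac_class D S \<phi> = frac_class D S \<psi> \<longleftrightarrow> \<phi> = \<psi>"
proof
  assume eq: "frac_class D S \<phi> = frac_class D S \<psi>"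
  obtain f e where fe: "keys e \<subseteq> S" "frac_coef D S f e = \<phi>" by (rule frac_coef_surj[OF assms(1)])
  hence "(coset (mono_span D) f, xpow e) \<in> frac_class D S \<psi>" 
    unfolding eq[symmetric] by (auto simp: frac_class_def)
  then obtain f' e' where f': "coset (mono_span D) f = coset (mono_span D) f'"
     "(xpow e :: ('a, 'b) mpoly) = xpow e'" "frac_coef D S f' e' = \<psi>"
    by (auto simp: frac_class_def)
  have "e = e'" using f'(2) by (metis keys_single singletonD singletonI zero_neq_one)
  moreover have "frac_coef D S f e = frac_coef D S f' e"
  proof
    fix a
    have d: "f - f' \<in> mono_span D" using f'(1) by (simp add: coset_mono_span_eq_iff)
    show "frac_coef D S f e a = frac_coef D S f' e a"
    proof (cases "S \<in> surviving D a")
      case True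
      have "zcoef (f - f') (a + expo e) = 0"
      proof (rule ccontr)
        assume "zcoef (f - f') (a + expo e) \<noteq> 0"
        then obtain b where "b \<in> keys (f - f')" "a + expo e = expo b" by (rule zcoef_nonzeroE)
        moreover have "b \<in> D" using \<open>b \<in> _\<close> d by (auto simp: mono_span_def)
        ultimately show False using survivingD[OF True fe(1)] by blast
      qed
      thus ?thesis using True by (simp add: frac_coef_def zcoef_diff)
    qed (simp add: frac_coef_def)
  qed
  ultimately show "\<phi> = \<psi>" using fe f' by simp
qed simp

abbreviation cech_loc :: "('n \<Rightarrow>\<^sub>0 nat) set \<Rightarrow> 'n set \<Rightarrow>
   (('n::{finite,linorder}, 'k::field) mpoly, (('n, 'k) mpoly set \<times> ('n, 'k) mpoly) set) module" where
  "cech_loc D S \<equiv> cech_summand mpoly_ring mpoly_var (quot D) S"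

text \<open>
  The difference \<open>x\<^bsup>e'\<^esup> f - x\<^sup>e f'\<close> is annihilated in the localization if and only if none of its monomials
  survives there.  For the converse, the monomials that carry the single terms into the ideal are
  multiplied together.
\<close>

lemma fraction_eq_iff:
  fixes f f' :: "('n::{finite,linorder}, 'k::field) mpoly"
  assumes D: "up_closed D" and e: "keys e \<subseteq> S" "keys e' \<subseteq> S"
  shows "(\<exists>c. keys c \<subseteq> S \<and> xpow c * (xpow e' * f - xpow e * f') \<in> mono_span D) \<longleftrightarrow>
     frac_coef D S f e = frac_coef D S f' e'"
proof -
  define g where "g = xpow e' * f - xpow e * f'"
  have g: "zcoef g z = zcoef f (z - expo e') - zcoef f' (z - expo e)" for z
    by (simp add: g_def zcoef_diff zcoef_single_times)
  show ?thesis unfolding g_def[symmetric]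
  proof
    assume "\<exists>c. keys c \<subseteq> S \<and> xpow c * g \<in> mono_span D"
    then obtain c where c: "keys c \<subseteq> S" "xpow c * g \<in> mono_span D" by blast
    show "frac_coef D S f e = frac_coef D S f' e'"
    proof
      fix a
      show "frac_coef D S f e a = frac_coef D S f' e' a"
      proof (cases "S \<in> surviving D a")
        case True
        have "zcoef (xpow c * g) (a + expo (e + e' + c)) = 0"
        proof (rule ccontr)
          assume "zcoef (xpow c * g) (a + expo (e + e' + c)) \<noteq> 0"
          then obtain b where b: "b \<in> keys (xpow c * g)" "a + expo (e + e' + c) = expo b"
            by (rule zcoef_nonzeroE)
          have "keys (e + e' + c) \<subseteq> S" using e c(1) by (simp add: keys_expo expo_add)
          moreover have "b \<in> D" using b(1) c(2) by (auto simp: mono_span_def)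
          ultimately show False using survivingD[OF True] b(2) by blast
        qed
        moreover have "zcoef (xpow c * g) (a + expo (e + e' + c)) = zcoef g (a + expo (e + e'))"
          using zcoef_xpow_times[of c g "a + expo (e + e')"] by (simp add: expo_add add.assoc)
        moreover have "zcoef (xpow e' * f) (a + expo (e + e')) = zcoef f (a + expo e)"
          using zcoef_xpow_times[of e' f "a + expo e"] by (simp add: expo_add add.assoc)
        moreover have "zcoef (xpow e * f') (a + expo (e + e')) = zcoef f' (a + expo e')"
          using zcoef_xpow_times[of e f' "a + expo e'"] by (simp add: expo_add add_ac)
        ultimately show ?thesis using True by (simp add: frac_coef_def g_def zcoef_diff)
      qed (simp add: frac_coef_def)
    qed
  next
    assume eq: "frac_coef D S f e = frac_coef D S f' e'"
    have "\<exists>c. keys c \<subseteq> S \<and> b + c \<in> D" if b: "b \<in> keys g" for b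
    proof -
      define a where "a = expo b - expo e - expo e'"
      have ab: "expo b - expo e' = a + expo e" "expo b - expo e = a + expo e'" by (simp_all add: a_def)
      have "zcoef g (expo b) \<noteq> 0" using b by (simp add: in_keys_iff)
      hence "zcoef f (a + expo e) \<noteq> zcoef f' (a + expo e')"
        unfolding g ab by simp
      moreover have "frac_coef D S f e a = frac_coef D S f' e' a" using eq by simp
      ultimately have ns: "S \<notin> surviving D a" by (auto simp: frac_coef_def)
      have "{i. a i < 0} \<subseteq> S"
      proof
        fix i assume "i \<in> {i. a i < 0}"
        show "i \<in> S"
        proof (rule ccontr)
          assume "i \<notin> S"
          hence "expo e i = 0" "expo e' i = 0" using e by (simp_all add: keys_expo)
          thus False using \<open>i \<in> _\<close> by (simp add: a_def) (metis expo_nonneg not_le)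
        qed
      qed
      with ns obtain d c where dc: "d \<in> D" "keys c \<subseteq> S" "expo d = a + expo c" by (auto simp: surviving_def)
      have "expo (d + (e + e')) = expo (b + c)" by (simp add: expo_add dc a_def)
      hence "b + c = d + (e + e')" by simp
      hence "b + c \<in> D" using D dc(1) by (simp add: up_closed_def)
      thus ?thesis using dc by blast
    qed
    then obtain c where c: "\<And>b. b \<in> keys g \<Longrightarrow> keys (c b) \<subseteq> S \<and> b + c b \<in> D" by metis
    define C where "C = (\<Sum>b\<in>keys g. c b)"
    have "keys C \<subseteq> S" using keys_sum[of c "keys g"] c unfolding C_def by blast
    moreover have "xpow C * g \<in> mono_span D"
    proof -
      have "C + b \<in> D" if "b \<in> keys g" for b
      proof -
        have "C + b = (b + c b) + (\<Sum>b\<in>keys g - {b}. c b)"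
          unfolding C_def using that by (simp add: sum.remove[of _ b] algebra_simps)
        thus ?thesis using c[OF that] D by (auto simp: up_closed_def)
      qed
      thus ?thesis using keys_single_times[of C 1 g] by (auto simp: mono_span_def)
    qed
    ultimately show "\<exists>c. keys c \<subseteq> S \<and> xpow c * g \<in> mono_span D" by blast
  qed
qed

lemma quot_smult2:
  assumes D: "up_closed D"
  shows "t \<odot>\<^bsub>quot D\<^esub> (s \<odot>\<^bsub>quot D\<^esub> coset (mono_span D) f) = coset (mono_span D) (t * (s * f))"
  by (simp add: quot_smult[OF D])

lemma fraction_quot:
  fixes f :: "('n::{finite,linorder}, 'k::field) mpoly"
  assumes D: "up_closed D" and e: "keys e \<subseteq> S"
  shows "fraction mpoly_ring (quot D) (mult_set mpoly_ring mpoly_var S) (coset (mono_span D) f) (xpow e)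
     = frac_class D S (frac_coef D S f e)"
proof -
  let ?J = "mono_span D :: ('n, 'k) mpoly set"
  have key: "(\<exists>t\<in>{xpow c | c. keys c \<subseteq> S}. t \<odot>\<^bsub>quot D\<^esub> (xpow e' \<odot>\<^bsub>quot D\<^esub> coset ?J f) =
       t \<odot>\<^bsub>quot D\<^esub> (xpow e \<odot>\<^bsub>quot D\<^esub> coset ?J f')) \<longleftrightarrow> frac_coef D S f e = frac_coef D S f' e'"
    if e': "keys e' \<subseteq> S" for f' e'
    unfolding fraction_eq_iff[OF D e e', symmetric] 
    by (auto simp: quot_smult2[OF D] coset_mono_span_eq_iff right_diff_distrib)
  show ?thesis
    unfolding fraction_def mult_set_mpoly_var frac_class_def quot_carrier
  proof (intro Set.set_eqI iffI, goal_cases)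
    case (1 x)
    then obtain f' e' where x: "x = (coset ?J f', xpow e')" "keys e' \<subseteq> S"
      "\<exists>t\<in>{xpow c | c. keys c \<subseteq> S}. t \<odot>\<^bsub>quot D\<^esub> (xpow e' \<odot>\<^bsub>quot D\<^esub> coset ?J f) =
       t \<odot>\<^bsub>quot D\<^esub> (xpow e \<odot>\<^bsub>quot D\<^esub> coset ?J f')"
      by auto
    from key[OF x(2), of f'] x(3) have "frac_coef D S f e = frac_coef D S f' e'" by simp
    with x(1,2) show ?case by auto
  next
    case (2 x)
    then obtain f' e' where x: "x = (coset ?J f', xpow e')" "keys e' \<subseteq> S" "frac_coef D S f' e' = frac_coef D S f e"
      by auto
    from key[OF x(2), of f'] x show ?case by auto
  qed
qed

lemma frac_class_nonempty:
  assumes "\<phi> \<in> laurent D S"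
  shows "\<exists>x. x \<in> frac_class D S \<phi>"
proof -
  obtain f e where "keys e \<subseteq> S" "frac_coef D S f e = \<phi>" by (rule frac_coef_surj[OF assms])
  thus ?thesis unfolding frac_class_def by blast
qed

lemma cech_loc_carrier:
  assumes D: "up_closed D"
  shows "carrier (cech_loc D S) = frac_class D S ` laurent D S"
proof (intro Set.set_eqI iffI)
  fix x assume "x \<in> carrier (cech_loc D S)"
  then obtain f e where "keys e \<subseteq> S" "x = frac_class D S (frac_coef D S f e)"
    by (auto simp: localization_def mult_set_mpoly_var quot_carrier fraction_quot[OF D, unfolded mult_set_mpoly_var])
  thus "x \<in> frac_class D S ` laurent D S" using frac_coef_laurent by blast
next
  fix x assume "x \<in> frac_class D S ` laurent D S"
  then obtain \<phi> where "x = frac_class D S \<phi>" "\<phi> \<in> laurent D S" by blast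
  moreover obtain f e where "keys e \<subseteq> S" "frac_coef D S f e = \<phi>"
    by (rule frac_coef_surj[OF \<open>\<phi> \<in> laurent D S\<close>])
  ultimately have "x = fraction mpoly_ring (quot D) (mult_set mpoly_ring mpoly_var S) (coset (mono_span D) f) (xpow e)"
    "coset (mono_span D) f \<in> carrier (quot D)" "xpow e \<in> mult_set mpoly_ring mpoly_var S"
    by (simp_all add: fraction_quot[OF D] quot_carrier) (auto simp: mult_set_mpoly_var)
  thus "x \<in> carrier (cech_loc D S)" unfolding localization_def by auto
qed

text \<open>
  The operations on fractions are unions over all representatives, which all contribute the same class.
\<close>

lemma UN_constant_on: "A \<noteq> {} \<Longrightarrow> (\<And>x. x \<in> A \<Longrightarrow> f x = c) \<Longrightarrow> (\<Union>x\<in>A. f x) = c"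
  by auto

lemma frac_classE:
  assumes "x \<in> frac_class D S \<phi>"
  obtains f e where "x = (coset (mono_span D) f, xpow e)" "keys e \<subseteq> S" "frac_coef D S f e = \<phi>"
  using assms by (auto simp: frac_class_def)

lemma cech_loc_add:
  assumes D: "up_closed D" and \<phi>: "\<phi> \<in> laurent D S" and \<psi>: "\<psi> \<in> laurent D S"
  shows "frac_class D S \<phi> \<oplus>\<^bsub>cech_loc D S\<^esub> frac_class D S \<psi> = frac_class D S (\<phi> + \<psi>)"
proof -
  have "(case x of (m, s) \<Rightarrow> \<Union>(m', s')\<in>frac_class D S \<psi>.
      fraction mpoly_ring (quot D) (mult_set mpoly_ring mpoly_var S)
       ((s' \<odot>\<^bsub>quot D\<^esub> m) \<oplus>\<^bsub>quot D\<^esub> (s \<odot>\<^bsub>quot D\<^esub> m')) (s \<otimes>\<^bsub>mpoly_ring\<^esub> s')) = frac_class D S (\<phi> + \<psi>)"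
    if x: "x \<in> frac_class D S \<phi>" for x
  proof -
    obtain f e where x: "x = (coset (mono_span D) f, xpow e)" "keys e \<subseteq> S" "frac_coef D S f e = \<phi>"
      by (rule frac_classE[OF x])
    have "(case y of (m', s') \<Rightarrow> fraction mpoly_ring (quot D) (mult_set mpoly_ring mpoly_var S)
       ((s' \<odot>\<^bsub>quot D\<^esub> coset (mono_span D) f) \<oplus>\<^bsub>quot D\<^esub> (xpow e \<odot>\<^bsub>quot D\<^esub> m')) (xpow e \<otimes>\<^bsub>mpoly_ring\<^esub> s')) = frac_class D S (\<phi> + \<psi>)"
      if y: "y \<in> frac_class D S \<psi>" for y
    proof -
      obtain f' e' where y: "y = (coset (mono_span D) f', xpow e')" "keys e' \<subseteq> S" "frac_coef D S f' e' = \<psi>"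
        by (rule frac_classE[OF y])
      have k: "keys (e + e') \<subseteq> S" using x(2) y(2) by (simp add: keys_expo expo_add)
      have "frac_coef D S (xpow e' * f + xpow e * f') (e + e') = \<phi> + \<psi>"
      proof
        fix a
        have "zcoef (xpow e' * f) (a + expo (e + e')) = zcoef f (a + expo e)"
          using zcoef_xpow_times[of e' f "a + expo e"] by (simp add: expo_add add.assoc)
        moreover have "zcoef (xpow e * f') (a + expo (e + e')) = zcoef f' (a + expo e')"
          using zcoef_xpow_times[of e f' "a + expo e'"] by (simp add: expo_add add_ac)
        ultimately show "frac_coef D S (xpow e' * f + xpow e * f') (e + e') a = (\<phi> + \<psi>) a"
          unfolding x(3)[symmetric] y(3)[symmetric]
          by (simp add: frac_coef_def zcoef_add)
      qed
      thus ?thesis using fraction_quot[OF D k, of "xpow e' * f + xpow e * f'"]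
        by (simp add: y(1) quot_smult[OF D] quot_add xpow_add)
    qed
    thus ?thesis unfolding x(1) prod.case using frac_class_nonempty[OF \<psi>]
      by (intro UN_constant_on) auto
  qed
  moreover have "frac_class D S \<phi> \<oplus>\<^bsub>cech_loc D S\<^esub> frac_class D S \<psi> =
     (\<Union>x\<in>frac_class D S \<phi>. case x of (m, s) \<Rightarrow> \<Union>(m', s')\<in>frac_class D S \<psi>.
      fraction mpoly_ring (quot D) (mult_set mpoly_ring mpoly_var S)
       ((s' \<odot>\<^bsub>quot D\<^esub> m) \<oplus>\<^bsub>quot D\<^esub> (s \<odot>\<^bsub>quot D\<^esub> m')) (s \<otimes>\<^bsub>mpoly_ring\<^esub> s'))"
    by (simp add: localization_def)
  ultimately show ?thesis using frac_class_nonempty[OF \<phi>] UN_constant_on[of "frac_class D S \<phi>"]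
    by (metis (no_types, lifting) empty_iff)
qed

text \<open>
  Multiplication of Laurent polynomials, followed by discarding the monomials that vanish in the
  localization.
\<close>

definition laurent_smult :: "('n \<Rightarrow>\<^sub>0 nat) set \<Rightarrow> 'n set \<Rightarrow> ('n, 'k::field) mpoly \<Rightarrow> (('n \<Rightarrow> int) \<Rightarrow> 'k) \<Rightarrow> ('n \<Rightarrow> int) \<Rightarrow> 'k" where
  "laurent_smult D S r \<phi> a = (if S \<in> surviving D a then \<Sum>c\<in>keys r. lookup r c * \<phi> (a - expo c) else 0)"

text \<open>
  The monomials that were discarded from the fraction contribute nothing to the product: their multiples
  vanish as well.
\<close>

lemma laurent_smult_frac_coef:
  fixes r f :: "('n::{finite,linorder}, 'k::field) mpoly"
  assumes D: "up_closed D" and e: "keys e \<subseteq> S"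
  shows "laurent_smult D S r (frac_coef D S f e) = frac_coef D S (r * f) e"
proof
  fix a
  have "frac_coef D S f e (a - expo c) = zcoef f (a + expo e - expo c)" if a: "S \<in> surviving D a" for c
  proof (cases "{i. a i - expo c i < 0} \<subseteq> S")
    case True
    hence "S \<in> surviving D (a - expo c)" using surviving_minus[OF D a] by blast
    thus ?thesis by (simp add: frac_coef_def algebra_simps)
  next
    case False
    hence "zcoef f ((a - expo c) + expo e) = 0" by (intro zcoef_outside_S[OF e]) simp
    thus ?thesis by (simp add: frac_coef_def algebra_simps)
  qed
  thus "laurent_smult D S r (frac_coef D S f e) a = frac_coef D S (r * f) e a"
    by (cases "S \<in> surviving D a") (simp_all add: laurent_smult_def frac_coef_def[of D S "r * f"] zcoef_times)
qed

lemma laurent_smult_closed: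
  fixes r :: "('n::{finite,linorder}, 'k::field) mpoly"
  assumes D: "up_closed D" and "\<phi> \<in> laurent D S"
  shows "laurent_smult D S r \<phi> \<in> laurent D S"
proof -
  obtain f e where "keys e \<subseteq> S" "frac_coef D S f e = \<phi>" by (rule frac_coef_surj[OF assms(2)])
  thus ?thesis using laurent_smult_frac_coef[OF D, of e S r f] frac_coef_laurent by metis
qed

lemma cech_loc_smult:
  assumes D: "up_closed D" and \<phi>: "\<phi> \<in> laurent D S"
  shows "r \<odot>\<^bsub>cech_loc D S\<^esub> frac_class D S \<phi> = frac_class D S (laurent_smult D S r \<phi>)"
proof -
  have "(case x of (m, s) \<Rightarrow> fraction mpoly_ring (quot D) (mult_set mpoly_ring mpoly_var S)
       (r \<odot>\<^bsub>quot D\<^esub> m) s) = frac_class D S (laurent_smult D S r \<phi>)"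
    if x: "x \<in> frac_class D S \<phi>" for x
  proof -
    obtain f e where x: "x = (coset (mono_span D) f, xpow e)" "keys e \<subseteq> S" "frac_coef D S f e = \<phi>"
      by (rule frac_classE[OF x])
    show ?thesis using fraction_quot[OF D x(2), of "r * f"] x(3)
      by (auto simp: x(1) quot_smult[OF D] laurent_smult_frac_coef[OF D x(2), symmetric])
  qed
  moreover have "r \<odot>\<^bsub>cech_loc D S\<^esub> frac_class D S \<phi> = (\<Union>x\<in>frac_class D S \<phi>. case x of (m, s) \<Rightarrow>
      fraction mpoly_ring (quot D) (mult_set mpoly_ring mpoly_var S) (r \<odot>\<^bsub>quot D\<^esub> m) s)"
    by (simp add: localization_def)
  ultimately show ?thesis using frac_class_nonempty[OF \<phi>] UN_constant_on[of "frac_class D S \<phi>"]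
    by (metis (no_types, lifting) empty_iff)
qed

lemma cech_loc_zero:
  assumes D: "up_closed D"
  shows "\<zero>\<^bsub>cech_loc D S\<^esub> = (frac_class D S 0 :: (('n::{finite,linorder}, 'k::field) mpoly set \<times> _) set)"
proof -
  have "frac_coef D S (0 :: ('n, 'k) mpoly) 0 = 0" by (auto simp: frac_coef_def fun_eq_iff zcoef_def)
  thus ?thesis using fraction_quot[OF D, of 0 S "0 :: ('n, 'k) mpoly"]
    by (simp add: localization_def quot_zero)
qed

definition laurent_restrict :: "('n \<Rightarrow>\<^sub>0 nat) set \<Rightarrow> 'n set \<Rightarrow> (('n \<Rightarrow> int) \<Rightarrow> 'k::field) \<Rightarrow> ('n \<Rightarrow> int) \<Rightarrow> 'k" where
  "laurent_restrict D T \<phi> a = (if T \<in> surviving D a then \<phi> a else 0)"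

lemma laurent_restrict_closed:
  assumes "\<phi> \<in> laurent D S" 
  shows "laurent_restrict D T \<phi> \<in> laurent D T"
  using assms unfolding laurent_def laurent_restrict_def by (auto elim: rev_finite_subset)

lemma cech_loc_map:
  assumes D: "up_closed D" and \<phi>: "\<phi> \<in> laurent D S" and ST: "S \<subseteq> T"
  shows "localization_map mpoly_ring (quot D) (mult_set mpoly_ring mpoly_var T) (frac_class D S \<phi>)
     = (frac_class D T (laurent_restrict D T \<phi>) :: (('n::{finite,linorder}, 'k::field) mpoly set \<times> _) set)"
proof -
  have "(case x of (m, s) \<Rightarrow> fraction mpoly_ring (quot D) (mult_set mpoly_ring mpoly_var T) m s)
     = frac_class D T (laurent_restrict D T \<phi>)"
    if x: "x \<in> frac_class D S \<phi>" for x
  proof -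
    obtain f e where x: "x = (coset (mono_span D) f, xpow e)" "keys e \<subseteq> S" "frac_coef D S f e = \<phi>"
      by (rule frac_classE[OF x])
    have "frac_coef D T f e a = laurent_restrict D T \<phi> a" for a
      using surviving_antimono_neg[OF ST, of a D] zcoef_outside_S[OF x(2), of a f]
      by (auto simp: x(3)[symmetric] laurent_restrict_def frac_coef_def)
    hence "frac_coef D T f e = laurent_restrict D T \<phi>" by blast
    thus ?thesis using fraction_quot[OF D, of e T f] x(2) ST by (auto simp: x(1))
  qed
  thus ?thesis using frac_class_nonempty[OF \<phi>] UN_constant_on[of "frac_class D S \<phi>"]
    unfolding localization_map_def by (metis (no_types, lifting) empty_iff)
qed

section \<open>The Cech complex in coordinates\<close>

text \<open>
  The value at \<open>S\<close> and \<open>a\<close> is the coefficient at \<open>x\<^sup>a\<close> of the component in the localization at the variables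
  in \<open>S\<close>.
\<close>

type_synonym ('n, 'k) cochain = "'n set \<Rightarrow> ('n \<Rightarrow> int) \<Rightarrow> 'k"

text \<open>
  The components at sets of the wrong cardinality are fixed to \<open>0\<close>, so that \<open>cochain_class\<close> is injective.
\<close>

definition cochains :: "('n::finite \<Rightarrow>\<^sub>0 nat) set \<Rightarrow> nat \<Rightarrow> ('n, 'k::field) cochain set" where
  "cochains D j = {c. \<forall>S. (card S = j \<longrightarrow> c S \<in> laurent D S) \<and> (card S \<noteq> j \<longrightarrow> c S = 0)}"

definition cochain_class :: "('n \<Rightarrow>\<^sub>0 nat) set \<Rightarrow> nat \<Rightarrow> ('n::{finite,linorder}, 'k::field) cochain
    \<Rightarrow> 'n set \<Rightarrow> (('n, 'k) mpoly set \<times> ('n, 'k) mpoly) set" where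
  "cochain_class D j c = (\<lambda>S\<in>{S. card S = j}. frac_class D S (c S))"

definition csign :: "'n::linorder set \<Rightarrow> 'n \<Rightarrow> 'k::field" where
  "csign T i = (- 1) ^ card {l \<in> T. l < i}"

definition codiff :: "('n \<Rightarrow>\<^sub>0 nat) set \<Rightarrow> nat \<Rightarrow> ('n::{finite,linorder}, 'k::field) cochain \<Rightarrow> ('n, 'k) cochain" where
  "codiff D j c T a = (if card T = Suc j \<and> T \<in> surviving D a then \<Sum>i\<in>T. csign T i * c (T - {i}) a else 0)"

definition cochain_smult :: "('n \<Rightarrow>\<^sub>0 nat) set \<Rightarrow> ('n::{finite,linorder}, 'k::field) mpoly \<Rightarrow> ('n, 'k) cochain \<Rightarrow> ('n, 'k) cochain" where
  "cochain_smult D r c S = laurent_smult D S r (c S)"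

lemma cochains_0 [simp]: "0 \<in> cochains D j"
  by (simp add: cochains_def)

lemma cochains_add: "c \<in> cochains D j \<Longrightarrow> d \<in> cochains D j \<Longrightarrow> c + d \<in> cochains D j"
  by (simp add: cochains_def laurent_add)

lemma cochains_uminus: "c \<in> cochains D j \<Longrightarrow> - c \<in> cochains D j"
  by (simp add: cochains_def laurent_uminus)

lemma laurent_smult_0 [simp]: "laurent_smult D S r 0 = 0"
  by (auto simp: laurent_smult_def fun_eq_iff)

lemma cochains_smult: "up_closed D \<Longrightarrow> c \<in> cochains D j \<Longrightarrow> cochain_smult D r c \<in> cochains D j"
  by (simp add: cochains_def laurent_smult_closed cochain_smult_def)

abbreviation cech_mod :: "('n \<Rightarrow>\<^sub>0 nat) set \<Rightarrow> nat \<Rightarrow>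
   (('n::{finite,linorder}, 'k::field) mpoly, 'n set \<Rightarrow> (('n, 'k) mpoly set \<times> ('n, 'k) mpoly) set) module" where
  "cech_mod D j \<equiv> cech_module mpoly_ring mpoly_var (quot D) j"

lemma cech_mod_carrier:
  assumes D: "up_closed D"
  shows "carrier (cech_mod D j) = cochain_class D j ` cochains D j"
proof (intro Set.set_eqI iffI)
  fix x :: "'a set \<Rightarrow> (('a, 'b) mpoly set \<times> ('a, 'b) mpoly) set"
  assume "x \<in> carrier (cech_mod D j)"
  hence x: "x \<in> (\<Pi>\<^sub>E S\<in>{S. card S = j}. frac_class D S ` laurent D S)"
    by (simp add: cech_module_def cech_loc_carrier[OF D])
  hence "\<forall>S. \<exists>\<phi>. card S = j \<longrightarrow> \<phi> \<in> laurent D S \<and> x S = frac_class D S \<phi>" 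
    by (auto simp: PiE_def Pi_def image_iff Bex_def)
  then obtain c where c: "\<And>S. card S = j \<Longrightarrow> c S \<in> laurent D S \<and> x S = frac_class D S (c S)"
    by metis
  define d where "d = (\<lambda>S. if card S = j then c S else 0)"
  have "d \<in> cochains D j" using c by (simp add: cochains_def d_def)
  moreover have "x = cochain_class D j d"
    unfolding cochain_class_def by (rule ext) (use x c in \<open>auto simp: d_def PiE_def extensional_def\<close>)
  ultimately show "x \<in> cochain_class D j ` cochains D j" by blast
next
  fix x :: "'a set \<Rightarrow> (('a, 'b) mpoly set \<times> ('a, 'b) mpoly) set"
  assume "x \<in> cochain_class D j ` cochains D j"
  thus "x \<in> carrier (cech_mod D j)"
    by (auto simp: cech_module_def cech_loc_carrier[OF D] cochain_class_def cochains_def)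
qed

lemma cochain_class_inject:
  assumes D: "up_closed D" and c: "c \<in> cochains D j" and d: "d \<in> cochains D j"
  shows "cochain_class D j c = cochain_class D j d \<longleftrightarrow> c = d"
proof
  assume eq: "cochain_class D j c = cochain_class D j d"
  show "c = d"
  proof
    fix S show "c S = d S"
    proof (cases "card S = j")
      case True
      hence "frac_class D S (c S) = frac_class D S (d S)" using fun_cong[OF eq, of S] by (simp add: cochain_class_def)
      thus ?thesis using c d True D by (simp add: frac_class_inject cochains_def)
    qed (use c d in \<open>simp add: cochains_def\<close>)
  qed
qed simp

lemma cochain_class_add:
  assumes D: "up_closed D" and c: "c \<in> cochains D j" and d: "d \<in> cochains D j"
  shows "cochain_class D j c \<oplus>\<^bsub>cech_mod D j\<^esub> cochain_class D j d = cochain_class D j (c + d)"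
  using c d by (auto simp: cech_module_def cochain_class_def cech_loc_add[OF D] cochains_def fun_eq_iff)

lemma cochain_class_smult:
  assumes D: "up_closed D" and c: "c \<in> cochains D j"
  shows "r \<odot>\<^bsub>cech_mod D j\<^esub> cochain_class D j c = cochain_class D j (cochain_smult D r c)"
  using c by (auto simp: cech_module_def cochain_class_def cech_loc_smult[OF D] cochains_def fun_eq_iff cochain_smult_def)

lemma cochain_class_zero:
  assumes D: "up_closed D"
  shows "\<zero>\<^bsub>cech_mod D j\<^esub> = cochain_class D j 0"
  by (auto simp: cech_module_def cochain_class_def cech_loc_zero[OF D] fun_eq_iff)

text \<open>
  This provides the laws for the finite sum in the Cech differential.
\<close>

lemma abelian_monoid_cech_loc:
  assumes D: "up_closed D"
  shows "abelian_monoid (cech_loc D S :: (('n::{finite,linorder}, 'k::field) mpoly, _) module)"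
proof (rule abelian_monoidI, goal_cases)
  case (1 x y) thus ?case by (auto simp: cech_loc_carrier[OF D] cech_loc_add[OF D] laurent_add)
next
  case 2 thus ?case by (auto simp: cech_loc_carrier[OF D] cech_loc_zero[OF D])
next
  case (3 x y z) thus ?case by (auto simp: cech_loc_carrier[OF D] cech_loc_add[OF D] laurent_add add.assoc)
next
  case (4 x)
  then obtain \<phi> where \<phi>: "\<phi> \<in> laurent D S" "x = frac_class D S \<phi>" by (auto simp: cech_loc_carrier[OF D])
  show ?case using cech_loc_add[OF D laurent_0 \<phi>(1)] by (simp add: \<phi>(2) cech_loc_zero[OF D])
next
  case (5 x y) thus ?case by (auto simp: cech_loc_carrier[OF D] cech_loc_add[OF D] laurent_add add.commute)
qed

lemma laurent_sum: "(\<And>i. i \<in> A \<Longrightarrow> g i \<in> laurent D S) \<Longrightarrow> sum g A \<in> laurent D S"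
  by (induction A rule: infinite_finite_induct) (auto intro: laurent_add)

lemma finsum_cech_loc:
  assumes D: "up_closed D" and "finite A" "\<And>i. i \<in> A \<Longrightarrow> g i \<in> laurent D S"
  shows "finsum (cech_loc D S) (\<lambda>i. frac_class D S (g i)) A = 
     (frac_class D S (sum g A) :: (('n::{finite,linorder}, 'k::field) mpoly set \<times> _) set)"
proof -
  interpret abelian_monoid "cech_loc D S :: (('n::{finite,linorder}, 'k::field) mpoly, _) module"
    by (rule abelian_monoid_cech_loc[OF D])
  show ?thesis using assms(2,3)
  proof (induction A rule: finite_induct)
    case empty thus ?case by (simp add: cech_loc_zero[OF D] zero_fun_def)
  next
    case (insert i A)
    thus ?case
      by (subst finsum_insert) (auto simp: cech_loc_carrier[OF D] cech_loc_add[OF D] laurent_sum)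
  qed
qed

lemma laurent_smult_const:
  fixes D :: "('n::{finite,linorder} \<Rightarrow>\<^sub>0 nat) set" and k :: "'k::field"
  assumes "\<phi> \<in> laurent D S"
  shows "laurent_smult D S (Poly_Mapping.single 0 k) \<phi> = (\<lambda>a. k * \<phi> a)"
  using laurent_surviving[OF assms] by (auto simp: laurent_smult_def fun_eq_iff)

lemma power_minus_one_single: "(- 1) ^ m = (Poly_Mapping.single 0 ((- 1) ^ m) :: ('n::{finite,linorder}, 'k::field) mpoly)"
  by (induction m) (simp_all add: mult_single single_uminus)

lemma fun_sum_apply [simp]: "(sum f A) x = (\<Sum>i\<in>A. f i x)"
  by (induction A rule: infinite_finite_induct) auto

lemma laurent_scale: "\<phi> \<in> laurent D S \<Longrightarrow> (\<lambda>a. k * \<phi> a) \<in> laurent D S"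
  unfolding laurent_def by (auto elim: rev_finite_subset)

lemma cech_diff_cochain_class:
  fixes c :: "('n::{finite,linorder}, 'k::field) cochain"
  assumes D: "up_closed D" and c: "c \<in> cochains D j"
  shows "cech_diff mpoly_ring mpoly_var (quot D) j (cochain_class D j c) = cochain_class D (Suc j) (codiff D j c)"
proof
  fix T :: "'n set"
  show "cech_diff mpoly_ring mpoly_var (quot D) j (cochain_class D j c) T = cochain_class D (Suc j) (codiff D j c) T"
  proof (cases "card T = Suc j")
    case True
    define g where "g i = (\<lambda>a. csign T i * laurent_restrict D T (c (T - {i})) a)" for i
    have ci: "c (T - {i}) \<in> laurent D (T - {i})" "card (T - {i}) = j" if "i \<in> T" for i
      using c that True by (auto simp: cochains_def)
    have g: "g i \<in> laurent D T" if "i \<in> T" for i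
      unfolding g_def using laurent_scale laurent_restrict_closed[OF ci(1)[OF that]] by blast
    have eq: "((\<ominus>\<^bsub>mpoly_ring\<^esub> \<one>\<^bsub>mpoly_ring\<^esub>) [^]\<^bsub>mpoly_ring\<^esub> card {l \<in> T. l < i})
            \<odot>\<^bsub>cech_loc D T\<^esub> localization_map mpoly_ring (quot D) (mult_set mpoly_ring mpoly_var T) (cochain_class D j c (T - {i}))
         = frac_class D T (g i)" if "i \<in> T" for i
    proof -
      have "localization_map mpoly_ring (quot D) (mult_set mpoly_ring mpoly_var T) (cochain_class D j c (T - {i}))
        = frac_class D T (laurent_restrict D T (c (T - {i})))"
        using cech_loc_map[OF D ci(1)[OF that], of T] ci(2)[OF that] by (simp add: cochain_class_def)
      thus ?thesis
        using laurent_restrict_closed[OF ci(1)[OF that], of T]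
        by (simp add: cech_loc_smult[OF D] power_minus_one_single laurent_smult_const g_def csign_def)
    qed
    have "cech_diff mpoly_ring mpoly_var (quot D) j (cochain_class D j c) T = finsum (cech_loc D T) (\<lambda>i. frac_class D T (g i)) T"
    proof -
      interpret abelian_monoid "cech_loc D T :: (('n::{finite,linorder}, 'k::field) mpoly, _) module"
        by (rule abelian_monoid_cech_loc[OF D])
      show ?thesis unfolding cech_diff_def using True g
        by (simp del: ring_of_type_algebra_sel ring_of_type_algebra_a_inv ring_of_type_algebra_pow add: True cong: restrict_cong)
           (intro finsum_cong', auto simp del: ring_of_type_algebra_sel ring_of_type_algebra_a_inv ring_of_type_algebra_pow simp: eq cech_loc_carrier[OF D])
    qed
    also have "\<dots> = frac_class D T (sum g T)"
      by (rule finsum_cech_loc[OF D]) (use g in auto)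
    also have "sum g T = codiff D j c T"
      by (auto simp: fun_eq_iff codiff_def True g_def laurent_restrict_def)
    finally show ?thesis using True by (simp add: cochain_class_def[of D "Suc j"])
  qed (simp add: cech_diff_def cochain_class_def)
qed

lemma codiff_closed:
  assumes c: "c \<in> cochains D j"
  shows "codiff D j c \<in> cochains D (Suc j)"
  unfolding cochains_def
proof (intro CollectI allI conjI impI)
  fix T :: "'a set" assume T: "card T = Suc j"
  have "(\<Sum>i\<in>T. (\<lambda>a. csign T i * laurent_restrict D T (c (T - {i})) a)) \<in> laurent D T"
  proof (rule laurent_sum)
    fix i assume "i \<in> T"
    hence "c (T - {i}) \<in> laurent D (T - {i})" using c T by (auto simp: cochains_def)
    thus "(\<lambda>a. csign T i * laurent_restrict D T (c (T - {i})) a) \<in> laurent D T"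
      using laurent_scale laurent_restrict_closed by blast
  qed
  also have "(\<Sum>i\<in>T. (\<lambda>a. csign T i * laurent_restrict D T (c (T - {i})) a)) = codiff D j c T"
    by (auto simp: fun_eq_iff codiff_def T laurent_restrict_def)
  finally show "codiff D j c T \<in> laurent D T" .
qed (auto simp: codiff_def fun_eq_iff)

definition cocycles :: "('n \<Rightarrow>\<^sub>0 nat) set \<Rightarrow> nat \<Rightarrow> ('n::{finite,linorder}, 'k::field) cochain set" where
  "cocycles D j = {c \<in> cochains D j. codiff D j c = 0}"

definition coboundaries :: "('n \<Rightarrow>\<^sub>0 nat) set \<Rightarrow> nat \<Rightarrow> ('n::{finite,linorder}, 'k::field) cochain set" where
  "coboundaries D j = (case j of 0 \<Rightarrow> {0} | Suc i \<Rightarrow> codiff D i ` cochains D i)"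

lemma cech_cocycles_eq:
  assumes D: "up_closed D"
  shows "cech_cocycles mpoly_ring mpoly_var (quot D) j = cochain_class D j ` cocycles D j"
proof -
  have "cech_diff mpoly_ring mpoly_var (quot D) j (cochain_class D j c) = \<zero>\<^bsub>cech_mod D (Suc j)\<^esub> \<longleftrightarrow> codiff D j c = 0"
    if "c \<in> cochains D j" for c :: "('a, 'b) cochain"
    using cochain_class_inject[OF D codiff_closed[OF that] cochains_0]
    by (simp add: cochain_class_zero[OF D] cech_diff_cochain_class[OF D that])
  thus ?thesis unfolding cech_cocycles_def cocycles_def cech_mod_carrier[OF D] by auto
qed

lemma cech_coboundaries_eq:
  assumes D: "up_closed D"
  shows "cech_coboundaries mpoly_ring mpoly_var (quot D) j = cochain_class D j ` coboundaries D j"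
proof (cases j)
  case 0
  thus ?thesis by (simp add: cech_coboundaries_def coboundaries_def cochain_class_zero[OF D])
next
  case (Suc i)
  thus ?thesis by (auto simp add: cech_coboundaries_def coboundaries_def cech_mod_carrier[OF D]
     cech_diff_cochain_class[OF D] image_image)
qed

section \<open>Length of a quotient module\<close>

text \<open>
  Submodules of an additive group on which scalars act; the module laws hold on the cocycles only.
\<close>

definition act_stable :: "('r \<Rightarrow> 'c \<Rightarrow> 'c::ab_group_add) \<Rightarrow> 'c set \<Rightarrow> bool" where
  "act_stable act N \<longleftrightarrow> 0 \<in> N \<and> (\<forall>x\<in>N. \<forall>y\<in>N. x + y \<in> N) \<and> (\<forall>x\<in>N. - x \<in> N) \<and> (\<forall>r. \<forall>x\<in>N. act r x \<in> N)"

definition stable_chain :: "('r \<Rightarrow> 'c \<Rightarrow> 'c::ab_group_add) \<Rightarrow> 'c set \<Rightarrow> 'c set \<Rightarrow> nat \<Rightarrow> (nat \<Rightarrow> 'c set) \<Rightarrow> bool" where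
  "stable_chain act B Z k N \<longleftrightarrow> (\<forall>j\<le>k. B \<subseteq> N j \<and> N j \<subseteq> Z \<and> act_stable act (N j)) \<and> (\<forall>j<k. N j \<subset> N (Suc j))"

lemma stable_diff: "act_stable act N \<Longrightarrow> x \<in> N \<Longrightarrow> y \<in> N \<Longrightarrow> x - y \<in> N"
  unfolding act_stable_def by (metis diff_conv_add_uminus)

text \<open>
  Inverse images under \<open>\<pi>\<close> turn chains of submodules of \<open>Q \<cong> Z/B\<close> into chains of stable sets between \<open>B\<close>
  and \<open>Z\<close>, and images turn them back.  The scalar \<open>m\<close> acts as \<open>-1\<close>; it gives closure under
  negation.
\<close>

lemma module_length_transfer:
  fixes \<pi> :: "'c::ab_group_add \<Rightarrow> 'b" and Q :: "('a, 'b, 'm) module_scheme" and R :: "('a, 'r) ring_scheme"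
  assumes R: "carrier R = UNIV"
    and carrier: "carrier Q = \<pi> ` Z" and zero: "\<zero>\<^bsub>Q\<^esub> = \<pi> 0"
    and add: "\<And>x y. x \<in> Z \<Longrightarrow> y \<in> Z \<Longrightarrow> \<pi> x \<oplus>\<^bsub>Q\<^esub> \<pi> y = \<pi> (x + y)"
    and smult: "\<And>r x. x \<in> Z \<Longrightarrow> r \<odot>\<^bsub>Q\<^esub> \<pi> x = \<pi> (act r x)"
    and eq: "\<And>x y. x \<in> Z \<Longrightarrow> y \<in> Z \<Longrightarrow> \<pi> x = \<pi> y \<longleftrightarrow> x - y \<in> B"
    and Z: "act_stable act Z" and B: "B \<subseteq> Z"
    and neg: "\<And>x. x \<in> Z \<Longrightarrow> act m x = - x"
  shows "module_length R Q = Sup {enat k | k. \<exists>N. stable_chain act B Z k N}"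
proof -
  have Z0: "0 \<in> Z" and Zadd: "\<And>x y. x \<in> Z \<Longrightarrow> y \<in> Z \<Longrightarrow> x + y \<in> Z" and Zneg: "\<And>x. x \<in> Z \<Longrightarrow> - x \<in> Z"
    using Z by (auto simp: act_stable_def)
  have inv: "inv\<^bsub>add_monoid Q\<^esub> (\<pi> x) = \<pi> (- x)" if x: "x \<in> Z" for x
    unfolding m_inv_def
  proof (rule the_equality, goal_cases)
    case 1 show ?case using x Zneg by (simp add: carrier add zero)
  next
    case (2 y)
    then obtain y' where y': "y' \<in> Z" "y = \<pi> y'" using carrier by auto
    with 2 have "\<pi> (x + y') = \<pi> 0" by (simp add: add x zero)
    hence "x + y' - 0 \<in> B" using eq[OF Zadd[OF x y'(1)] Z0] by simp
    hence "y' - (- x) \<in> B" by (simp add: add.commute)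
    thus ?case using eq[OF y'(1) Zneg[OF x]] y'(2) by simp
  qed
  have 1: "\<exists>N'. stable_chain act B Z k N'"
    if N: "\<forall>j\<le>k. submodule (N j) R Q" "\<forall>j<k. N j \<subset> N (Suc j)" for N k
  proof
    show "stable_chain act B Z k (\<lambda>j. {z \<in> Z. \<pi> z \<in> N j})"
      unfolding stable_chain_def
    proof (intro conjI allI impI)
      fix j assume "j \<le> k"
      then interpret submodule "N j" R Q using N by auto
      have N0: "\<pi> 0 \<in> N j" using one_closed by (simp add: zero)
      show "B \<subseteq> {z \<in> Z. \<pi> z \<in> N j}"
      proof
        fix b assume b: "b \<in> B"
        hence bZ: "b \<in> Z" using B by blast
        have "\<pi> b = \<pi> 0" using eq[OF bZ Z0] b by simp
        thus "b \<in> {z \<in> Z. \<pi> z \<in> N j}" using bZ N0 by simp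
      qed
      have act: "\<pi> (act r x) \<in> N j" if "x \<in> Z" "\<pi> x \<in> N j" for r x
        using smult_closed[OF _ that(2), of r] smult[OF that(1), of r] R by simp
      show "act_stable act {z \<in> Z. \<pi> z \<in> N j}"
        unfolding act_stable_def
      proof (intro conjI ballI allI)
        fix x y assume "x \<in> {z \<in> Z. \<pi> z \<in> N j}" "y \<in> {z \<in> Z. \<pi> z \<in> N j}"
        thus "x + y \<in> {z \<in> Z. \<pi> z \<in> N j}" 
          using m_closed[of "\<pi> x" "\<pi> y"] add[of x y] Zadd by simp
      next
        fix x assume "x \<in> {z \<in> Z. \<pi> z \<in> N j}"
        thus "- x \<in> {z \<in> Z. \<pi> z \<in> N j}" using act[of x m] neg[of x] Zneg by simp
      next
        fix x r assume "x \<in> {z \<in> Z. \<pi> z \<in> N j}"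
        thus "act r x \<in> {z \<in> Z. \<pi> z \<in> N j}" using act Z by (auto simp: act_stable_def)
      qed (use N0 Z0 in auto)
    next
      fix j assume j: "j < k"
      then obtain q where q: "q \<in> N (Suc j)" "q \<notin> N j" using N(2) by blast
      interpret submodule "N (Suc j)" R Q using N j by auto
      have "q \<in> carrier Q" using q subset by auto
      then obtain z where "z \<in> Z" "q = \<pi> z" using carrier by auto
      thus "{z \<in> Z. \<pi> z \<in> N j} \<subset> {z \<in> Z. \<pi> z \<in> N (Suc j)}" using q N(2) j by blast
    qed auto
  qed
  have 2: "\<exists>N. (\<forall>j\<le>k. submodule (N j) R Q) \<and> (\<forall>j<k. N j \<subset> N (Suc j))"
    if N: "stable_chain act B Z k N'" for N' k
  proof (intro exI[of _ "\<lambda>j. \<pi> ` N' j"] conjI allI impI)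
    fix j assume "j \<le> k"
    hence j: "B \<subseteq> N' j" "N' j \<subseteq> Z" "act_stable act (N' j)" using N by (auto simp: stable_chain_def)
    have inZ: "x \<in> Z" if "x \<in> N' j" for x using that j by blast
    show "submodule (\<pi> ` N' j) R Q"
    proof (intro submodule.intro subgroup.intro submodule_axioms.intro)
      show "\<pi> ` N' j \<subseteq> carrier (add_monoid Q)" using j carrier by auto
      show "x \<otimes>\<^bsub>add_monoid Q\<^esub> y \<in> \<pi> ` N' j" if "x \<in> \<pi> ` N' j" "y \<in> \<pi> ` N' j" for x y
        using that j(3) by (auto simp: add inZ act_stable_def)
      show "\<one>\<^bsub>add_monoid Q\<^esub> \<in> \<pi> ` N' j" using j(3) by (auto simp: zero act_stable_def)
      show "inv\<^bsub>add_monoid Q\<^esub> x \<in> \<pi> ` N' j" if "x \<in> \<pi> ` N' j" for x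
        using that j(3) by (auto simp: inv inZ act_stable_def)
      show "r \<odot>\<^bsub>Q\<^esub> x \<in> \<pi> ` N' j" if "x \<in> \<pi> ` N' j" for r x
        using that j(3) by (auto simp: smult inZ act_stable_def)
    qed
  next
    fix j assume jk: "j < k"
    then obtain z where z: "z \<in> N' (Suc j)" "z \<notin> N' j" using N unfolding stable_chain_def by blast
    have j: "B \<subseteq> N' j" "N' j \<subseteq> Z" "act_stable act (N' j)" "N' j \<subseteq> N' (Suc j)" "N' (Suc j) \<subseteq> Z"
      using N jk by (auto simp: stable_chain_def)
    have "\<pi> z \<notin> \<pi> ` N' j"
    proof
      assume "\<pi> z \<in> \<pi> ` N' j"
      then obtain w where w: "w \<in> N' j" "\<pi> z = \<pi> w" by auto
      hence "z - w \<in> N' j" using eq[of z w] z j by auto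
      hence "z - w + w \<in> N' j" using w j(3) unfolding act_stable_def by blast
      thus False using z by simp
    qed
    thus "\<pi> ` N' j \<subset> \<pi> ` N' (Suc j)" using z j by blast
  qed
  have "(\<exists>N. (\<forall>j\<le>k. submodule (N j) R Q) \<and> (\<forall>j<k. N j \<subset> N (Suc j))) \<longleftrightarrow>
      (\<exists>N. stable_chain act B Z k N)" for k
    by (rule iffI; elim exE conjE) (erule (1) 1, erule 2)
  thus ?thesis unfolding module_length_def by simp
qed

section \<open>Local cohomology as a quotient of cochains\<close>

text \<open>
  If a larger set \<open>T\<close> survives, then \<open>S\<close> can fail to survive only because of a negative exponent outside
  \<open>S\<close>, and then every term of the sum vanishes.  So the differential can be compared with the
  action term by term.
\<close>

lemma laurent_smult_eq_sum:
  fixes D :: "('n::{finite,linorder} \<Rightarrow>\<^sub>0 nat) set"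
  assumes \<phi>: "\<phi> \<in> laurent D S" and "S \<subseteq> T" "T \<in> surviving D a"
  shows "laurent_smult D S r \<phi> a = (\<Sum>c\<in>keys r. lookup r c * \<phi> (a - expo c))"
proof (cases "S \<in> surviving D a")
  case False
  hence "\<not> {i. a i < 0} \<subseteq> S" using surviving_antimono_neg assms(2,3) by blast
  then obtain i where i: "a i < 0" "i \<notin> S" by auto
  have "\<phi> (a - expo c) = 0" for c
  proof (rule ccontr)
    assume "\<phi> (a - expo c) \<noteq> 0"
    hence "S \<in> surviving D (a - expo c)" using \<phi> laurent_surviving by blast
    moreover have "(a - expo c) i < 0" using order.strict_trans2[OF i(1) expo_nonneg[of c i]] by simp
    ultimately show False using i(2) by (auto simp: surviving_def)
  qed
  thus ?thesis using False by (simp add: laurent_smult_def)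
qed (simp add: laurent_smult_def)

lemma cochains_laurent: "c \<in> cochains D j \<Longrightarrow> c S \<in> laurent D S"
  by (cases "card S = j") (auto simp: cochains_def)

lemma cochain_smult_eq_sum:
  assumes "c \<in> cochains D j" and "S \<subseteq> T" "T \<in> surviving D a"
  shows "cochain_smult D r c S a = (\<Sum>d\<in>keys r. lookup r d * c S (a - expo d))"
  unfolding cochain_smult_def by (rule laurent_smult_eq_sum[OF cochains_laurent assms(2,3)]) (rule assms(1))

lemma cochain_smult_not_surviving: "S \<notin> surviving D a \<Longrightarrow> cochain_smult D r c S a = 0"
  by (simp add: cochain_smult_def laurent_smult_def)

lemma codiff_smult:
  assumes D: "up_closed D" and c: "c \<in> cochains D j"
  shows "codiff D j (cochain_smult D r c) = cochain_smult D r (codiff D j c)"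
proof (intro ext)
  fix T a
  show "codiff D j (cochain_smult D r c) T a = cochain_smult D r (codiff D j c) T a"
  proof (cases "T \<in> surviving D a \<and> card T = Suc j")
    case False
    thus ?thesis
      by (auto simp: codiff_def cochain_smult_not_surviving) (simp add: cochain_smult_def laurent_smult_def codiff_def)
  next
    case True
    have *: "codiff D j c T (a - expo d) = (\<Sum>i\<in>T. csign T i * c (T - {i}) (a - expo d))" for d
    proof (cases "T \<in> surviving D (a - expo d)")
      case False
      have n: "\<not> {i. (a - expo d) i < 0} \<subseteq> T" using surviving_minus[OF D, of T a d] True False by auto
      have "c (T - {i}) (a - expo d) = 0" for i
      proof (rule ccontr)
        assume "c (T - {i}) (a - expo d) \<noteq> 0"
        hence "T - {i} \<in> surviving D (a - expo d)" using laurent_surviving[OF cochains_laurent[OF c]] by blast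
        thus False using n by (auto simp: surviving_def)
      qed
      thus ?thesis using False by (simp add: codiff_def)
    qed (use True in \<open>simp add: codiff_def\<close>)
    have "codiff D j (cochain_smult D r c) T a = (\<Sum>i\<in>T. csign T i * (\<Sum>d\<in>keys r. lookup r d * c (T - {i}) (a - expo d)))"
      using True by (simp add: codiff_def cochain_smult_eq_sum[OF c, of "T - {_}" T])
    also have "\<dots> = (\<Sum>d\<in>keys r. lookup r d * (\<Sum>i\<in>T. csign T i * c (T - {i}) (a - expo d)))"
      unfolding sum_distrib_left by (subst sum.swap) (simp add: mult_ac)
    also have "\<dots> = cochain_smult D r (codiff D j c) T a"
      using True by (simp add: cochain_smult_eq_sum[OF codiff_closed[OF c], of T T] *)
    finally show ?thesis .
  qed
qed

lemma cochain_smult_add: "cochain_smult D r (c + d) = cochain_smult D r c + cochain_smult D r d"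
  by (auto simp: fun_eq_iff cochain_smult_def laurent_smult_def ring_distribs sum.distrib)

lemma cochain_smult_0 [simp]: "cochain_smult D r 0 = 0"
  by (auto simp: fun_eq_iff cochain_smult_def laurent_smult_def)

lemma codiff_0 [simp]: "codiff D j 0 = 0"
  by (auto simp: fun_eq_iff codiff_def)

lemma codiff_add: "codiff D j (c + d) = codiff D j c + codiff D j d"
  by (auto simp: fun_eq_iff codiff_def ring_distribs sum.distrib)

lemma codiff_uminus: "codiff D j (- c) = - codiff D j c"
  by (auto simp: fun_eq_iff codiff_def sum_negf)

lemma stable_cocycles:
  assumes D: "up_closed D"
  shows "act_stable (cochain_smult D) (cocycles D j)"
  unfolding act_stable_def cocycles_def
  by (auto simp: cochains_add cochains_uminus codiff_add codiff_uminus cochains_smult[OF D] codiff_smult[OF D])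

lemma stable_coboundaries:
  fixes D :: "('n::{finite,linorder} \<Rightarrow>\<^sub>0 nat) set"
  assumes D: "up_closed D"
  shows "act_stable (cochain_smult D) (coboundaries D j :: ('n, 'k::field) cochain set)"
proof (cases j)
  case (Suc i)
  have cb: "coboundaries D j = codiff D i ` cochains D i" by (simp add: coboundaries_def Suc)
  show ?thesis unfolding act_stable_def cb
  proof (intro conjI ballI allI; (elim imageE)?)
    show "0 \<in> codiff D i ` cochains D i" by (rule image_eqI[of _ _ 0]) simp_all
  next
    fix x y c d :: "('n, 'k) cochain" assume "x = codiff D i c" "c \<in> cochains D i" "y = codiff D i d" "d \<in> cochains D i"
    thus "x + y \<in> codiff D i ` cochains D i"
      by (intro image_eqI[of _ _ "c + d"]) (simp_all add: codiff_add cochains_add)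
  next
    fix x c :: "('n, 'k) cochain" assume "x = codiff D i c" "c \<in> cochains D i"
    thus "- x \<in> codiff D i ` cochains D i"
      by (intro image_eqI[of _ _ "- c"]) (simp_all add: codiff_uminus cochains_uminus)
  next
    fix x c :: "('n, 'k) cochain" and r assume "x = codiff D i c" "c \<in> cochains D i"
    thus "cochain_smult D r x \<in> codiff D i ` cochains D i"
      by (intro image_eqI[of _ _ "cochain_smult D r c"]) (simp_all add: codiff_smult[OF D] cochains_smult[OF D])
  qed
qed (simp add: act_stable_def coboundaries_def)


lemma quotient_module_sel:
  "carrier (quotient_module M N) = a_rcosets\<^bsub>M\<^esub> N"
  "ring.zero (quotient_module M N) = N"
  "ring.add (quotient_module M N) = set_add M"
  "module.smult (quotient_module M N) = (\<lambda>r A. \<Union>x\<in>A. N +>\<^bsub>M\<^esub> (r \<odot>\<^bsub>M\<^esub> x))"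
  by (simp_all add: quotient_module_def)

text \<open>
  Two cocycles represent the same class if their difference is a coboundary; this difference is again a
  cocycle, whence the intersection.
\<close>

lemma local_cohomology_length_chains:
  fixes D :: "('n::{finite,linorder} \<Rightarrow>\<^sub>0 nat) set"
  assumes D: "up_closed D"
  shows "local_cohomology_length j (mono_span D :: ('n, 'k::field) mpoly set) =
    Sup {enat k | k. \<exists>N. stable_chain (cochain_smult D)
       (coboundaries D j \<inter> cocycles D j :: ('n, 'k) cochain set) (cocycles D j) k N}"
proof -
  let ?B = "coboundaries D j :: ('n, 'k) cochain set" and ?Z = "cocycles D j :: ('n, 'k) cochain set"
  define M :: "(('n, 'k) mpoly, _) module" where "M = (cech_mod D j)\<lparr>carrier := cochain_class D j ` ?Z\<rparr>"
  define \<pi> where "\<pi> z = cochain_class D j ` (\<lambda>b. b + z) ` ?B" for z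
  have stB: "act_stable (cochain_smult D) ?B" and stZ: "act_stable (cochain_smult D) ?Z"
    by (rule stable_coboundaries[OF D], rule stable_cocycles[OF D])
  have Bc: "b \<in> cochains D j" if "b \<in> ?B" for b
    using that by (cases j) (auto simp: coboundaries_def codiff_closed)
  have Zc: "z \<in> cochains D j" if "z \<in> ?Z" for z
    using that by (simp add: cocycles_def)
  have B0: "0 \<in> ?B" using stB by (simp add: act_stable_def)
  have Badd: "b + b' \<in> ?B" if "b \<in> ?B" "b' \<in> ?B" for b b' using stB that by (simp add: act_stable_def)
  have Bdiff: "b - b' \<in> ?B" if "b \<in> ?B" "b' \<in> ?B" for b b' using stable_diff[OF stB] that by blast
  have coset: "cochain_class D j ` ?B +>\<^bsub>M\<^esub> cochain_class D j z = \<pi> z" if z: "z \<in> cochains D j" for z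
    using Bc z by (auto simp: a_r_coset_add M_def \<pi>_def cochain_class_add[OF D] image_iff)
  have lc: "local_cohomology_quotient j (mono_span D) = quotient_module M (cochain_class D j ` ?B)"
    unfolding local_cohomology_def M_def cech_cocycles_eq[OF D] cech_coboundaries_eq[OF D] ..
  show ?thesis unfolding local_cohomology_length_def lc
  proof (rule module_length_transfer[where \<pi> = \<pi> and m = "- 1"])
    show "carrier (quotient_module M (cochain_class D j ` ?B)) = \<pi> ` ?Z"
    proof -
      have "a_rcosets\<^bsub>M\<^esub> (cochain_class D j ` ?B) = (\<lambda>a. cochain_class D j ` ?B +>\<^bsub>M\<^esub> a) ` carrier M"
        by (auto simp: A_RCOSETS_def RCOSETS_def a_r_coset_def)
      also have "\<dots> = \<pi> ` ?Z" using coset Zc by (auto simp: M_def image_iff Bex_def)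
      finally show ?thesis by (simp add: quotient_module_sel)
    qed
    show "\<zero>\<^bsub>quotient_module M (cochain_class D j ` ?B)\<^esub> = \<pi> 0" by (simp add: quotient_module_sel \<pi>_def)
  next
    fix x y assume x: "x \<in> ?Z" and y: "y \<in> ?Z"
    show "\<pi> x \<oplus>\<^bsub>quotient_module M (cochain_class D j ` ?B)\<^esub> \<pi> y = \<pi> (x + y)"
    proof -
      have "\<pi> x \<oplus>\<^bsub>quotient_module M (cochain_class D j ` ?B)\<^esub> \<pi> y =
        {p \<oplus>\<^bsub>M\<^esub> q | p q. p \<in> \<pi> x \<and> q \<in> \<pi> y}"
        by (auto simp: quotient_module_sel set_add_def set_mult_def)
      also have "\<dots> = {cochain_class D j ((b + x) + (b' + y)) | b b'. b \<in> ?B \<and> b' \<in> ?B}"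
      proof -
        have "cochain_class D j (b + x) \<oplus>\<^bsub>M\<^esub> cochain_class D j (b' + y) = cochain_class D j ((b + x) + (b' + y))"
          if "b \<in> ?B" "b' \<in> ?B" for b b'
          using cochain_class_add[OF D cochains_add[OF Bc[OF that(1)] Zc[OF x]] cochains_add[OF Bc[OF that(2)] Zc[OF y]]]
          by (simp add: M_def)
        note * = this
        show ?thesis
        proof (intro Set.set_eqI iffI)
          fix p assume "p \<in> {p \<oplus>\<^bsub>M\<^esub> q | p q. p \<in> \<pi> x \<and> q \<in> \<pi> y}"
          then obtain b b' where "b \<in> ?B" "b' \<in> ?B" 
            "p = cochain_class D j (b + x) \<oplus>\<^bsub>M\<^esub> cochain_class D j (b' + y)" unfolding \<pi>_def by blast
          thus "p \<in> {cochain_class D j ((b + x) + (b' + y)) | b b'. b \<in> ?B \<and> b' \<in> ?B}" using *[of b b'] by blast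
        next
          fix p assume "p \<in> {cochain_class D j ((b + x) + (b' + y)) | b b'. b \<in> ?B \<and> b' \<in> ?B}"
          then obtain b b' where b: "b \<in> ?B" "b' \<in> ?B" "p = cochain_class D j ((b + x) + (b' + y))" by blast
          have "p = cochain_class D j (b + x) \<oplus>\<^bsub>M\<^esub> cochain_class D j (b' + y)" using *[OF b(1,2)] b(3) by simp
          moreover have "cochain_class D j (b + x) \<in> \<pi> x" "cochain_class D j (b' + y) \<in> \<pi> y" 
            using b(1,2) unfolding \<pi>_def by auto
          ultimately show "p \<in> {p \<oplus>\<^bsub>M\<^esub> q | p q. p \<in> \<pi> x \<and> q \<in> \<pi> y}" by blast
        qed
      qed
      also have "\<dots> = \<pi> (x + y)"
      proof (intro Set.set_eqI iffI)
        fix p assume "p \<in> {cochain_class D j ((b + x) + (b' + y)) | b b'. b \<in> ?B \<and> b' \<in> ?B}"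
        then obtain b b' where p: "p = cochain_class D j ((b + x) + (b' + y))" "b \<in> ?B" "b' \<in> ?B" by blast
        have "p = cochain_class D j ((b + b') + (x + y))" unfolding p(1) by (simp add: add_ac)
        thus "p \<in> \<pi> (x + y)" using Badd[OF p(2,3)] unfolding \<pi>_def by blast
      next
        fix p assume "p \<in> \<pi> (x + y)"
        then obtain b where p: "p = cochain_class D j (b + (x + y))" "b \<in> ?B" unfolding \<pi>_def by blast
        have "p = cochain_class D j ((b + x) + (0 + y))" unfolding p(1) by (simp add: add_ac)
        thus "p \<in> {cochain_class D j ((b + x) + (b' + y)) | b b'. b \<in> ?B \<and> b' \<in> ?B}" using p(2) B0 by blast
      qed
      finally show ?thesis .
    qed
    show "\<pi> x = \<pi> y \<longleftrightarrow> x - y \<in> ?B \<inter> ?Z"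
    proof -
      have "inj_on (cochain_class D j) (cochains D j :: ('n, 'k) cochain set)" by (intro inj_onI) (simp add: cochain_class_inject[OF D])
      hence "\<pi> x = \<pi> y \<longleftrightarrow> (\<lambda>b. b + x) ` ?B = (\<lambda>b. b + y) ` ?B"
        unfolding \<pi>_def by (rule inj_on_image_eq_iff) (use Bc Zc[OF x] Zc[OF y] in \<open>auto intro: cochains_add\<close>)
      also have "\<dots> \<longleftrightarrow> x - y \<in> ?B"
        using coset_eq_iff[of ?B x y] B0 Bdiff unfolding coset_def by blast
      finally show ?thesis using stable_diff[OF stZ x y] by blast
    qed
  next
    fix r :: "('n, 'k) mpoly" and x assume x: "x \<in> ?Z"
    have "cochain_class D j ` ?B +>\<^bsub>M\<^esub> (r \<odot>\<^bsub>M\<^esub> p) = \<pi> (cochain_smult D r x)" if p: "p \<in> \<pi> x" for p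
    proof -
      obtain b where b: "b \<in> ?B" "p = cochain_class D j (b + x)" using p unfolding \<pi>_def by blast
      have bx: "b + x \<in> cochains D j" using Bc[OF b(1)] Zc[OF x] by (rule cochains_add)
      have rb: "cochain_smult D r b \<in> ?B" using stB b(1) by (simp add: act_stable_def)
      have "r \<odot>\<^bsub>M\<^esub> p = cochain_class D j (cochain_smult D r (b + x))"
        using cochain_class_smult[OF D bx, of r] by (simp add: M_def b(2))
      hence "cochain_class D j ` ?B +>\<^bsub>M\<^esub> (r \<odot>\<^bsub>M\<^esub> p) = \<pi> (cochain_smult D r b + cochain_smult D r x)"
        using coset[OF cochains_smult[OF D bx, of r]] by (simp add: cochain_smult_add)
      also have "(\<lambda>b'. b' + (cochain_smult D r b + cochain_smult D r x)) ` ?B = (\<lambda>b'. b' + cochain_smult D r x) ` ?B"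
        using coset_eq_iff[of ?B "cochain_smult D r b + cochain_smult D r x" "cochain_smult D r x"] B0 Bdiff rb
        unfolding coset_def by simp
      hence "\<pi> (cochain_smult D r b + cochain_smult D r x) = \<pi> (cochain_smult D r x)" by (simp only: \<pi>_def)
      finally show ?thesis .
    qed
    moreover have "\<pi> x \<noteq> {}" using B0 unfolding \<pi>_def by blast
    ultimately show "r \<odot>\<^bsub>quotient_module M (cochain_class D j ` ?B)\<^esub> \<pi> x = \<pi> (cochain_smult D r x)"
      unfolding quotient_module_sel by (intro UN_constant_on) auto
  next
    fix x assume x: "x \<in> ?Z"
    have "(- 1 :: ('n, 'k) mpoly) = Poly_Mapping.single 0 (- 1)" using power_minus_one_single[of 1] by simp
    thus "cochain_smult D (- 1) x = - x"
      using laurent_smult_const[OF cochains_laurent[OF Zc[OF x]], where k = "- 1"]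
      by (auto simp: cochain_smult_def fun_eq_iff)
  qed (use stZ in auto)
qed

section \<open>Chains of subspaces\<close>

lemma (in vector_space) span_exchange_finite:
  assumes "finite E" "y \<in> span (A \<union> E)" "y \<notin> span A"
  shows "\<exists>e\<in>E. e \<in> span (insert y (A \<union> (E - {e})))"
  using assms(1,2)
proof (induction E rule: finite_induct)
  case empty thus ?case using assms(3) by simp
next
  case (insert e F)
  show ?case
  proof (cases "y \<in> span (A \<union> F)")
    case True
    then obtain f where f: "f \<in> F" "f \<in> span (insert y (A \<union> (F - {f})))" using insert.IH by blast
    have "insert y (A \<union> (F - {f})) \<subseteq> insert y (A \<union> (insert e F - {f}))" by blast
    hence "f \<in> span (insert y (A \<union> (insert e F - {f})))" using f(2) span_mono by blast
    thus ?thesis using f(1) by blast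
  next
    case False
    have "y \<in> span (insert e (A \<union> F))" using insert.prems by simp
    hence "e \<in> span (insert y (A \<union> F))" using False by (rule in_span_insert)
    moreover have "insert e F - {e} = F" using insert.hyps by blast
    ultimately show ?thesis by (intro bexI[of _ e]) simp_all
  qed
qed

text \<open>
  Steinitz exchange modulo \<open>N 0\<close>: a vector that is new in \<open>N 1\<close> replaces a member of \<open>E\<close>.
\<close>

lemma (in vector_space) chain_length_le:
  assumes "finite E" "\<And>j. j \<le> k \<Longrightarrow> subspace (N j)" "\<And>j. j < k \<Longrightarrow> N j \<subset> N (Suc j)"
    "N k \<subseteq> span (N 0 \<union> E)"
  shows "k \<le> card E"
  using assms
proof (induction k arbitrary: N E)
  case (Suc k)
  have mono: "N j \<subseteq> N (Suc k)" if "j \<le> Suc k" for j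
    using that by (rule inc_induct) (use Suc.prems(3) in auto)
  obtain y where y: "y \<in> N (Suc 0)" "y \<notin> N 0" using Suc.prems(3)[of 0] by auto
  have "y \<in> span (N 0 \<union> E)" using y(1) mono[of "Suc 0"] Suc.prems(4) by auto
  moreover have "y \<notin> span (N 0)" using y(2) Suc.prems(2)[of 0] by (simp add: span_eq_iff[THEN iffD2])
  ultimately obtain e where e: "e \<in> E" "e \<in> span (insert y (N 0 \<union> (E - {e})))"
    using span_exchange_finite[OF Suc.prems(1)] by blast
  have sub: "insert y (N 0 \<union> (E - {e})) \<subseteq> N (Suc 0) \<union> (E - {e})" using y Suc.prems(3)[of 0] by auto
  have "N 0 \<union> E \<subseteq> span (N (Suc 0) \<union> (E - {e}))"
  proof
    fix x assume "x \<in> N 0 \<union> E"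
    hence x: "x = e \<or> x \<in> N (Suc 0) \<union> (E - {e})" using Suc.prems(3)[of 0] by auto
    have "e \<in> span (N (Suc 0) \<union> (E - {e}))" using e(2) span_mono[OF sub] by (rule rev_subsetD)
    with x span_base[of x "N (Suc 0) \<union> (E - {e})"] show "x \<in> span (N (Suc 0) \<union> (E - {e}))" by metis
  qed
  hence "span (N 0 \<union> E) \<subseteq> span (N (Suc 0) \<union> (E - {e}))" by (simp add: span_minimal)
  hence "k \<le> card (E - {e})"
    using Suc.prems by (intro Suc.IH[of "E - {e}" "\<lambda>j. N (Suc j)"]) auto
  thus ?case using Suc.prems(1) e(1) by (metis Suc_le_eq card_Diff1_less order.strict_trans1)
qed simp

section \<open>The finite complexes in single degrees\<close>

abbreviation fscale :: "'k::field \<Rightarrow> ('s \<Rightarrow> 'k) \<Rightarrow> 's \<Rightarrow> 'k" where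
  "fscale k y \<equiv> \<lambda>S. k * y S"

lemma vector_space_fscale: "vector_space (fscale :: 'k::field \<Rightarrow> ('s \<Rightarrow> 'k) \<Rightarrow> _)"
  by unfold_locales (auto simp: fun_eq_iff algebra_simps)

text \<open>
  The strand of the Cech complex in degree \<open>a\<close>, where \<open>\<Delta>\<close> is the family of the sets \<open>S\<close> in which \<open>x\<^sup>a\<close>
  survives.
\<close>

definition deg_cochains :: "nat \<Rightarrow> 'n set set \<Rightarrow> ('n::finite set \<Rightarrow> 'k::field) set" where
  "deg_cochains j \<Delta> = {y. \<forall>S. y S \<noteq> 0 \<longrightarrow> card S = j \<and> S \<in> \<Delta>}"

definition deg_codiff :: "nat \<Rightarrow> 'n set set \<Rightarrow> ('n::{finite,linorder} set \<Rightarrow> 'k::field) \<Rightarrow> 'n set \<Rightarrow> 'k" where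
  "deg_codiff j \<Delta> y T = (if card T = Suc j \<and> T \<in> \<Delta> then \<Sum>i\<in>T. csign T i * y (T - {i}) else 0)"

definition deg_cocycles :: "nat \<Rightarrow> 'n set set \<Rightarrow> ('n::{finite,linorder} set \<Rightarrow> 'k::field) set" where
  "deg_cocycles j \<Delta> = {y \<in> deg_cochains j \<Delta>. deg_codiff j \<Delta> y = 0}"

definition deg_coboundaries :: "nat \<Rightarrow> 'n set set \<Rightarrow> ('n::{finite,linorder} set \<Rightarrow> 'k::field) set" where
  "deg_coboundaries j \<Delta> = (case j of 0 \<Rightarrow> {0} | Suc i \<Rightarrow> deg_codiff i \<Delta> ` deg_cochains i \<Delta>)"

lemma deg_codiff_add: "deg_codiff j \<Delta> (x + y) = deg_codiff j \<Delta> x + deg_codiff j \<Delta> y"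
  by (auto simp: fun_eq_iff deg_codiff_def ring_distribs sum.distrib)

lemma deg_codiff_scale: "deg_codiff j \<Delta> (fscale k y) = fscale k (deg_codiff j \<Delta> y)"
  by (auto simp: fun_eq_iff deg_codiff_def sum_distrib_left mult_ac)

lemma deg_codiff_0 [simp]: "deg_codiff j \<Delta> 0 = 0"
  by (auto simp: fun_eq_iff deg_codiff_def)

text \<open>
  The classes of the elements of \<open>E\<close> form a basis of the cohomology of the strand.
\<close>

definition is_cohom_basis :: "nat \<Rightarrow> 'n set set \<Rightarrow> ('n::{finite,linorder} set \<Rightarrow> 'k::field) set \<Rightarrow> bool" where
  "is_cohom_basis j \<Delta> E \<longleftrightarrow> finite E \<and> E \<subseteq> deg_cocycles j \<Delta> \<and>
     (\<forall>y\<in>deg_cocycles j \<Delta>. \<exists>q. y - (\<Sum>e\<in>E. fscale (q e) e) \<in> deg_coboundaries j \<Delta>) \<and>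
     (\<forall>q. (\<Sum>e\<in>E. fscale (q e) e) \<in> deg_coboundaries j \<Delta> \<longrightarrow> (\<forall>e\<in>E. q e = 0))"

text \<open>
  A basis of the coboundaries is extended to a basis of the cocycles, and \<open>E\<close> consists of the new elements.
\<close>

lemma ex_cohom_basis: "\<exists>E :: ('n::{finite,linorder} set \<Rightarrow> 'k::field) set. is_cohom_basis j \<Delta> E"
proof -
  interpret vector_space "fscale :: 'k \<Rightarrow> ('n set \<Rightarrow> 'k) \<Rightarrow> _" by (rule vector_space_fscale)
  let ?Z = "deg_cocycles j \<Delta> :: ('n set \<Rightarrow> 'k) set"
  let ?B = "deg_coboundaries j \<Delta> \<inter> ?Z"
  have cc: "subspace (deg_cochains i \<Delta> :: ('n set \<Rightarrow> 'k) set)" for i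
    unfolding subspace_def deg_cochains_def by (auto simp: plus_fun_def) (metis add.right_neutral)+
  have Z: "subspace ?Z"
    using cc[of j] unfolding subspace_def deg_cocycles_def
    by (auto simp: deg_codiff_add deg_codiff_scale fun_eq_iff)
  have B1: "subspace (deg_coboundaries j \<Delta> :: ('n set \<Rightarrow> 'k) set)"
  proof (cases j)
    case 0 thus ?thesis by (auto simp: subspace_def deg_coboundaries_def fun_eq_iff)
  next
    case (Suc i)
    have eq: "deg_coboundaries j \<Delta> = deg_codiff i \<Delta> ` (deg_cochains i \<Delta> :: ('n set \<Rightarrow> 'k) set)"
      by (simp add: deg_coboundaries_def Suc)
    note c = cc[of i, unfolded subspace_def]
    show ?thesis unfolding subspace_def eq
    proof (intro conjI ballI allI)
      show "0 \<in> deg_codiff i \<Delta> ` (deg_cochains i \<Delta> :: ('n set \<Rightarrow> 'k) set)"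
        by (rule image_eqI[of _ _ 0]) (use c in auto)
    next
      fix x y assume "x \<in> deg_codiff i \<Delta> ` (deg_cochains i \<Delta> :: ('n set \<Rightarrow> 'k) set)" 
        "y \<in> deg_codiff i \<Delta> ` (deg_cochains i \<Delta> :: ('n set \<Rightarrow> 'k) set)"
      then obtain x' y' where "x = deg_codiff i \<Delta> x'" "y = deg_codiff i \<Delta> y'" 
        "x' \<in> deg_cochains i \<Delta>" "y' \<in> deg_cochains i \<Delta>" by blast
      thus "x + y \<in> deg_codiff i \<Delta> ` (deg_cochains i \<Delta> :: ('n set \<Rightarrow> 'k) set)"
        by (intro image_eqI[of _ _ "x' + y'"]) (use c in \<open>auto simp: deg_codiff_add\<close>)
    next
      fix k :: 'k and x assume "x \<in> deg_codiff i \<Delta> ` (deg_cochains i \<Delta> :: ('n set \<Rightarrow> 'k) set)" 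
      then obtain x' where "x = deg_codiff i \<Delta> x'" "x' \<in> deg_cochains i \<Delta>" by blast
      thus "fscale k x \<in> deg_codiff i \<Delta> ` (deg_cochains i \<Delta> :: ('n set \<Rightarrow> 'k) set)"
        by (intro image_eqI[of _ _ "fscale k x'"]) (use c in \<open>auto simp: deg_codiff_scale\<close>)
    qed
  qed
  have B: "subspace ?B" using B1 Z by (rule subspace_inter)
  obtain \<beta> where \<beta>: "\<beta> \<subseteq> ?B" "independent \<beta>" "?B \<subseteq> span \<beta>"
    using maximal_independent_subset[of ?B] by metis
  obtain \<beta>' where \<beta>': "\<beta> \<subseteq> \<beta>'" "\<beta>' \<subseteq> ?Z" "independent \<beta>'" "?Z \<subseteq> span \<beta>'"
    using maximal_independent_subset_extend[of \<beta> ?Z] \<beta> by (metis le_inf_iff)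
  define T :: "('n set \<Rightarrow> 'k) set" where "T = (\<lambda>S S'. if S' = S then 1 else 0) ` UNIV"
  have "y \<in> span T" for y
  proof -
    have "y = (\<Sum>S\<in>UNIV. fscale (y S) (\<lambda>S'. if S' = S then 1 else 0))"
      by (rule ext) (simp add: if_distrib[of "(*) _"] cong: if_cong)
    also have "\<dots> \<in> span T" by (intro span_sum span_scale span_base) (auto simp: T_def)
    finally show ?thesis .
  qed
  hence fin: "finite \<beta>'" using independent_span_bound[of T \<beta>'] \<beta>'(3) by (auto simp: T_def)
  define E where "E = \<beta>' - \<beta>"
  have E: "finite E" "finite \<beta>" "\<beta>' = \<beta> \<union> E" "\<beta> \<inter> E = {}" using fin \<beta>' by (auto simp: E_def intro: finite_subset)
  have span\<beta>: "span \<beta> \<subseteq> ?B" by (rule span_minimal[OF \<beta>(1) B])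
  have "\<exists>q. y - (\<Sum>e\<in>E. fscale (q e) e) \<in> deg_coboundaries j \<Delta>" if "y \<in> ?Z" for y
  proof -
    have "y \<in> span (\<beta> \<union> E)" using that \<beta>' E by auto
    then obtain b s where bs: "b \<in> span \<beta>" "s \<in> span E" "y = b + s" unfolding span_Un by blast
    then obtain q where "s = (\<Sum>e\<in>E. fscale (q e) e)" unfolding span_finite[OF E(1)] by blast
    hence "y - (\<Sum>e\<in>E. fscale (q e) e) = b" using bs by simp
    thus ?thesis using bs(1) span\<beta> by blast
  qed
  moreover have "q e = 0" if q: "(\<Sum>e\<in>E. fscale (q e) e) \<in> deg_coboundaries j \<Delta>" and e: "e \<in> E" for q e
  proof -
    have "(\<Sum>e\<in>E. fscale (q e) e) \<in> ?Z" by (rule subspace_sum[OF Z]) (use Z \<beta>' in \<open>auto simp: E_def subspace_def\<close>)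
    hence "(\<Sum>e\<in>E. fscale (q e) e) \<in> span \<beta>" using q \<beta>(3) by blast
    then obtain p where p: "(\<Sum>e\<in>E. fscale (q e) e) = (\<Sum>e\<in>\<beta>. fscale (p e) e)" unfolding span_finite[OF E(2)] by blast
    define u where "u x = (if x \<in> E then q x else - p x)" for x
    have "(\<Sum>x\<in>\<beta>'. fscale (u x) x) = (\<Sum>x\<in>\<beta>. fscale (u x) x) + (\<Sum>x\<in>E. fscale (u x) x)"
      unfolding E(3) by (rule sum.union_disjoint) (use E in auto)
    also have "(\<Sum>x\<in>\<beta>. fscale (u x) x) = (\<Sum>x\<in>\<beta>. - fscale (p x) x)"
      by (rule sum.cong) (use E(4) in \<open>auto simp: u_def fun_eq_iff\<close>)
    also have "(\<Sum>x\<in>E. fscale (u x) x) = (\<Sum>e\<in>E. fscale (q e) e)"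
      by (rule sum.cong) (auto simp: u_def)
    finally have "(\<Sum>x\<in>\<beta>'. fscale (u x) x) = 0" unfolding p sum_negf by (simp only: left_minus)
    hence "u e = 0" using independentD[OF \<beta>'(3) fin subset_refl] e E(3) by blast
    thus ?thesis using e by (simp add: u_def)
  qed
  ultimately show ?thesis unfolding is_cohom_basis_def 
    using E(1) \<beta>'(2) by (intro exI[of _ E]) (auto simp: E_def)
qed

text \<open>
  The choice depends on \<open>\<Delta>\<close> only; therefore the length will depend on the degrees only through
  \<open>surviving\<close>.
\<close>

definition cohom_basis :: "nat \<Rightarrow> 'n set set \<Rightarrow> ('n::{finite,linorder} set \<Rightarrow> 'k::field) set" where
  "cohom_basis j \<Delta> = (SOME E. is_cohom_basis j \<Delta> E)"

lemma is_cohom_basis: "is_cohom_basis j \<Delta> (cohom_basis j \<Delta>)"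
  unfolding cohom_basis_def using someI_ex[OF ex_cohom_basis] .

lemmas cohom_basis_finite = is_cohom_basis[unfolded is_cohom_basis_def, THEN conjunct1]
lemmas cohom_basis_subset = is_cohom_basis[unfolded is_cohom_basis_def, THEN conjunct2, THEN conjunct1]
lemmas cohom_basis_span = is_cohom_basis[unfolded is_cohom_basis_def, THEN conjunct2, THEN conjunct2, THEN conjunct1, rule_format]
lemmas cohom_basis_indep = is_cohom_basis[unfolded is_cohom_basis_def, THEN conjunct2, THEN conjunct2, THEN conjunct2, rule_format]

section \<open>The length as a count of basis elements\<close>

abbreviation cscale :: "'k::field \<Rightarrow> ('n, 'k) cochain \<Rightarrow> ('n, 'k) cochain" where
  "cscale k c \<equiv> \<lambda>S a. k * c S a"

definition total_deg :: "('n::finite \<Rightarrow> int) \<Rightarrow> int" where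
  "total_deg a = (\<Sum>i\<in>UNIV. a i)"

definition component :: "('n \<Rightarrow> int) \<Rightarrow> ('n, 'k) cochain \<Rightarrow> 'n set \<Rightarrow> 'k" where
  "component a c = (\<lambda>S. c S a)"

definition homogeneous :: "('n \<Rightarrow> int) \<Rightarrow> ('n set \<Rightarrow> 'k::zero) \<Rightarrow> ('n, 'k) cochain" where
  "homogeneous a y = (\<lambda>S x. if x = a then y S else 0)"

lemma vector_space_cscale: "vector_space (cscale :: 'k::field \<Rightarrow> ('n, 'k) cochain \<Rightarrow> _)"
  by unfold_locales (auto simp: fun_eq_iff algebra_simps)

lemma component_0 [simp]: "component a 0 = 0"
  by (simp add: component_def fun_eq_iff)

lemma component_add [simp]: "component a (c + d) = component a c + component a d"
  by (simp add: component_def fun_eq_iff)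

lemma component_diff [simp]: "component a (c - d) = component a c - component a d"
  by (simp add: component_def fun_eq_iff)

lemma component_cscale [simp]: "component a (cscale k c) = fscale k (component a c)"
  by (simp add: component_def fun_eq_iff)

lemma component_sum [simp]: "component a (sum f A) = (\<Sum>x\<in>A. component a (f x))"
  by (simp add: component_def fun_eq_iff)

lemma component_homogeneous: "component b (homogeneous a y) = (if b = a then y else 0)"
  by (auto simp: component_def homogeneous_def)

lemma component_cochains: "c \<in> cochains D j \<Longrightarrow> component a c \<in> deg_cochains j (surviving D a)"
  unfolding deg_cochains_def component_def
proof (intro CollectI allI impI conjI)
  fix S assume c: "c \<in> cochains D j" and S: "c S a \<noteq> 0"
  show "S \<in> surviving D a" by (rule laurent_surviving[OF cochains_laurent[OF c] S])
  have "card S \<noteq> j \<Longrightarrow> c S = 0" using c by (simp add: cochains_def)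
  thus "card S = j" using S by (metis zero_fun_apply)
qed

lemma component_codiff: "component a (codiff D j c) = deg_codiff j (surviving D a) (component a c)"
  by (auto simp: component_def codiff_def deg_codiff_def fun_eq_iff)

lemma finite_component: "c \<in> cochains D j \<Longrightarrow> finite {a. component a c \<noteq> 0}"
proof -
  assume c: "c \<in> cochains D j"
  have "{a. component a c \<noteq> 0} \<subseteq> (\<Union>S. {a. c S a \<noteq> 0})" by (auto simp: component_def fun_eq_iff)
  moreover have "finite (\<Union>S. {a. c S a \<noteq> 0})"
    using laurent_finite_support[OF cochains_laurent[OF c]] by (intro finite_UN_I) auto
  ultimately show ?thesis by (rule finite_subset)
qed

lemma cochains_componentI:
  assumes "finite {a. component a c \<noteq> 0}" "\<And>a. component a c \<in> deg_cochains j (surviving D a)"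
  shows "c \<in> cochains D j"
  unfolding cochains_def laurent_def
proof (intro CollectI allI conjI impI)
  fix S show "finite {a. c S a \<noteq> 0}" 
    by (rule finite_subset[OF _ assms(1)]) (auto simp: component_def fun_eq_iff)
  fix a assume "c S a \<noteq> 0" thus "S \<in> surviving D a" 
    using assms(2)[of a] by (auto simp: component_def deg_cochains_def)
next
  fix S :: "'a set" assume "card S \<noteq> j"
  thus "c S = 0" using assms(2) by (auto simp: component_def deg_cochains_def fun_eq_iff)
qed

lemma deg_cochains_0 [simp]: "0 \<in> deg_cochains j \<Delta>"
  by (simp add: deg_cochains_def)

lemma homogeneous_cochains:
  assumes "y \<in> deg_cochains j (surviving D a)"
  shows "homogeneous a y \<in> cochains D j"
  by (rule cochains_componentI)
     (use assms in \<open>auto simp: component_homogeneous intro: finite_subset[of _ "{a}"] split: if_splits\<close>)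

lemma cocycles_component_iff:
  "c \<in> cocycles D j \<longleftrightarrow> c \<in> cochains D j \<and> (\<forall>a. component a c \<in> deg_cocycles j (surviving D a))"
proof -
  have "codiff D j c = 0 \<longleftrightarrow> (\<forall>a. component a (codiff D j c) = 0)"
    by (auto simp: component_def fun_eq_iff)
  thus ?thesis unfolding cocycles_def deg_cocycles_def component_codiff
    using component_cochains by blast
qed

lemma homogeneous_cocycles:
  assumes "y \<in> deg_cocycles j (surviving D a)"
  shows "homogeneous a y \<in> cocycles D j"
proof -
  have "0 \<in> deg_cocycles j \<Delta>" for \<Delta> by (simp add: deg_cocycles_def)
  thus ?thesis unfolding cocycles_component_iff
    using assms homogeneous_cochains by (auto simp: component_homogeneous deg_cocycles_def)
qed

lemma coboundaries_component:
  assumes "c \<in> coboundaries D j"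
  shows "component a c \<in> deg_coboundaries j (surviving D a)"
  using assms
  by (cases j) (auto simp: coboundaries_def deg_coboundaries_def component_codiff intro!: imageI component_cochains)

text \<open>
  Primitives of the components are put together; where the component is \<open>0\<close>, the primitive is taken to be
  \<open>0\<close>, which keeps the support finite.
\<close>

lemma coboundaries_componentI:
  assumes c: "c \<in> cochains D j" and co: "\<And>a. component a c \<in> deg_coboundaries j (surviving D a)"
  shows "c \<in> coboundaries D j"
proof (cases j)
  case 0
  hence "component a c = 0" for a using co[of a] by (simp add: deg_coboundaries_def)
  hence "c = 0" by (auto simp: component_def fun_eq_iff)
  thus ?thesis by (simp add: coboundaries_def 0)
next
  case (Suc i)
  have "\<exists>y\<in>deg_cochains i (surviving D a). component a c = deg_codiff i (surviving D a) y" for a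
    using co[of a] by (auto simp: Suc deg_coboundaries_def)
  then obtain y where y: "\<And>a. y a \<in> deg_cochains i (surviving D a)" 
    "\<And>a. component a c = deg_codiff i (surviving D a) (y a)" by metis
  define d where "d = (\<lambda>S a. if component a c = 0 then 0 else y a S)"
  have d: "component a d = (if component a c = 0 then 0 else y a)" for a
    by (auto simp: component_def d_def fun_eq_iff)
  have "d \<in> cochains D i"
    by (rule cochains_componentI) 
       (use y(1) in \<open>auto simp: d intro: finite_subset[OF _ finite_component[OF c]]\<close>)
  moreover have "codiff D i d = c"
  proof -
    have "component a (codiff D i d) = component a c" for a
      unfolding component_codiff d using y(2)[of a] by auto
    thus ?thesis by (auto simp: component_def fun_eq_iff)
  qed
  ultimately show ?thesis by (auto simp: coboundaries_def Suc)
qed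

text \<open>
  A basis of the local cohomology, as a vector space over \<open>k\<close>, given by its homogeneous representatives.
\<close>

definition cohom_index :: "('n \<Rightarrow>\<^sub>0 nat) set \<Rightarrow> nat \<Rightarrow> (('n::{finite,linorder} \<Rightarrow> int) \<times> ('n set \<Rightarrow> 'k::field)) set" where
  "cohom_index D j = {(a, e). e \<in> cohom_basis j (surviving D a)}"

lemma cohom_index_cocycle:
  "(a, e) \<in> cohom_index D j \<Longrightarrow> homogeneous a e \<in> cocycles D j"
  using cohom_basis_subset by (intro homogeneous_cocycles) (auto simp: cohom_index_def)

lemma cscale_cochain_smult:
  assumes "c \<in> cochains D j"
  shows "cochain_smult D (Poly_Mapping.single 0 k) c = cscale k c"
  using laurent_smult_const[OF cochains_laurent[OF assms], where k = k]
  by (auto simp: cochain_smult_def fun_eq_iff)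

lemma act_stable_cscale:
  assumes "act_stable (cochain_smult D) N" "N \<subseteq> cocycles D j" "x \<in> N"
  shows "cscale k x \<in> N"
proof -
  have "x \<in> cochains D j" using assms by (auto simp: cocycles_def)
  hence "cscale k x = cochain_smult D (Poly_Mapping.single 0 k) x" by (simp add: cscale_cochain_smult)
  thus ?thesis using assms by (auto simp: act_stable_def)
qed

text \<open>
  Submodules are subspaces, and the cocycles are spanned by the coboundaries and the homogeneous basis.
\<close>

lemma stable_chain_length_le:
  assumes D: "up_closed D" and fin: "finite (cohom_index D j :: (_ \<times> ('n::{finite,linorder} set \<Rightarrow> 'k::field)) set)"
    and N: "stable_chain (cochain_smult D) (coboundaries D j \<inter> cocycles D j :: ('n, 'k) cochain set) (cocycles D j) k N"
  shows "k \<le> card (cohom_index D j :: (_ \<times> ('n set \<Rightarrow> 'k)) set)"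
proof -
  interpret vector_space "cscale :: 'k \<Rightarrow> ('n, 'k) cochain \<Rightarrow> _" by (rule vector_space_cscale)
  let ?I = "cohom_index D j :: (_ \<times> ('n set \<Rightarrow> 'k)) set"
  define E where "E = (\<lambda>(a, e). homogeneous a e) ` ?I"
  have Nst: "act_stable (cochain_smult D) (N i)" "N i \<subseteq> cocycles D j" if "i \<le> k" for i
    using N that by (auto simp: stable_chain_def)
  have subspace_cocycles: "subspace (cocycles D j :: ('n, 'k) cochain set)"
    using stable_cocycles[OF D] act_stable_cscale[OF stable_cocycles[OF D] subset_refl]
    unfolding subspace_def act_stable_def by blast
  have "k \<le> card E"
  proof (rule chain_length_le)
    show "finite E" using fin by (simp add: E_def)
    show "subspace (N i)" if "i \<le> k" for i
      using Nst[OF that] act_stable_cscale[OF Nst[OF that]] unfolding subspace_def act_stable_def by blast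
    show "N i \<subset> N (Suc i)" if "i < k" for i using N that by (simp add: stable_chain_def)
    show "N k \<subseteq> span (N 0 \<union> E)"
    proof
      fix z assume "z \<in> N k"
      hence z: "z \<in> cocycles D j" using Nst(2)[of k] by auto
      have "\<exists>q. component a z - (\<Sum>e\<in>cohom_basis j (surviving D a). fscale (q e) e) \<in> deg_coboundaries j (surviving D a)" for a
        by (rule cohom_basis_span) (use z cocycles_component_iff in blast)
      hence "\<exists>q. \<forall>a. component a z - (\<Sum>e\<in>cohom_basis j (surviving D a). fscale (q a e) e) \<in> deg_coboundaries j (surviving D a)"
        by (intro choice allI)
      then obtain q where q: "\<And>a. component a z - (\<Sum>e\<in>cohom_basis j (surviving D a). fscale (q a e) e) \<in> deg_coboundaries j (surviving D a)"
        by auto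
      define s where "s = (\<Sum>(a, e)\<in>?I. cscale (q a e) (homogeneous a e))"
      have cs: "component a s = (\<Sum>e\<in>cohom_basis j (surviving D a). fscale (q a e) e)" for a
      proof -
        have "component a s = (\<Sum>p\<in>?I. if fst p = a then fscale (q a (snd p)) (snd p) else 0)"
          unfolding s_def component_sum
          by (rule sum.cong) (auto simp: component_homogeneous zero_fun_def split: prod.splits)
        also have "\<dots> = (\<Sum>p\<in>Pair a ` cohom_basis j (surviving D a). fscale (q a (snd p)) (snd p))"
          by (rule sum.mono_neutral_cong_right) (use fin in \<open>auto simp: cohom_index_def\<close>)
        also have "\<dots> = (\<Sum>e\<in>cohom_basis j (surviving D a). fscale (q a e) e)"
          by (subst sum.reindex) (auto simp: inj_on_def)
        finally show ?thesis .
      qed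
      have sZ: "s \<in> cocycles D j"
      proof -
        have "cscale k (homogeneous a e) \<in> cocycles D j" if "(a, e) \<in> ?I" for a e k
          using act_stable_cscale[OF stable_cocycles[OF D] subset_refl cohom_index_cocycle[OF that]] .
        thus ?thesis unfolding s_def
          by (intro subspace_sum[OF subspace_cocycles]) auto
      qed
      have zs: "z - s \<in> cocycles D j" using stable_diff[OF stable_cocycles[OF D] z sZ] .
      have "z - s \<in> coboundaries D j"
        by (rule coboundaries_componentI) (use zs q in \<open>auto simp: cs cocycles_def\<close>)
      hence "z - s \<in> N 0" using zs N by (auto simp: stable_chain_def)
      hence "z - s \<in> span (N 0 \<union> E)" by (intro span_base) simp
      moreover have "s \<in> span (N 0 \<union> E)"
        unfolding s_def
      proof (intro span_sum)
        fix p assume "p \<in> ?I"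
        moreover obtain a e where p: "p = (a, e)" by (cases p)
        ultimately have "homogeneous a e \<in> span (N 0 \<union> E)" by (intro span_base) (auto simp: E_def)
        from span_scale[OF this, of "q a e"]
        show "(case p of (a, e) \<Rightarrow> cscale (q a e) (homogeneous a e)) \<in> span (N 0 \<union> E)" by (simp add: p)
      qed
      ultimately have "(z - s) + s \<in> span (N 0 \<union> E)" by (rule span_add)
      thus "z \<in> span (N 0 \<union> E)" by simp
    qed
  qed
  also have "card E \<le> card ?I" unfolding E_def by (rule card_image_le[OF fin])
  finally show ?thesis .
qed


lemma cochain_smult_sum: "cochain_smult D r (sum f A) = (\<Sum>x\<in>A. cochain_smult D r (f x))"
  by (induction A rule: infinite_finite_induct)
     (simp_all only: sum.infinite sum.empty sum.insert cochain_smult_0 cochain_smult_add not_False_eq_True)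

lemma cochain_smult_cscale: "cochain_smult D r (cscale k c) = cscale k (cochain_smult D r c)"
  by (auto simp: fun_eq_iff cochain_smult_def laurent_smult_def sum_distrib_left mult_ac)

lemma total_deg_diff_expo: "total_deg (a - expo c) \<le> total_deg a"
  unfolding total_deg_def by (intro sum_mono) simp

lemma total_deg_diff_expo_less:
  assumes "c \<noteq> 0"
  shows "total_deg (a - expo c) < total_deg a"
proof -
  obtain i where i: "lookup c i \<noteq> 0" using assms by (metis lookup_zero poly_mapping_eqI)
  show ?thesis unfolding total_deg_def
    by (rule sum_strict_mono_ex1) (use i in \<open>auto simp: expo_def\<close>)
qed

lemma component_cochain_smult_nonzero:
  assumes "component x (cochain_smult D r c) \<noteq> 0"
  obtains d where "d \<in> keys r" "component (x - expo d) c \<noteq> 0"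
proof -
  obtain S where "cochain_smult D r c S x \<noteq> 0" using assms by (auto simp: component_def fun_eq_iff)
  hence "(\<Sum>d\<in>keys r. lookup r d * c S (x - expo d)) \<noteq> 0"
    by (auto simp: cochain_smult_def laurent_smult_def split: if_splits)
  then obtain d where "d \<in> keys r" "lookup r d * c S (x - expo d) \<noteq> 0" by (meson sum.not_neutral_contains_not_neutral)
  moreover from this have "component (x - expo d) c \<noteq> 0" by (auto simp: component_def fun_eq_iff)
  ultimately show ?thesis using that by blast
qed

text \<open>
  A polynomial acts on a homogeneous cochain by its constant term, up to terms of larger total degree.
\<close>

lemma cochain_smult_homogeneous_leading:
  assumes y: "y \<in> deg_cochains j (surviving D a)"
    and nz: "component x (cochain_smult D r (homogeneous a y) - cscale (lookup r 0) (homogeneous a y)) \<noteq> 0"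
  shows "total_deg a < total_deg x"
proof (cases "x = a")
  case True
  have "cochain_smult D r (homogeneous a y) S a = lookup r 0 * y S" for S
  proof (cases "S \<in> surviving D a")
    case True
    have "cochain_smult D r (homogeneous a y) S a = (\<Sum>d\<in>keys r. lookup r d * (if a - expo d = a then y S else 0))"
      using True by (simp add: cochain_smult_def laurent_smult_def homogeneous_def)
    also have "\<dots> = (\<Sum>d\<in>keys r. if d = 0 then lookup r 0 * y S else 0)"
    proof (rule sum.cong)
      fix d
      have "a - expo d = a \<longleftrightarrow> expo d = expo 0" by (auto simp: fun_eq_iff)
      thus "lookup r d * (if a - expo d = a then y S else 0) = (if d = 0 then lookup r 0 * y S else 0)"
        by (simp del: expo_0)
    qed simp
    also have "\<dots> = lookup r 0 * y S" by (simp add: in_keys_iff)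
    finally show ?thesis .
  next
    case False
    hence "y S = 0" using y by (auto simp: deg_cochains_def)
    thus ?thesis using False by (simp add: cochain_smult_not_surviving)
  qed
  moreover have "homogeneous a y S a = y S" for S by (simp add: homogeneous_def)
  ultimately have "component x (cochain_smult D r (homogeneous a y) - cscale (lookup r 0) (homogeneous a y)) = 0"
    by (intro ext) (simp add: component_def True)
  thus ?thesis using nz by simp
next
  case False
  hence "component x (cscale (lookup r 0) (homogeneous a y)) = 0"
    by (intro ext) (simp add: component_def homogeneous_def)
  hence "component x (cochain_smult D r (homogeneous a y)) \<noteq> 0" using nz by simp
  then obtain d where "component (x - expo d) (homogeneous a y) \<noteq> 0"
    by (rule component_cochain_smult_nonzero)
  hence d: "x - expo d = a" by (auto simp: component_homogeneous split: if_splits)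
  hence "d \<noteq> 0" using False by auto
  thus ?thesis using total_deg_diff_expo_less[of d x] d by simp
qed

text \<open>
  The basis elements in \<open>F\<close> are ordered by decreasing total degree, and the \<open>m\<close>-th member of the chain is
  generated by the coboundaries, the first \<open>m\<close> elements, and all cocycles in larger degrees than one
  of these.  The last part absorbs the products with nonconstant polynomials.  The inclusions are
  strict: in the degree of the next element, that part vanishes, and what remains would be a linear
  relation modulo coboundaries.
\<close>

lemma stable_chain_exists:
  assumes D: "up_closed D" and fin: "finite F"
    and F: "F \<subseteq> (cohom_index D j :: (_ \<times> ('n::{finite,linorder} set \<Rightarrow> 'k::field)) set)"
  shows "\<exists>N. stable_chain (cochain_smult D) (coboundaries D j \<inter> cocycles D j :: ('n, 'k) cochain set) (cocycles D j) (card F) N"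
proof -
  let ?Z = "cocycles D j :: ('n, 'k) cochain set"
  let ?B = "coboundaries D j \<inter> ?Z"
  have stZ: "act_stable (cochain_smult D) ?Z" by (rule stable_cocycles[OF D])
  have stB: "act_stable (cochain_smult D) ?B" 
    using stable_coboundaries[OF D, of j, where 'k = 'k] stZ by (auto simp: act_stable_def)
  have Z0: "0 \<in> ?Z" and Zadd: "\<And>x y. x \<in> ?Z \<Longrightarrow> y \<in> ?Z \<Longrightarrow> x + y \<in> ?Z" and Zneg: "\<And>x. x \<in> ?Z \<Longrightarrow> - x \<in> ?Z"
    and Zact: "\<And>x r. x \<in> ?Z \<Longrightarrow> cochain_smult D r x \<in> ?Z" using stZ by (auto simp: act_stable_def)
  have B0: "0 \<in> ?B" and Badd: "\<And>x y. x \<in> ?B \<Longrightarrow> y \<in> ?B \<Longrightarrow> x + y \<in> ?B" and Bneg: "\<And>x. x \<in> ?B \<Longrightarrow> - x \<in> ?B"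
    and Bact: "\<And>x r. x \<in> ?B \<Longrightarrow> cochain_smult D r x \<in> ?B" using stB by (auto simp: act_stable_def)
  have Zsum: "(\<And>x. x \<in> A \<Longrightarrow> f x \<in> ?Z) \<Longrightarrow> sum f A \<in> ?Z" for f :: "nat \<Rightarrow> _" and A
    by (induction A rule: infinite_finite_induct) (auto intro: Z0 Zadd)
  have Zsc: "x \<in> ?Z \<Longrightarrow> cscale k x \<in> ?Z" for x k by (rule act_stable_cscale[OF stZ subset_refl])
  obtain xs0 where xs0: "set xs0 = F" "distinct xs0" using finite_distinct_list[OF fin] by blast
  define xs where "xs = sort_key (\<lambda>p. - total_deg (fst p)) xs0"
  have xs: "set xs = F" "distinct xs" "length xs = card F" 
    using xs0 by (auto simp: xs_def distinct_card[symmetric])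
  define A where "A l = fst (xs ! l)" for l
  define e where "e l = snd (xs ! l)" for l
  define h where "h l = homogeneous (A l) (e l)" for l
  have Ae: "(A l, e l) \<in> cohom_index D j" if "l < card F" for l
    using that xs F nth_mem[of l xs] by (auto simp: A_def e_def)
  have hZ: "h l \<in> ?Z" if "l < card F" for l
    unfolding h_def by (rule cohom_index_cocycle[OF Ae[OF that]])
  have eB: "e l \<in> cohom_basis j (surviving D (A l))" if "l < card F" for l
    using Ae[OF that] by (simp add: cohom_index_def)
  have sorted: "total_deg (A l') \<le> total_deg (A l)" if "l \<le> l'" "l' < card F" for l l'
  proof -
    have "sorted (map (\<lambda>p. - total_deg (fst p)) xs)" by (simp add: xs_def)
    from sorted_nth_mono[OF this, of l l'] show ?thesis using that xs(3) by (simp add: A_def)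
  qed
  have inj: "l = l'" if "A l = A l'" "e l = e l'" "l < card F" "l' < card F" for l l'
  proof -
    have "xs ! l = xs ! l'" using that by (intro prod_eqI) (simp_all add: A_def e_def)
    thus ?thesis using that xs by (simp add: nth_eq_iff_index_eq)
  qed
  \<comment> \<open>the cocycles in total degrees above that of one of the first \<open>m\<close> basis elements\<close>
  define tail where "tail m = {v \<in> ?Z. \<forall>x. component x v \<noteq> 0 \<longrightarrow> (\<exists>l<m. total_deg (A l) < total_deg x)}" for m
  define N where "N m = {b + (\<Sum>l<m. cscale (q l) (h l)) + v | b q v. b \<in> ?B \<and> v \<in> tail m}" for m
  have tail0: "0 \<in> tail m" for m using Z0 by (simp add: tail_def)
  have tadd: "v + w \<in> tail m" if "v \<in> tail m" "w \<in> tail m" for v w m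
  proof -
    have "component x v \<noteq> 0 \<or> component x w \<noteq> 0" if "component x (v + w) \<noteq> 0" for x
      using that by auto
    thus ?thesis using that Zadd unfolding tail_def by blast
  qed
  have tneg: "- v \<in> tail m" if "v \<in> tail m" for v m
  proof -
    have "component x (- v) \<noteq> 0 \<Longrightarrow> component x v \<noteq> 0" for x by (auto simp: component_def fun_eq_iff)
    thus ?thesis using that Zneg unfolding tail_def by blast
  qed
  have tact: "cochain_smult D r v \<in> tail m" if v: "v \<in> tail m" for v m r
    unfolding tail_def
  proof (intro CollectI conjI allI impI)
    show "cochain_smult D r v \<in> ?Z" using v Zact by (simp add: tail_def)
    fix x assume "component x (cochain_smult D r v) \<noteq> 0"
    then obtain d where "component (x - expo d) v \<noteq> 0" by (rule component_cochain_smult_nonzero)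
    then obtain l where "l < m" "total_deg (A l) < total_deg (x - expo d)" using v by (auto simp: tail_def)
    thus "\<exists>l<m. total_deg (A l) < total_deg x" using total_deg_diff_expo[of x d] by (meson order.strict_trans2)
  qed
  have tsum: "(\<And>l. l \<in> L \<Longrightarrow> f l \<in> tail m) \<Longrightarrow> sum f L \<in> tail m" for f :: "nat \<Rightarrow> _" and L m
    by (induction L rule: infinite_finite_induct) (auto intro: tail0 tadd)
  have NI: "b + (\<Sum>l<m. cscale (q l) (h l)) + v \<in> N m" if "b \<in> ?B" "v \<in> tail m" for b q v m
    using that unfolding N_def by blast
  have NE: thesis if "z \<in> N m" "\<And>b q v. z = b + (\<Sum>l<m. cscale (q l) (h l)) + v \<Longrightarrow> b \<in> ?B \<Longrightarrow> v \<in> tail m \<Longrightarrow> thesis" for z m thesis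
    using that unfolding N_def by blast
  have zero_sum: "(\<Sum>l<m. cscale 0 (h l)) = 0" for m by (simp add: fun_eq_iff)
  have stable: "act_stable (cochain_smult D) (N m)" if m: "m \<le> card F" for m
    unfolding act_stable_def
  proof (intro conjI ballI allI)
    show "0 \<in> N m" using NI[OF B0 tail0, where m = m and q = "\<lambda>_. 0"] unfolding zero_sum by simp
  next
    fix x y assume "x \<in> N m" "y \<in> N m"
    then obtain b q v b' q' v' where x: "x = b + (\<Sum>l<m. cscale (q l) (h l)) + v" "b \<in> ?B" "v \<in> tail m"
      and y: "y = b' + (\<Sum>l<m. cscale (q' l) (h l)) + v'" "b' \<in> ?B" "v' \<in> tail m" by (elim NE)
    have eq: "x + y = (b + b') + (\<Sum>l<m. cscale (q l + q' l) (h l)) + (v + v')"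
      unfolding x y by (simp add: fun_eq_iff sum.distrib ring_distribs)
    show "x + y \<in> N m" unfolding eq by (rule NI[OF Badd[OF x(2) y(2)] tadd[OF x(3) y(3)]])
  next
    fix x assume "x \<in> N m"
    then obtain b q v where x: "x = b + (\<Sum>l<m. cscale (q l) (h l)) + v" "b \<in> ?B" "v \<in> tail m" by (elim NE)
    have eq: "- x = - b + (\<Sum>l<m. cscale (- q l) (h l)) + (- v)"
      unfolding x by (simp add: fun_eq_iff sum_negf)
    show "- x \<in> N m" unfolding eq by (rule NI[OF Bneg[OF x(2)] tneg[OF x(3)]])
  next
    fix x r assume "x \<in> N m"
    then obtain b q v where x: "x = b + (\<Sum>l<m. cscale (q l) (h l)) + v" "b \<in> ?B" "v \<in> tail m" by (elim NE)
    \<comment> \<open>the part of \<open>r\<close> times the \<open>l\<close>-th element in degrees above it\<close>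
    define w where "w l = cscale (q l) (cochain_smult D r (h l) - cscale (lookup r 0) (h l))" for l
    have wt: "w l \<in> tail m" if l: "l < m" for l
    proof -
      have lF: "l < card F" using l m by simp
      have "e l \<in> deg_cochains j (surviving D (A l))" using eB[OF lF] cohom_basis_subset by (auto simp: deg_cocycles_def)
      have "total_deg (A l) < total_deg x" if nz: "component x (w l) \<noteq> 0" for x
      proof (rule cochain_smult_homogeneous_leading[OF \<open>e l \<in> _\<close>, of _ r], rule notI)
        assume "component x (cochain_smult D r (homogeneous (A l) (e l)) - cscale (lookup r 0) (homogeneous (A l) (e l))) = 0"
        hence "component x (w l) = fscale (q l) 0" unfolding w_def component_cscale h_def by (simp only:)
        thus False using nz by (simp add: zero_fun_def)
      qed
      moreover have "w l \<in> ?Z" unfolding w_def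
        using hZ[OF lF] by (intro Zsc stable_diff[OF stZ]) (auto intro: Zact Zsc)
      ultimately show ?thesis using l by (auto simp: tail_def)
    qed
    have "cochain_smult D r x = cochain_smult D r b + (\<Sum>l<m. cscale (q l) (cochain_smult D r (h l))) + cochain_smult D r v"
      unfolding x cochain_smult_add cochain_smult_sum cochain_smult_cscale ..
    also have "\<dots> = cochain_smult D r b + (\<Sum>l<m. cscale (q l * lookup r 0) (h l)) + ((\<Sum>l<m. w l) + cochain_smult D r v)"
      by (simp add: fun_eq_iff w_def sum.distrib ring_distribs sum_subtractf mult_ac)
    finally have eq: "cochain_smult D r x = cochain_smult D r b + (\<Sum>l<m. cscale (q l * lookup r 0) (h l)) + ((\<Sum>l<m. w l) + cochain_smult D r v)" .
    show "cochain_smult D r x \<in> N m" unfolding eq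
      by (rule NI[OF Bact[OF x(2)] tadd[OF tsum[of "{..<m}" w m] tact[OF x(3)]]]) (use wt in simp)
  qed
  have "stable_chain (cochain_smult D) ?B ?Z (card F) N"
    unfolding stable_chain_def
  proof (intro conjI allI impI)
    fix m assume m: "m \<le> card F"
    show "?B \<subseteq> N m"
    proof
      fix b assume "b \<in> ?B"
      from NI[OF this tail0, where m = m and q = "\<lambda>_. 0"] show "b \<in> N m" unfolding zero_sum by simp
    qed
    show "N m \<subseteq> ?Z"
    proof
      fix z assume "z \<in> N m"
      then obtain b q v where z: "z = b + (\<Sum>l<m. cscale (q l) (h l)) + v" "b \<in> ?B" "v \<in> tail m" by (elim NE)
      show "z \<in> ?Z" unfolding z(1) by (intro Zadd Zsum Zsc) (use z m hZ in \<open>auto simp: tail_def\<close>)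
    qed
    show "act_stable (cochain_smult D) (N m)" by (rule stable[OF m])
  next
    fix m assume m: "m < card F"
    have sub: "N m \<subseteq> N (Suc m)"
    proof
      fix z assume "z \<in> N m"
      then obtain b q v where z: "z = b + (\<Sum>l<m. cscale (q l) (h l)) + v" "b \<in> ?B" "v \<in> tail m" by (elim NE)
      have v: "v \<in> tail (Suc m)" using z(3) by (force simp: tail_def)
      have eq: "z = b + (\<Sum>l<Suc m. cscale ((q(m := 0)) l) (h l)) + v"
        unfolding z(1) by (simp add: fun_eq_iff)
      show "z \<in> N (Suc m)" unfolding eq by (rule NI[OF z(2) v])
    qed
    have "h m \<in> N (Suc m)"
    proof -
      have eq: "h m = 0 + (\<Sum>l<Suc m. cscale (if l = m then 1 else 0) (h l)) + 0" by (simp add: fun_eq_iff)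
      show ?thesis by (subst eq) (rule NI[OF B0 tail0])
    qed
    moreover have "h m \<notin> N m"
    proof
      assume "h m \<in> N m"
      then obtain b q v where z: "h m = b + (\<Sum>l<m. cscale (q l) (h l)) + v" "b \<in> ?B" "v \<in> tail m" by (elim NE)
      let ?C = "cohom_basis j (surviving D (A m)) :: ('n set \<Rightarrow> 'k) set"
      \<comment> \<open>the degrees decrease, so \<open>v\<close> has no component in the degree of the new element\<close>
      have "component (A m) v = 0"
        using z(3) sorted[of _ m] m by (auto simp: tail_def) (meson leD less_imp_le_nat)
      hence "component (A m) (h m) = component (A m) b + (\<Sum>l<m. component (A m) (cscale (q l) (h l)))"
        by (subst z(1)) simp
      moreover have "(\<Sum>l<m. component (A m) (cscale (q l) (h l))) = (\<Sum>l\<in>{l. l < m \<and> A l = A m}. fscale (q l) (e l))"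
        by (rule sum.mono_neutral_cong_right) (auto simp: h_def component_homogeneous zero_fun_def)
      moreover have "\<exists>p. p (e m) = 0 \<and> (\<Sum>l\<in>{l. l < m \<and> A l = A m}. fscale (q l) (e l)) = (\<Sum>x\<in>?C. fscale (p x) x)"
      proof -
        let ?L = "{l. l < m \<and> A l = A m}"
        have inje: "inj_on e ?L" by (intro inj_onI inj) (use m in auto)
        define p where "p x = (if x \<in> e ` ?L then q (the_inv_into ?L e x) else 0)" for x
        have "(\<Sum>l\<in>?L. fscale (q l) (e l)) = (\<Sum>l\<in>?L. fscale (p (e l)) (e l))"
          by (rule sum.cong) (auto simp: p_def the_inv_into_f_f[OF inje])
        also have "\<dots> = (\<Sum>x\<in>e ` ?L. fscale (p x) x)" by (simp add: sum.reindex[OF inje])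
        also have "\<dots> = (\<Sum>x\<in>?C. fscale (p x) x)"
        proof (rule sum.mono_neutral_left)
          show "finite ?C" by (rule cohom_basis_finite)
          show "e ` ?L \<subseteq> ?C"
          proof
            fix x assume "x \<in> e ` ?L"
            then obtain l where l: "x = e l" "l < m" "A l = A m" by blast
            thus "x \<in> ?C" using eB[of l] m by simp
          qed
          show "\<forall>x\<in>?C - e ` ?L. fscale (p x) x = 0" by (simp add: p_def zero_fun_def)
        qed
        finally have "(\<Sum>l\<in>?L. fscale (q l) (e l)) = (\<Sum>x\<in>?C. fscale (p x) x)" .
        moreover have "e m \<notin> e ` ?L"
        proof
          assume "e m \<in> e ` ?L"
          then obtain l where l: "e m = e l" "l < m" "A l = A m" by blast
          thus False using inj[of m l] m by simp
        qed
        hence "p (e m) = 0" by (simp add: p_def)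
        ultimately show ?thesis by blast
      qed
      then obtain p where p: "p (e m) = 0" "(\<Sum>l\<in>{l. l < m \<and> A l = A m}. fscale (q l) (e l)) = (\<Sum>x\<in>?C. fscale (p x) x)" by blast
      ultimately have eq: "e m = component (A m) b + (\<Sum>x\<in>?C. fscale (p x) x)" by (simp add: h_def component_homogeneous)
      define u where "u x = (if x = e m then 1 else - p x)" for x
      have "(\<Sum>x\<in>?C. fscale (u x) x) = e m + (\<Sum>x\<in>?C - {e m}. - fscale (p x) x)"
        unfolding sum.remove[OF cohom_basis_finite eB[OF m]]
        by (intro arg_cong2[where f = "(+)"] sum.cong) (auto simp: u_def fun_eq_iff)
      also have "(\<Sum>x\<in>?C - {e m}. - fscale (p x) x) = - (\<Sum>x\<in>?C. fscale (p x) x)"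
        unfolding sum.remove[OF cohom_basis_finite eB[OF m]] sum_negf using p(1) by (simp add: fun_eq_iff)
      also have "e m + - (\<Sum>x\<in>?C. fscale (p x) x) = component (A m) b"
        unfolding eq by (simp only: add.assoc right_minus add_0_right)
      also have "\<dots> \<in> deg_coboundaries j (surviving D (A m))" using coboundaries_component z(2) by blast
      finally have "u (e m) = 0" using cohom_basis_indep eB[OF m] by blast
      thus False by (simp add: u_def)
    qed
    ultimately show "N m \<subset> N (Suc m)" using sub by blast
  qed
  thus ?thesis by blast
qed

theorem local_cohomology_length_mono_span:
  fixes D :: "('n::{finite,linorder} \<Rightarrow>\<^sub>0 nat) set"
  assumes D: "up_closed D"
  shows "local_cohomology_length j (mono_span D :: ('n, 'k::field) mpoly set) =
    (if finite (cohom_index D j :: (_ \<times> ('n set \<Rightarrow> 'k)) set) then enat (card (cohom_index D j :: (_ \<times> ('n set \<Rightarrow> 'k)) set)) else \<infinity>)"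
proof -
  let ?I = "cohom_index D j :: (_ \<times> ('n set \<Rightarrow> 'k)) set"
  let ?chain = "\<lambda>k N. stable_chain (cochain_smult D) (coboundaries D j \<inter> cocycles D j :: ('n, 'k) cochain set) (cocycles D j) k N"
  let ?S = "{enat k | k. \<exists>N. ?chain k N}"
  have eq: "local_cohomology_length j (mono_span D :: ('n, 'k) mpoly set) = Sup ?S"
    by (rule local_cohomology_length_chains[OF D])
  show ?thesis
  proof (cases "finite ?I")
    case True
    have "Sup ?S = enat (card ?I)"
    proof (rule antisym)
      show "Sup ?S \<le> enat (card ?I)"
        by (rule Sup_least) (use stable_chain_length_le[OF D True] in auto)
      show "enat (card ?I) \<le> Sup ?S"
        by (rule Sup_upper) (use stable_chain_exists[OF D True subset_refl] in auto)
    qed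
    thus ?thesis using True eq by simp
  next
    case False
    have le: "enat m \<le> Sup ?S" for m
    proof -
      obtain F where F: "F \<subseteq> ?I" "finite F" "card F = m" using infinite_arbitrarily_large[OF False] by blast
      show ?thesis using stable_chain_exists[OF D F(2,1)] F(3) by (intro Sup_upper) auto
    qed
    have "Sup ?S = \<infinity>"
    proof (cases "Sup ?S")
      case (enat k)
      thus ?thesis using le[of "Suc k"] by simp
    qed
    thus ?thesis using False eq by simp
  qed
qed

section \<open>Rational polyhedral cones\<close>

text \<open>
  The forms have integral coefficients and are evaluated over any ordered field: at rational points for
  monomials and exponents \<open>u\<close>, at real points for volumes.
\<close>

definition ev :: "('v::finite \<Rightarrow> int) \<Rightarrow> ('v \<Rightarrow> 'a::linordered_field) \<Rightarrow> 'a" where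
  "ev w x = (\<Sum>v\<in>UNIV. of_int (w v) * x v)"

definition dot :: "('v::finite \<Rightarrow> int) \<Rightarrow> ('v \<Rightarrow> int) \<Rightarrow> int" where
  "dot w g = (\<Sum>v\<in>UNIV. w v * g v)"

definition in_cone :: "('v \<Rightarrow> int) set \<Rightarrow> ('v \<Rightarrow> 'a::linordered_field) \<Rightarrow> bool" where
  "in_cone G x \<longleftrightarrow> (\<exists>l. (\<forall>g\<in>G. 0 \<le> l g) \<and> (\<forall>v. x v = (\<Sum>g\<in>G. l g * of_int (g v))))"

lemma ev_of_int: "ev w (\<lambda>v. of_int (g v)) = of_int (dot w g)"
  by (simp add: ev_def dot_def)

lemma dot_commute: "dot w g = dot g w"
  by (simp add: dot_def mult.commute)

lemma ev_diff_scaled: "ev w (\<lambda>v. x v - t * of_int (g v)) = ev w x - t * of_int (dot w g)"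
  by (simp add: ev_def dot_def ring_distribs sum_subtractf sum_distrib_left mult_ac)

lemma ev_combination: "ev w (\<lambda>v. \<Sum>g\<in>G. l g * of_int (g v)) = (\<Sum>g\<in>G. l g * of_int (dot w g))"
  unfolding ev_def dot_def of_int_sum sum_distrib_left
  by (subst sum.swap) (simp add: mult_ac)

lemma in_coneI: "finite G \<Longrightarrow> g \<in> G \<Longrightarrow> in_cone G (\<lambda>v. of_int (g v))"
  unfolding in_cone_def by (intro exI[of _ "\<lambda>h. if h = g then 1 else 0"]) (simp add: if_distrib[of "\<lambda>z. z * _"] cong: if_cong)

lemma in_cone_ev_nonneg:
  assumes "in_cone G x" "\<And>g. g \<in> G \<Longrightarrow> 0 \<le> dot w g"
  shows "0 \<le> ev w x"
proof -
  obtain l where l: "\<forall>g\<in>G. 0 \<le> l g" "\<And>v. x v = (\<Sum>g\<in>G. l g * of_int (g v))"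
    using assms(1) by (auto simp: in_cone_def)
  have "x = (\<lambda>v. \<Sum>g\<in>G. l g * of_int (g v))" using l(2) by blast
  hence "ev w x = (\<Sum>g\<in>G. l g * of_int (dot w g))" by (simp add: ev_combination)
  also have "\<dots> \<ge> 0" by (intro sum_nonneg mult_nonneg_nonneg) (use l assms(2) in auto)
  finally show ?thesis .
qed

text \<open>
  Fourier-Motzkin elimination of \<open>t \<ge> 0\<close> from the inequalities \<open>0 \<le> \<omega> (x - t g)\<close>: each lower bound for \<open>t\<close>,
  including \<open>0\<close>, is compared with each upper bound.
\<close>

definition weyl_step :: "('v::finite \<Rightarrow> int) set \<Rightarrow> ('v \<Rightarrow> int) \<Rightarrow> ('v \<Rightarrow> int) set" where
  "weyl_step W g = {w \<in> W. 0 \<le> dot w g} \<union>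
     (\<lambda>(w, w') v. dot w g * w' v - dot w' g * w v) ` {(w, w'). w \<in> W \<and> w' \<in> W \<and> 0 < dot w g \<and> dot w' g < 0}"

lemma finite_weyl_step: "finite W \<Longrightarrow> finite (weyl_step W g)"
  unfolding weyl_step_def
  by (intro finite_UnI finite_imageI) (auto intro: finite_subset[of _ "W \<times> W"])

lemma ev_weyl_combination:
  "ev (\<lambda>v. dot w g * w' v - dot w' g * w v) x = of_int (dot w g) * ev w' x - of_int (dot w' g) * ev w x"
  by (simp add: ev_def ring_distribs sum_subtractf sum_distrib_left mult_ac)

lemma weyl_step:
  fixes x :: "'v::finite \<Rightarrow> 'a::linordered_field"
  assumes W: "finite W"
  shows "(\<forall>w\<in>weyl_step W g. 0 \<le> ev w x) \<longleftrightarrow> (\<exists>t\<ge>0. \<forall>w\<in>W. 0 \<le> ev w (\<lambda>v. x v - t * of_int (g v)))"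
proof
  assume "\<exists>t\<ge>0. \<forall>w\<in>W. 0 \<le> ev w (\<lambda>v. x v - t * of_int (g v))"
  then obtain t where t: "t \<ge> 0" "\<And>w. w \<in> W \<Longrightarrow> t * of_int (dot w g) \<le> ev w x"
    by (auto simp: ev_diff_scaled)
  show "\<forall>w\<in>weyl_step W g. 0 \<le> ev w x"
    unfolding weyl_step_def
  proof (intro ballI, elim UnE imageE)
    fix w assume "w \<in> {w \<in> W. 0 \<le> dot w g}"
    moreover from this have "0 \<le> t * of_int (dot w g)" using t(1) by simp
    ultimately show "0 \<le> ev w x" using t(2)[of w] by simp
  next
    fix u p assume "u = (case p of (w, w') \<Rightarrow> \<lambda>v. dot w g * w' v - dot w' g * w v)"
      "p \<in> {(w, w'). w \<in> W \<and> w' \<in> W \<and> 0 < dot w g \<and> dot w' g < 0}"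
    then obtain w w' where u: "u = (\<lambda>v. dot w g * w' v - dot w' g * w v)" "w \<in> W" "w' \<in> W" "0 < dot w g" "dot w' g < 0"
      by auto
    have "of_int (dot w g) * (t * of_int (dot w' g)) \<le> of_int (dot w g) * ev w' x"
      using t(2)[OF u(3)] u(4) by (intro mult_left_mono) auto
    moreover have "of_int (dot w' g) * ev w x \<le> of_int (dot w' g) * (t * of_int (dot w g))"
      using t(2)[OF u(2)] u(5) by (intro mult_left_mono_neg) auto
    ultimately show "0 \<le> ev u x" unfolding u(1) ev_weyl_combination by (simp add: mult_ac)
  qed
next
  assume *: "\<forall>w\<in>weyl_step W g. 0 \<le> ev w x"
  define N where "N = {w \<in> W. dot w g < 0}"
  define t where "t = Max (insert 0 ((\<lambda>w. ev w x / of_int (dot w g)) ` N))"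
  have fin: "finite (insert 0 ((\<lambda>w. ev w x / of_int (dot w g)) ` N))" using W by (simp add: N_def)
  have t0: "0 \<le> t" unfolding t_def using fin by simp
  have tN: "ev w x / of_int (dot w g) \<le> t" if "w \<in> N" for w unfolding t_def using fin that by simp
  have tcases: "t = 0 \<or> (\<exists>w\<in>N. t = ev w x / of_int (dot w g))"
    using Max_in[OF fin] by (auto simp: t_def)
  have "t * of_int (dot w g) \<le> ev w x" if w: "w \<in> W" for w
  proof (cases "dot w g" "0 :: int" rule: linorder_cases)
    case less
    have "(of_int (dot w g) :: 'a) < 0" using less by simp
    thus ?thesis using tN[of w] w less by (simp add: N_def neg_divide_le_eq)
  next
    case equal
    thus ?thesis using * w by (auto simp: weyl_step_def)
  next
    case greater
    have g0: "(0::'a) < of_int (dot w g)" using greater by simp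
    from tcases show ?thesis
    proof
      assume "t = 0" thus ?thesis using * w greater by (auto simp: weyl_step_def)
    next
      assume "\<exists>w\<in>N. t = ev w x / of_int (dot w g)"
      then obtain w' where w': "w' \<in> W" "dot w' g < 0" "t = ev w' x / of_int (dot w' g)" by (auto simp: N_def)
      have n: "(of_int (dot w' g) :: 'a) < 0" using w' by simp
      have "(\<lambda>v. dot w g * w' v - dot w' g * w v) \<in> weyl_step W g"
        unfolding weyl_step_def using w w' greater by (intro UnI2 image_eqI[of _ _ "(w, w')"]) auto
      hence "of_int (dot w' g) * ev w x \<le> of_int (dot w g) * ev w' x"
        using * ev_weyl_combination[of w g w' x] by fastforce
      thus ?thesis unfolding w'(3) using n by (simp add: neg_divide_le_eq mult_ac)
    qed
  qed
  thus "\<exists>t\<ge>0. \<forall>w\<in>W. 0 \<le> ev w (\<lambda>v. x v - t * of_int (g v))"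
    using t0 by (auto simp: ev_diff_scaled)
qed

lemma in_cone_insert:
  assumes "finite G" "g \<notin> G"
  shows "in_cone (insert g G) x \<longleftrightarrow> (\<exists>t\<ge>0. in_cone G (\<lambda>v. x v - t * of_int (g v)))"
proof
  assume "in_cone (insert g G) x"
  then obtain l where l: "\<forall>h\<in>insert g G. 0 \<le> l h" "\<And>v. x v = (\<Sum>h\<in>insert g G. l h * of_int (h v))"
    by (auto simp: in_cone_def)
  show "\<exists>t\<ge>0. in_cone G (\<lambda>v. x v - t * of_int (g v))"
    unfolding in_cone_def by (intro exI[of _ "l g"] conjI exI[of _ l]) (use l assms in auto)
next
  assume "\<exists>t\<ge>0. in_cone G (\<lambda>v. x v - t * of_int (g v))"
  then obtain t l where t: "t \<ge> 0" "\<forall>h\<in>G. 0 \<le> l h" "\<And>v. x v - t * of_int (g v) = (\<Sum>h\<in>G. l h * of_int (h v))"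
    by (auto simp: in_cone_def)
  have "(\<Sum>h\<in>G. (l(g := t)) h * of_int (h v)) = (\<Sum>h\<in>G. l h * of_int (h v))" for v
    by (rule sum.cong) (use assms in auto)
  hence "x v = (\<Sum>h\<in>insert g G. (l(g := t)) h * of_int (h v))" for v
    using t(3)[of v] assms by (simp add: algebra_simps)
  thus "in_cone (insert g G) x" unfolding in_cone_def
    by (intro exI[of _ "l(g := t)"]) (use t in auto)
qed

definition coord_forms :: "('v \<Rightarrow> int) set" where
  "coord_forms = (\<lambda>(i, s) v. if v = i then s else 0) ` (UNIV \<times> {1, -1})"

lemma finite_coord_forms: "finite (coord_forms :: ('v::finite \<Rightarrow> int) set)"
  by (simp add: coord_forms_def)

lemma ev_coord: "ev (\<lambda>v. if v = i then s else 0) x = of_int s * x i"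
  by (simp add: ev_def if_distrib[of "\<lambda>z. z * _"] if_distrib[of of_int] cong: if_cong)

lemma in_cone_empty_iff: "in_cone {} x \<longleftrightarrow> (\<forall>w\<in>coord_forms. 0 \<le> ev w x)"
proof -
  have "(\<forall>w\<in>coord_forms. 0 \<le> ev w x) \<longleftrightarrow> (\<forall>i. 0 \<le> x i \<and> x i \<le> 0)" by (auto simp: coord_forms_def ev_coord)
  also have "\<dots> \<longleftrightarrow> (\<forall>i. x i = 0)" by (metis order.antisym order.refl)
  finally have "(\<forall>w\<in>coord_forms. 0 \<le> ev w x) \<longleftrightarrow> (\<forall>i. x i = 0)" .
  moreover have "in_cone {} x \<longleftrightarrow> (\<forall>i. x i = 0)" by (simp add: in_cone_def)
  ultimately show ?thesis by blast
qed

text \<open>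
  Finitely generated cones are polyhedral, by adding the generators one at a time.  Elimination
  computes the same integral forms over every ordered field.
\<close>

theorem weyl:
  assumes "finite G"
  obtains W :: "('v::finite \<Rightarrow> int) set" where "finite W"
    "\<And>x :: 'v \<Rightarrow> rat. in_cone G x \<longleftrightarrow> (\<forall>w\<in>W. 0 \<le> ev w x)"
    "\<And>x :: 'v \<Rightarrow> real. in_cone G x \<longleftrightarrow> (\<forall>w\<in>W. 0 \<le> ev w x)"
  using assms
proof (induction G arbitrary: thesis rule: finite_induct)
  case empty
  show ?case by (rule empty.prems[of coord_forms]) (rule finite_coord_forms in_cone_empty_iff)+
next
  case (insert g G)
  obtain W where W: "finite W" "\<And>x :: 'v \<Rightarrow> rat. in_cone G x \<longleftrightarrow> (\<forall>w\<in>W. 0 \<le> ev w x)"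
    "\<And>x :: 'v \<Rightarrow> real. in_cone G x \<longleftrightarrow> (\<forall>w\<in>W. 0 \<le> ev w x)" using insert.IH by blast
  show ?case
    by (rule insert.prems[of "weyl_step W g"])
       (simp_all add: finite_weyl_step W weyl_step in_cone_insert insert.hyps)
qed

text \<open>
  Polyhedral cones are finitely generated.  Weyl's theorem for the cone spanned by the forms gives
  generators \<open>G\<close>, and Weyl's theorem for the cone spanned by \<open>G\<close> shows that they suffice: the
  forms that define it are nonnegative combinations of those in \<open>W\<close>.
\<close>

theorem minkowski:
  assumes "finite W"
  obtains G :: "('v::finite \<Rightarrow> int) set" where "finite G"
    "\<And>x :: 'v \<Rightarrow> real. in_cone G x \<longleftrightarrow> (\<forall>w\<in>W. 0 \<le> ev w x)"
proof -
  obtain G where G: "finite G" "\<And>x :: 'v \<Rightarrow> rat. in_cone W x \<longleftrightarrow> (\<forall>g\<in>G. 0 \<le> ev g x)"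
    "\<And>x :: 'v \<Rightarrow> real. in_cone W x \<longleftrightarrow> (\<forall>g\<in>G. 0 \<le> ev g x)" by (rule weyl[OF assms]) blast
  obtain W' where W': "finite W'" "\<And>x :: 'v \<Rightarrow> rat. in_cone G x \<longleftrightarrow> (\<forall>g\<in>W'. 0 \<le> ev g x)"
    "\<And>x :: 'v \<Rightarrow> real. in_cone G x \<longleftrightarrow> (\<forall>g\<in>W'. 0 \<le> ev g x)" by (rule weyl[OF G(1)]) blast
  have WG: "0 \<le> dot w g" if "w \<in> W" "g \<in> G" for w g
    using G(3)[of "\<lambda>v. of_int (w v)"] in_coneI[OF assms that(1), where 'b = real] that(2)
    by (simp add: ev_of_int dot_commute)
  have "in_cone G x \<longleftrightarrow> (\<forall>w\<in>W. 0 \<le> ev w x)" for x :: "'v \<Rightarrow> real"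
  proof
    assume "in_cone G x" thus "\<forall>w\<in>W. 0 \<le> ev w x" using in_cone_ev_nonneg WG by blast
  next
    assume x: "\<forall>w\<in>W. 0 \<le> ev w x"
    have "0 \<le> ev w x" if w: "w \<in> W'" for w
    proof -
      have "0 \<le> dot w g" if "g \<in> G" for g
        using W'(3)[of "\<lambda>v. of_int (g v)"] in_coneI[OF G(1) that, where 'b = real] w by (simp add: ev_of_int)
      hence "in_cone W (\<lambda>v. of_int (w v) :: real)" using G(3)[of "\<lambda>v. of_int (w v)"] by (simp add: ev_of_int dot_commute)
      then obtain l where l: "\<forall>h\<in>W. (0::real) \<le> l h" "\<And>v. of_int (w v) = (\<Sum>h\<in>W. l h * of_int (h v))"
        by (auto simp: in_cone_def)
      have "ev w x = (\<Sum>v\<in>UNIV. (\<Sum>h\<in>W. l h * of_int (h v)) * x v)" by (simp add: ev_def l(2))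
      also have "\<dots> = (\<Sum>h\<in>W. l h * ev h x)"
        unfolding ev_def sum_distrib_left sum_distrib_right by (subst sum.swap) (simp add: mult_ac)
      also have "\<dots> \<ge> 0" by (intro sum_nonneg mult_nonneg_nonneg) (use l x in auto)
      finally show ?thesis .
    qed
    thus "in_cone G x" using W'(3) by blast
  qed
  thus ?thesis using that G(1) by blast
qed

section \<open>Dickson's lemma\<close>

text \<open>
  In the induction step, finitely many elements bound all the others from below in the coordinates of
  \<open>S\<close>.  If \<open>m\<close> bounds their
  \<open>i\<close>-th coordinates, they also serve all elements whose \<open>i\<close>-th coordinate is at least \<open>m\<close>;
  each of the \<open>m\<close> remaining slices is treated separately.
\<close>

lemma dickson_coords:
  fixes D :: "('v \<Rightarrow> nat) set"
  assumes "finite S"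
  shows "\<exists>A. finite A \<and> A \<subseteq> D \<and> (\<forall>d\<in>D. \<exists>a\<in>A. \<forall>i\<in>S. a i \<le> d i)"
  using assms
proof (induction S arbitrary: D rule: finite_induct)
  case empty
  show ?case
  proof (cases "D = {}")
    case False
    then obtain d where "d \<in> D" by blast
    thus ?thesis by (intro exI[of _ "{d}"]) auto
  qed auto
next
  case (insert i S)
  obtain A0 where A0: "finite A0" "A0 \<subseteq> D" "\<And>d. d \<in> D \<Longrightarrow> \<exists>a\<in>A0. \<forall>i\<in>S. a i \<le> d i"
    using insert.IH[of D] by blast
  define m where "m = (\<Sum>a\<in>A0. a i)"
  have m: "a i \<le> m" if "a \<in> A0" for a unfolding m_def using A0(1) that by (intro member_le_sum) auto
  have "\<forall>k. \<exists>A. finite A \<and> A \<subseteq> {d \<in> D. d i = k} \<and> (\<forall>d\<in>{d \<in> D. d i = k}. \<exists>a\<in>A. \<forall>i\<in>S. a i \<le> d i)"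
    using insert.IH by blast
  from choice[OF this] obtain A where A': "\<forall>k. finite (A k) \<and> A k \<subseteq> {d \<in> D. d i = k} \<and>
     (\<forall>d\<in>{d \<in> D. d i = k}. \<exists>a\<in>A k. \<forall>i\<in>S. a i \<le> d i)" ..
  have A: "finite (A k)" "A k \<subseteq> {d \<in> D. d i = k}" "d \<in> D \<Longrightarrow> d i = k \<Longrightarrow> \<exists>a\<in>A k. \<forall>i\<in>S. a i \<le> d i" for k d
    using A'[rule_format, of k] by auto
  show ?case
  proof (intro exI[of _ "A0 \<union> (\<Union>k<m. A k)"] conjI ballI)
    show "finite (A0 \<union> (\<Union>k<m. A k))" using A0 A by auto
    show "A0 \<union> (\<Union>k<m. A k) \<subseteq> D" using A0 A by blast
    fix d assume d: "d \<in> D"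
    show "\<exists>a\<in>A0 \<union> (\<Union>k<m. A k). \<forall>i\<in>insert i S. a i \<le> d i"
    proof (cases "d i < m")
      case True
      obtain a where "a \<in> A (d i)" "\<forall>i\<in>S. a i \<le> d i" using A(3)[OF d refl] by blast
      moreover from this have "a i = d i" using A(2) by blast
      ultimately show ?thesis using True by (intro bexI[of _ a]) auto
    next
      case False
      obtain a where a: "a \<in> A0" "\<forall>i\<in>S. a i \<le> d i" using A0(3)[OF d] by blast
      thus ?thesis using False m[OF a(1)] by (intro bexI[of _ a]) auto
    qed
  qed
qed

lemma dickson:
  fixes D :: "('n::finite \<Rightarrow>\<^sub>0 nat) set"
  assumes "up_closed D"
  obtains A where "finite A" "D = {a + c | a c. a \<in> A}"
proof -
  have "\<exists>A. finite A \<and> A \<subseteq> lookup ` D \<and> (\<forall>d\<in>lookup ` D. \<exists>a\<in>A. \<forall>i\<in>UNIV. a i \<le> d i)"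
    by (rule dickson_coords) simp
  then obtain A' where "finite A' \<and> A' \<subseteq> lookup ` D \<and> (\<forall>d\<in>lookup ` D. \<exists>a\<in>A'. \<forall>i\<in>UNIV. a i \<le> d i)" ..
  note A' = this[THEN conjunct1] this[THEN conjunct2, THEN conjunct1] this[THEN conjunct2, THEN conjunct2]
  define A where "A = {a \<in> D. lookup a \<in> A'}"
  have "inj_on lookup A" by (rule inj_onI) (simp add: lookup_inject)
  moreover have "finite (lookup ` A)" by (rule finite_subset[OF _ A'(1)]) (auto simp: A_def)
  ultimately have "finite A" using finite_imageD by blast
  moreover have "D = {a + c | a c. a \<in> A}"
  proof (intro Set.set_eqI iffI)
    fix d assume d: "d \<in> D"
    then obtain a' where a': "a' \<in> A'" "\<And>i. a' i \<le> lookup d i" using A'(3) by auto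
    then obtain a where a: "a \<in> D" "lookup a = a'" using A'(2) by auto
    have "d = a + (d - a)" by (rule poly_mapping_eqI) (simp add: lookup_add lookup_minus a(2) a'(2))
    thus "d \<in> {a + c | a c. a \<in> A}" using a a'(1) by (auto simp: A_def)
  next
    fix d assume "d \<in> {a + c | a c. a \<in> A}"
    thus "d \<in> D" using assms by (auto simp: A_def up_closed_def)
  qed
  ultimately show ?thesis using that by blast
qed

section \<open>Ideals spanned by monomials\<close>

lemma mono_span_sum: "(\<And>x. x \<in> A \<Longrightarrow> f x \<in> mono_span D) \<Longrightarrow> sum f A \<in> mono_span D"
  by (induction A rule: infinite_finite_induct) (auto intro: mono_span_add)

lemma single_mono_span: "b \<in> D \<Longrightarrow> Poly_Mapping.single b k \<in> mono_span D"
  by (simp add: mono_span_def)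

lemma mono_span_ideal:
  fixes D :: "('n::{finite,linorder} \<Rightarrow>\<^sub>0 nat) set"
  assumes "up_closed D"
  shows "ideal (mono_span D :: ('n, 'k::field) mpoly set) mpoly_ring"
proof -
  interpret cring "mpoly_ring :: ('n, 'k) mpoly ring" by (rule cring_ring_of_type_algebra)
  have inv: "inv\<^bsub>add_monoid (mpoly_ring :: ('n, 'k) mpoly ring)\<^esub> x = - x" for x
    using ring_of_type_algebra_a_inv[of x] by (simp add: a_inv_def)
  show ?thesis
  proof (rule idealI)
    show "subgroup (mono_span D :: ('n, 'k) mpoly set) (add_monoid mpoly_ring)"
    proof (rule subgroup.intro)
      fix x :: "('n, 'k) mpoly" assume "x \<in> mono_span D"
      thus "inv\<^bsub>add_monoid mpoly_ring\<^esub> x \<in> mono_span D" unfolding inv by simp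
    qed (auto intro: mono_span_add)
  next
    fix a x :: "('n, 'k) mpoly" assume "a \<in> mono_span D"
    thus "x \<otimes>\<^bsub>mpoly_ring\<^esub> a \<in> mono_span D" "a \<otimes>\<^bsub>mpoly_ring\<^esub> x \<in> mono_span D"
      using mono_span_times[OF assms, of a x] by (simp_all add: mult.commute)
  qed (rule ring_axioms)
qed

lemma ideal_ring_of_type_algebraD:
  fixes J :: "'a::comm_ring_1 set"
  assumes "ideal J ring_of_type_algebra"
  shows "0 \<in> J" "x \<in> J \<Longrightarrow> y \<in> J \<Longrightarrow> x + y \<in> J" "x \<in> J \<Longrightarrow> r * x \<in> J"
    "(\<And>a. a \<in> A \<Longrightarrow> f a \<in> J) \<Longrightarrow> sum f A \<in> J"
proof -
  interpret ideal J ring_of_type_algebra by fact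
  show 0: "0 \<in> J" using additive_subgroup.zero_closed[OF is_additive_subgroup] by simp
  show add: "x + y \<in> J" if "x \<in> J" "y \<in> J" for x y using additive_subgroup.a_closed[OF is_additive_subgroup that] by simp
  show "r * x \<in> J" if "x \<in> J" using I_l_closed[OF that, of r] by simp
  show "(\<And>a. a \<in> A \<Longrightarrow> f a \<in> J) \<Longrightarrow> sum f A \<in> J"
    by (induction A rule: infinite_finite_induct) (auto intro: 0 add)
qed

lemma up_closed_generated: "up_closed {a + c | a c. a \<in> A}"
  unfolding up_closed_def
proof (intro ballI allI)
  fix b c assume "b \<in> {a + c | a c. a \<in> A}"
  then obtain a d where "b = a + d" "a \<in> A" by blast
  hence "b + c = a + (d + c)" by (simp add: add.assoc)
  thus "b + c \<in> {a + c | a c. a \<in> A}" using \<open>a \<in> A\<close> by blast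
qed

lemma monomial_idealE:
  fixes I :: "('n::{finite,linorder}, 'k::field) mpoly set"
  assumes "monomial_ideal I"
  obtains D where "up_closed D" "I = mono_span D"
proof -
  interpret cring "mpoly_ring :: ('n, 'k) mpoly ring" by (rule cring_ring_of_type_algebra)
  obtain A where A: "I = Idl\<^bsub>mpoly_ring\<^esub> (xpow ` A)" using assms by (auto simp: monomial_ideal_def)
  let ?D = "{a + c | a c. a \<in> A}"
  have "I = mono_span ?D"
  proof
    have "xpow a \<in> (mono_span ?D :: ('n, 'k) mpoly set)" if "a \<in> A" for a
      using that by (intro single_mono_span) (metis (mono_tags, lifting) CollectI add.right_neutral)
    thus "I \<subseteq> mono_span ?D" unfolding A
      by (intro genideal_minimal mono_span_ideal up_closed_generated) auto
  next
    have I: "ideal I mpoly_ring" unfolding A by (rule genideal_ideal) simp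
    show "mono_span ?D \<subseteq> I"
    proof
      fix f :: "('n, 'k) mpoly" assume f: "f \<in> mono_span ?D"
      have "Poly_Mapping.single b (lookup f b) \<in> I" if "b \<in> keys f" for b
      proof -
        have "b \<in> ?D" using f that unfolding mono_span_def by blast
        then obtain a c where b: "b = a + c" "a \<in> A" by blast
        have "xpow a \<in> I" unfolding A using genideal_self[of "xpow ` A"] b(2) by auto
        hence "Poly_Mapping.single c (lookup f b) * xpow a \<in> I" by (rule ideal_ring_of_type_algebraD(3)[OF I])
        thus ?thesis by (simp add: mult_single b(1) add.commute)
      qed
      hence "(\<Sum>b\<in>keys f. Poly_Mapping.single b (lookup f b)) \<in> I" by (rule ideal_ring_of_type_algebraD(4)[OF I])
      thus "f \<in> I" by (simp add: poly_mapping_sum_single[symmetric])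
    qed
  qed
  thus ?thesis using that up_closed_generated by blast
qed

text \<open>
  The exponents in the \<open>m\<close>-th power of the ideal spanned by \<open>D\<close>.  For \<open>m = 0\<close> this is the whole ring, hence
  \<open>UNIV\<close> instead of \<open>{0}\<close>.
\<close>

primrec sumset_pow :: "('n \<Rightarrow>\<^sub>0 nat) set \<Rightarrow> nat \<Rightarrow> ('n \<Rightarrow>\<^sub>0 nat) set" where
  "sumset_pow D 0 = UNIV"
| "sumset_pow D (Suc m) = {a + b | a b. a \<in> D \<and> b \<in> sumset_pow D m}"

lemma sumset_pow_up_closed: "up_closed D \<Longrightarrow> up_closed (sumset_pow D m)"
proof (induction m)
  case (Suc m)
  show ?case unfolding up_closed_def
  proof (intro ballI allI)
    fix x c assume "x \<in> sumset_pow D (Suc m)"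
    then obtain a b where x: "x = a + b" "a \<in> D" "b \<in> sumset_pow D m" by auto
    have "b + c \<in> sumset_pow D m" using Suc x(3) by (auto simp: up_closed_def)
    thus "x + c \<in> sumset_pow D (Suc m)" using x by (auto simp: add.assoc)
  qed
qed (simp add: up_closed_def)

lemma sumset_pow_mult:
  fixes a :: "'n \<Rightarrow>\<^sub>0 nat"
  assumes "a \<in> sumset_pow D m" "b \<in> sumset_pow D m'" "up_closed D"
  shows "a + b \<in> sumset_pow D (m + m')"
  using assms(1)
proof (induction m arbitrary: a)
  case 0
  have "b + a \<in> sumset_pow D m'" using assms(2) sumset_pow_up_closed[OF assms(3)] by (auto simp: up_closed_def)
  thus ?case by (simp add: add.commute)
next
  case (Suc m)
  then obtain c d where a: "a = c + d" "c \<in> D" "d \<in> sumset_pow D m" by auto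
  hence "d + b \<in> sumset_pow D (m + m')" using Suc.IH by blast
  thus ?case using a by (auto simp: add.assoc)
qed

lemma sumset_pow_antimono: "up_closed D \<Longrightarrow> m \<le> m' \<Longrightarrow> sumset_pow D m' \<subseteq> sumset_pow D m"
proof
  fix a assume D: "up_closed D" "m \<le> m'" and "a \<in> sumset_pow D m'"
  thus "a \<in> sumset_pow D m"
  proof (induction "m' - m" arbitrary: m)
    case (Suc k)
    have "k = m' - Suc m" "Suc m \<le> m'" using Suc.hyps(2) by simp_all
    hence "a \<in> sumset_pow D (Suc m)" using Suc.hyps(1)[of "Suc m"] Suc.prems by blast
    then obtain b c where "a = b + c" "c \<in> sumset_pow D m" by auto
    hence "c + b \<in> sumset_pow D m" using sumset_pow_up_closed[OF D(1)] by (auto simp: up_closed_def)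
    thus ?case using \<open>a = b + c\<close> by (simp add: add.commute)
  qed simp
qed

lemma mono_span_prod:
  fixes D E :: "('n::{finite,linorder} \<Rightarrow>\<^sub>0 nat) set"
  assumes D: "up_closed D" and E: "up_closed E"
  shows "(mono_span D :: ('n, 'k::field) mpoly set) \<cdot>\<^bsub>mpoly_ring\<^esub> mono_span E = mono_span {a + b | a b. a \<in> D \<and> b \<in> E}"
proof -
  interpret cring "mpoly_ring :: ('n, 'k) mpoly ring" by (rule cring_ring_of_type_algebra)
  let ?P = "{a + b | a b. a \<in> D \<and> b \<in> E}"
  have *: "f * g \<in> mono_span ?P" if "f \<in> mono_span D" "g \<in> mono_span E" for f g :: "('n, 'k) mpoly"
    using that keys_mult[of f g] by (force simp: mono_span_def)
  have ip: "ideal ((mono_span D :: ('n, 'k) mpoly set) \<cdot>\<^bsub>mpoly_ring\<^esub> mono_span E) mpoly_ring"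
    by (intro ideal_prod_is_ideal mono_span_ideal D E)
  show ?thesis
  proof (intro equalityI subsetI)
    fix f :: "('n, 'k) mpoly" assume "f \<in> mono_span D \<cdot>\<^bsub>mpoly_ring\<^esub> mono_span E"
    thus "f \<in> mono_span ?P"
      by (induction rule: ideal_prod.induct) (auto intro: * mono_span_add)
  next
    fix f :: "('n, 'k) mpoly" assume f: "f \<in> mono_span ?P"
    have "Poly_Mapping.single b (lookup f b) \<in> mono_span D \<cdot>\<^bsub>mpoly_ring\<^esub> mono_span E" if "b \<in> keys f" for b
    proof -
      have "b \<in> ?P" using f that unfolding mono_span_def by blast
      then obtain a c where b: "b = a + c" "a \<in> D" "c \<in> E" by blast
      have "Poly_Mapping.single a (lookup f b) \<otimes>\<^bsub>mpoly_ring\<^esub> xpow c \<in> mono_span D \<cdot>\<^bsub>mpoly_ring\<^esub> mono_span E"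
        by (intro ideal_prod.prod single_mono_span b)
      thus ?thesis by (simp add: mult_single b(1))
    qed
    hence "(\<Sum>b\<in>keys f. Poly_Mapping.single b (lookup f b)) \<in> mono_span D \<cdot>\<^bsub>mpoly_ring\<^esub> mono_span E"
      by (rule ideal_ring_of_type_algebraD(4)[OF ip])
    thus "f \<in> mono_span D \<cdot>\<^bsub>mpoly_ring\<^esub> mono_span E" by (simp add: poly_mapping_sum_single[symmetric])
  qed
qed

lemma ideal_power_mono_span:
  fixes D :: "('n::{finite,linorder} \<Rightarrow>\<^sub>0 nat) set"
  assumes D: "up_closed D"
  shows "ideal_power mpoly_ring (mono_span D :: ('n, 'k::field) mpoly set) m = mono_span (sumset_pow D m)"
proof (induction m)
  case 0 show ?case by (simp add: mono_span_def)
next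
  case (Suc m)
  show ?case by (simp add: Suc mono_span_prod[OF D sumset_pow_up_closed[OF D]])
qed

section \<open>Monomial valuations\<close>

definition wt :: "('n::finite \<Rightarrow> int) \<Rightarrow> ('n \<Rightarrow>\<^sub>0 nat) \<Rightarrow> int" where
  "wt w b = (\<Sum>i\<in>UNIV. w i * int (lookup b i))"

lemma wt_add: "wt w (a + b) = wt w a + wt w b"
  by (simp add: wt_def lookup_add ring_distribs sum.distrib)

lemma wt_0 [simp]: "wt w 0 = 0"
  by (simp add: wt_def)

lemma wt_nonneg: "(\<And>i. 0 \<le> w i) \<Longrightarrow> 0 \<le> wt w b"
  by (simp add: wt_def sum_nonneg)

text \<open>
  The smallest exponent for the weight \<open>w\<close>, where ties are broken by the order of exponent vectors.
\<close>

definition initial :: "('n::{finite,linorder} \<Rightarrow> int) \<Rightarrow> ('n, 'k::field) mpoly \<Rightarrow> ('n \<Rightarrow>\<^sub>0 nat) \<Rightarrow> bool" where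
  "initial w f m \<longleftrightarrow> m \<in> keys f \<and> (\<forall>b\<in>keys f. wt w m < wt w b \<or> wt w m = wt w b \<and> m \<le> b)"

lemma ex_initial:
  fixes f :: "('n::{finite,linorder}, 'k::field) mpoly"
  assumes "f \<noteq> 0"
  obtains m where "initial w f m"
proof -
  have ne: "keys f \<noteq> {}" using assms by (metis all_not_in_conv not_in_keys_iff_lookup_eq_zero poly_mapping_eqI lookup_zero)
  define V where "V = Min (wt w ` keys f)"
  define M where "M = {b \<in> keys f. wt w b = V}"
  have "V \<in> wt w ` keys f" unfolding V_def using ne by (intro Min_in) auto
  hence M: "M \<noteq> {}" "finite M" by (auto simp: M_def)
  have "initial w f (Min M)"
    unfolding initial_def
  proof (intro conjI ballI)
    have m: "Min M \<in> M" using M by (intro Min_in)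
    show "Min M \<in> keys f" using m by (simp add: M_def)
    fix b assume b: "b \<in> keys f"
    have "V \<le> wt w b" unfolding V_def using b by simp
    moreover have "Min M \<le> b" if "wt w b = V" using that b M(2) by (simp add: M_def)
    moreover have "wt w (Min M) = V" using m by (simp add: M_def)
    ultimately show "wt w (Min M) < wt w b \<or> wt w (Min M) = wt w b \<and> Min M \<le> b" by force
  qed
  thus ?thesis by (rule that)
qed

lemma initial_wt_le: "initial w f m \<Longrightarrow> b \<in> keys f \<Longrightarrow> wt w m \<le> wt w b"
  by (auto simp: initial_def)

text \<open>
  Only one pair of exponents contributes to the initial coefficient of a product.  So the least weight
  is a valuation.
\<close>

lemma initial_mult:
  fixes f g :: "('n::{finite,linorder}, 'k::field) mpoly"
  assumes f: "initial w f m" and g: "initial w g m'"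
  shows "initial w (f * g) (m + m')"
proof -
  have less: "(wt w (m + m') < wt w (a + b) \<or> wt w (m + m') = wt w (a + b) \<and> m + m' \<le> a + b) \<and> (a + b = m + m' \<longrightarrow> a = m \<and> b = m')"
    if "a \<in> keys f" "b \<in> keys g" for a b
  proof -
    have a: "wt w m < wt w a \<or> wt w m = wt w a \<and> m \<le> a" and b: "wt w m' < wt w b \<or> wt w m' = wt w b \<and> m' \<le> b"
      using f g that by (auto simp: initial_def)
    have "m \<le> a \<Longrightarrow> m' \<le> b \<Longrightarrow> m + m' \<le> a + b" by (rule add_mono)
    moreover have "a = m \<and> b = m'" if eq: "a + b = m + m'"
    proof -
      have "wt w a + wt w b = wt w m + wt w m'" using eq by (metis wt_add)
      hence le: "m \<le> a" "m' \<le> b" using a b by auto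
      hence "m + b \<le> a + b" "m + m' \<le> m + b" by (auto intro: add_right_mono add_left_mono)
      hence "m + b = a + b" using eq by auto
      hence "a = m" by simp
      thus ?thesis using eq by simp
    qed
    ultimately show ?thesis using a b by (auto simp: wt_add)
  qed
  have "lookup (f * g) (m + m') = (\<Sum>a\<in>keys f. lookup f a * (\<Sum>q. lookup g q when m + m' = a + q))"
    unfolding lookup_mult by (rule Sum_any.expand_superset) (auto simp: in_keys_iff)
  also have "\<dots> = (\<Sum>a\<in>keys f. if a = m then lookup f m * lookup g m' else 0)"
  proof (rule sum.cong)
    fix a assume a: "a \<in> keys f"
    show "lookup f a * (\<Sum>q. lookup g q when m + m' = a + q) = (if a = m then lookup f m * lookup g m' else 0)"
    proof (cases "a = m")
      case True
      thus ?thesis by simp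
    next
      case False
      have "(lookup g q when m + m' = a + q) = 0" for q
        using less[OF a, of q] False by (cases "lookup g q = 0") (auto simp: when_def in_keys_iff)
      thus ?thesis using False by simp
    qed
  qed simp
  also have "\<dots> = lookup f m * lookup g m'" using f by (simp add: initial_def)
  finally have "m + m' \<in> keys (f * g)" using f g by (simp add: initial_def in_keys_iff)
  moreover have "wt w (m + m') < wt w c \<or> wt w (m + m') = wt w c \<and> m + m' \<le> c" if "c \<in> keys (f * g)" for c
    using that keys_mult[of f g] less by blast
  ultimately show ?thesis by (simp add: initial_def)
qed

section \<open>Integral closure of monomial ideals\<close>

definition nmul :: "nat \<Rightarrow> ('n \<Rightarrow>\<^sub>0 nat) \<Rightarrow> ('n \<Rightarrow>\<^sub>0 nat)" where
  "nmul d b = (\<Sum>i<d. b)"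

lemma nmul_0 [simp]: "nmul 0 b = 0"
  by (simp add: nmul_def)

lemma nmul_Suc: "nmul (Suc d) b = b + nmul d b"
  by (simp add: nmul_def add.commute)

lemma nmul_add: "nmul (d + d') b = nmul d b + nmul d' b"
  by (induction d) (simp_all add: nmul_Suc add.assoc)

lemma lookup_nmul: "lookup (nmul d b) i = d * lookup b i"
  by (simp add: nmul_def lookup_sum)

lemma wt_nmul: "wt w (nmul d b) = int d * wt w b"
  by (induction d) (simp_all add: nmul_Suc wt_add algebra_simps)

lemma initial_power:
  fixes f :: "('n::{finite,linorder}, 'k::field) mpoly"
  assumes "initial w f m"
  shows "initial w (f ^ d) (nmul d m)"
proof (induction d)
  case 0 show ?case by (simp add: initial_def)
next
  case (Suc d)
  show ?case unfolding nmul_Suc power_Suc by (rule initial_mult[OF assms Suc])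
qed

lemma keys_power_wt:
  fixes g :: "('n::{finite,linorder}, 'k::field) mpoly" and v :: rat
  assumes "\<And>b. b \<in> keys g \<Longrightarrow> v \<le> of_int (wt w b)" "b \<in> keys (g ^ d)"
  shows "of_nat d * v \<le> of_int (wt w b)"
  using assms(2)
proof (induction d arbitrary: b)
  case (Suc d)
  then obtain a c where b: "b = a + c" "a \<in> keys g" "c \<in> keys (g ^ d)"
    using keys_mult[of g "g ^ d"] unfolding power_Suc by blast
  show ?case using assms(1)[OF b(2)] Suc.IH[OF b(3)] by (simp add: b(1) wt_add algebra_simps)
qed simp

lemma sumset_pow_wt:
  assumes "\<And>a. a \<in> D \<Longrightarrow> c \<le> wt w a" "\<And>i. 0 \<le> w i" "b \<in> sumset_pow D m"
  shows "int m * c \<le> wt w b"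
  using assms(3)
proof (induction m arbitrary: b)
  case 0 thus ?case using wt_nonneg[of w b] assms(2) by simp
next
  case (Suc m)
  then obtain a d where b: "b = a + d" "a \<in> D" "d \<in> sumset_pow D m" by auto
  show ?case using assms(1)[OF b(2)] Suc.IH[OF b(3)] by (simp add: b(1) wt_add algebra_simps)
qed

text \<open>
  If \<open>g\<close> had weight less than \<open>c\<close>, the initial monomial of \<open>g\<^sup>d\<close> would have smaller weight than all the
  other terms of the equation of integral dependence, and could not cancel.
\<close>

lemma integral_closure_wt:
  fixes g :: "('n::{finite,linorder}, 'k::field) mpoly"
  assumes E: "up_closed E" and w: "\<And>i. 0 \<le> w i" and c: "\<And>a. a \<in> E \<Longrightarrow> c \<le> wt w a"
    and g: "g \<in> integral_closure mpoly_ring (mono_span E)" and b: "b \<in> keys g"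
  shows "c \<le> wt w b"
proof -
  obtain m where m: "initial w g m" using ex_initial[of g w] b by (metis empty_iff keys_zero)
  have "c \<le> wt w m"
  proof (rule ccontr)
    assume less: "\<not> c \<le> wt w m"
    obtain d a where d: "d \<ge> 1" and a: "\<forall>j\<in>{1..d}. a j \<in> ideal_power mpoly_ring (mono_span E) j"
      and eq: "g ^ d + (\<Sum>j\<in>{1..d}. a j * g ^ (d - j)) = 0"
      using g by (auto simp: integral_closure_def ring_of_type_algebra_finsum)
    have k: "nmul d m \<in> keys (g ^ d)" using initial_power[OF m, of d] by (simp add: initial_def)
    have "lookup (a j * g ^ (d - j)) (nmul d m) = 0" if j: "j \<in> {1..d}" for j
    proof (rule ccontr)
      assume "lookup (a j * g ^ (d - j)) (nmul d m) \<noteq> 0"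
      then obtain x y where xy: "nmul d m = x + y" "x \<in> keys (a j)" "y \<in> keys (g ^ (d - j))"
        using keys_mult[of "a j" "g ^ (d - j)"] by (auto simp: in_keys_iff)
      have "a j \<in> mono_span (sumset_pow E j)" using a j by (auto simp: ideal_power_mono_span[OF E])
      hence "x \<in> sumset_pow E j" using xy(2) by (auto simp: mono_span_def)
      hence 1: "int j * c \<le> wt w x" by (intro sumset_pow_wt[of E c w] c w)
      have "of_nat (d - j) * (of_int (wt w m) :: rat) \<le> of_int (wt w y)"
        by (rule keys_power_wt[OF _ xy(3)]) (use initial_wt_le[OF m] in simp)
      hence 2: "int (d - j) * wt w m \<le> wt w y" by (metis of_int_le_iff of_int_mult of_int_of_nat_eq)
      have "int d * wt w m = wt w x + wt w y" by (metis xy(1) wt_add wt_nmul)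
      moreover have "int d * wt w m = int j * wt w m + int (d - j) * wt w m"
        using j by (simp add: of_nat_diff algebra_simps)
      ultimately have "int j * c \<le> int j * wt w m" using 1 2 by linarith
      thus False using less j by simp
    qed
    hence "lookup (\<Sum>j\<in>{1..d}. a j * g ^ (d - j)) (nmul d m) = 0" by (simp add: lookup_sum)
    hence "lookup (g ^ d + (\<Sum>j\<in>{1..d}. a j * g ^ (d - j))) (nmul d m) = lookup (g ^ d) (nmul d m)"
      by (simp add: lookup_add)
    thus False using k unfolding eq by (simp add: in_keys_iff)
  qed
  thus ?thesis using initial_wt_le[OF m b] by simp
qed

subsection \<open>A determinant argument\<close>

text \<open>
  The powers of the ideal \<open>K\<close> spanned by \<open>E\<close>, where \<open>K\<^sup>z = R\<close> for negative \<open>z\<close>.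
\<close>

definition graded_part :: "('n \<Rightarrow>\<^sub>0 nat) set \<Rightarrow> int \<Rightarrow> ('n::{finite,linorder}, 'k::field) mpoly set" where
  "graded_part E z = mono_span (sumset_pow E (nat z))"

lemma graded_part_mult:
  assumes E: "up_closed E" and "f \<in> graded_part E z" "g \<in> graded_part E z'"
  shows "f * g \<in> graded_part E (z + z')"
proof -
  have "a + b \<in> sumset_pow E (nat (z + z'))" if "a \<in> sumset_pow E (nat z)" "b \<in> sumset_pow E (nat z')" for a b
  proof -
    have "nat (z + z') \<le> nat z + nat z'" by linarith
    thus ?thesis using sumset_pow_mult[OF that E] sumset_pow_antimono[OF E] by blast
  qed
  thus ?thesis using assms(2,3) keys_mult[of f g] unfolding graded_part_def mono_span_def by blast
qed

lemma graded_part_UNIV [simp]: "z \<le> 0 \<Longrightarrow> f \<in> graded_part E z"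
  by (simp add: graded_part_def mono_span_def)

lemma graded_part_zero [simp]: "0 \<in> graded_part E z"
  by (simp add: graded_part_def)

text \<open>
  The polynomials in one variable \<open>T\<close> that are homogeneous of degree \<open>z\<close> if \<open>T\<close> and \<open>K\<close> have degree \<open>1\<close>.  A monic
  one is an equation of integral dependence on \<open>K\<close>.
\<close>

definition graded_polys :: "('n \<Rightarrow>\<^sub>0 nat) set \<Rightarrow> int \<Rightarrow> ('n::{finite,linorder}, 'k::field) mpoly poly set" where
  "graded_polys E z = {P. \<forall>i. poly.coeff P i \<in> graded_part E (z - int i)}"

lemma graded_polys_mult:
  assumes E: "up_closed E" and P: "P \<in> graded_polys E z" and Q: "Q \<in> graded_polys E z'"
  shows "P * Q \<in> graded_polys E (z + z')"
  unfolding graded_polys_def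
proof (intro CollectI allI)
  fix n
  have "poly.coeff P i * poly.coeff Q (n - i) \<in> graded_part E (z + z' - int n)" if "i \<le> n" for i
  proof -
    have "poly.coeff P i * poly.coeff Q (n - i) \<in> graded_part E ((z - int i) + (z' - int (n - i)))"
      using P Q by (intro graded_part_mult[OF E]) (auto simp: graded_polys_def)
    thus ?thesis using that by (simp add: of_nat_diff algebra_simps)
  qed
  thus "poly.coeff (P * Q) n \<in> graded_part E (z + z' - int n)"
    unfolding coeff_mult graded_part_def by (intro mono_span_sum) auto
qed

lemma graded_polys_1: "1 \<in> graded_polys E 0"
  by (auto simp: graded_polys_def one_pCons coeff_pCons split: nat.splits)

lemma graded_polys_prod:
  assumes E: "up_closed E" and "finite S" "\<And>i. i \<in> S \<Longrightarrow> P i \<in> graded_polys E (z i)"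
  shows "(\<Prod>i\<in>S. P i) \<in> graded_polys E (\<Sum>i\<in>S. z i)"
  using assms(2,3) by (induction S rule: finite_induct) (auto intro: graded_polys_mult[OF E] graded_polys_1)

lemma graded_polys_sum: "(\<And>i. i \<in> S \<Longrightarrow> P i \<in> graded_polys E z) \<Longrightarrow> (\<Sum>i\<in>S. P i) \<in> graded_polys E z"
  unfolding graded_polys_def by (auto simp: coeff_sum graded_part_def intro: mono_span_sum)

lemma graded_polys_uminus: "P \<in> graded_polys E z \<Longrightarrow> - P \<in> graded_polys E z"
  by (simp add: graded_polys_def graded_part_def)

text \<open>
  The weights \<open>d\<close> cancel in each term of the Leibniz expansion.
\<close>

lemma char_poly_graded:
  fixes A :: "('n::{finite,linorder}, 'k::field) mpoly mat"
  assumes E: "up_closed E" and A: "A \<in> carrier_mat M M"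
    and deg: "\<And>i j. i < M \<Longrightarrow> j < M \<Longrightarrow> A $$ (i, j) \<in> graded_part E (1 + d i - d j)"
  shows "char_poly A \<in> graded_polys E (int M)"
proof -
  have entry: "char_poly_matrix A $$ (i, j) \<in> graded_polys E (1 + d i - d j)" if "i < M" "j < M" for i j
    unfolding graded_polys_def
  proof (intro CollectI allI)
    fix k
    have "- A $$ (i, j) \<in> graded_part E (1 + d i - d j)" using deg[OF that] by (simp add: graded_part_def)
    thus "poly.coeff (char_poly_matrix A $$ (i, j)) k \<in> graded_part E (1 + d i - d j - int k)"
      using that A by (auto simp: char_poly_matrix_def coeff_pCons split: nat.splits)
  qed
  have "char_poly A = (\<Sum>p | p permutes {0..<M}. signof p * (\<Prod>i = 0..<M. char_poly_matrix A $$ (i, p i)))"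
    unfolding char_poly_def by (rule det_def') (use A in simp)
  also have "\<dots> \<in> graded_polys E (int M)"
  proof (rule graded_polys_sum)
    fix p assume "p \<in> {p. p permutes {0..<M}}"
    hence p: "p permutes {0..<M}" by simp
    have "(\<Prod>i = 0..<M. char_poly_matrix A $$ (i, p i)) \<in> graded_polys E (\<Sum>i = 0..<M. 1 + d i - d (p i))"
      by (rule graded_polys_prod[OF E]) (use p in \<open>auto intro!: entry simp: permutes_in_image\<close>)
    also have "(\<Sum>i = 0..<M. 1 + d i - d (p i)) = int M"
      using sum.permute[OF p, of d] by (simp add: sum.distrib sum_subtractf comp_def)
    finally show "signof p * (\<Prod>i = 0..<M. char_poly_matrix A $$ (i, p i)) \<in> graded_polys E (int M)"
      by (cases p rule: sign_cases) (simp_all add: graded_polys_uminus)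
  qed
  finally show ?thesis .
qed

text \<open>
  The vector \<open>v\<close> is an eigenvector with eigenvalue \<open>g\<close>, so \<open>g\<close> is a root of the characteristic polynomial.
\<close>

lemma integral_closureI_matrix:
  fixes A :: "('n::{finite,linorder}, 'k::field) mpoly mat"
  assumes E: "up_closed E" and A: "A \<in> carrier_mat M M" and "0 < M"
    and deg: "\<And>i j. i < M \<Longrightarrow> j < M \<Longrightarrow> A $$ (i, j) \<in> graded_part E (1 + d i - d j)"
    and v: "\<And>i. i < M \<Longrightarrow> g * v i = (\<Sum>j<M. A $$ (i, j) * v j)" "v 0 \<noteq> 0"
  shows "g \<in> integral_closure mpoly_ring (mono_span E)"
proof -
  define P where "P = char_poly A"
  have P: "degree P = M" "poly.coeff P M = 1" using degree_monic_char_poly[OF A] by (simp_all add: P_def)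
  have Pg: "P \<in> graded_polys E (int M)" unfolding P_def by (rule char_poly_graded[OF E A deg])
  define C where "C = mat M M (\<lambda>(i, j). (if i = j then g else 0) - A $$ (i, j))"
  have C: "C \<in> carrier_mat M M" by (simp add: C_def)
  have "poly P g = det C"
    unfolding P_def char_poly_def
    by (rule poly_det_cong[OF C]) (use A in \<open>auto simp: C_def char_poly_matrix_def\<close>)
  also have "det C = 0"
    unfolding det_0_iff_vec_prod_zero[OF C]
  proof (intro exI conjI)
    show "vec M v \<in> carrier_vec M" by simp
    show "vec M v \<noteq> 0\<^sub>v M"
    proof
      assume "vec M v = 0\<^sub>v M"
      hence "vec M v $ 0 = 0\<^sub>v M $ 0" by simp
      thus False using v(2) \<open>0 < M\<close> by simp
    qed
    show "C *\<^sub>v vec M v = 0\<^sub>v M"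
    proof (rule eq_vecI)
      fix i assume "i < dim_vec (0\<^sub>v M :: ('n, 'k) mpoly vec)"
      hence i: "i < M" by simp
      have "(C *\<^sub>v vec M v) $ i = (\<Sum>j = 0..<M. ((if i = j then g else 0) - A $$ (i, j)) * v j)"
        using i by (simp add: C_def scalar_prod_def)
      also have "\<dots> = (\<Sum>j = 0..<M. (if i = j then g * v j else 0)) - (\<Sum>j = 0..<M. A $$ (i, j) * v j)"
        unfolding sum_subtractf[symmetric] by (rule sum.cong) (auto simp: left_diff_distrib)
      also have "\<dots> = 0" using i v(1)[OF i] by (simp add: atLeast0LessThan)
      finally show "(C *\<^sub>v vec M v) $ i = 0\<^sub>v M $ i" using i by simp
    qed (simp add: C_def)
  qed
  finally have root: "(\<Sum>i\<le>M. poly.coeff P i * g ^ i) = 0" unfolding poly_altdef P(1) .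
  have "(\<Sum>i\<le>M. poly.coeff P i * g ^ i) = (\<Sum>i<M. poly.coeff P i * g ^ i) + g ^ M"
    using P(2) by (simp add: lessThan_Suc_atMost[symmetric])
  also have "(\<Sum>i<M. poly.coeff P i * g ^ i) = (\<Sum>j\<in>{1..M}. poly.coeff P (M - j) * g ^ (M - j))"
    by (rule sum.reindex_bij_witness[of _ "\<lambda>j. M - j" "\<lambda>i. M - i"]) auto
  finally have "g ^ M + (\<Sum>j\<in>{1..M}. poly.coeff P (M - j) * g ^ (M - j)) = 0" using root by (simp add: add.commute)
  moreover have "poly.coeff P (M - j) \<in> ideal_power mpoly_ring (mono_span E) j" if "j \<in> {1..M}" for j
    using Pg that unfolding ideal_power_mono_span[OF E] graded_polys_def graded_part_def
    by (auto dest!: spec[of _ "M - j"] simp: of_nat_diff)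
  ultimately show ?thesis using \<open>0 < M\<close>
    unfolding integral_closure_def
    by (auto simp: ring_of_type_algebra_finsum intro!: exI[of _ M] exI[of _ "\<lambda>j. poly.coeff P (M - j)"])
qed

lemma nmul_sumset_pow_mult:
  assumes E: "up_closed E" and "nmul N k \<in> sumset_pow E N"
  shows "nmul (r * N) k \<in> sumset_pow E (r * N)"
proof (induction r)
  case (Suc r)
  have "nmul N k + nmul (r * N) k \<in> sumset_pow E (N + r * N)" by (rule sumset_pow_mult[OF assms(2) Suc E])
  thus ?case by (simp add: nmul_add)
qed simp

text \<open>
  Let \<open>N\<close> be a common exponent for which the \<open>N\<close>-th power of each monomial \<open>x\<^sup>k\<close> of \<open>g\<close> lies in the \<open>N\<close>-th power
  of the ideal.  Multiplication by \<open>x\<^sup>k\<close> maps the products of the monomials of \<open>g\<close> with exponents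
  below \<open>N\<close> to each other, except that the exponent \<open>N\<close> wraps around to \<open>0\<close> with the coefficient
  \<open>x\<^bsup>Nk\<^esup>\<close>.  This gives a matrix with eigenvalue \<open>g\<close>, homogeneous for the total exponent as weight.
\<close>

lemma integral_closureI_monomials:
  fixes g :: "('n::{finite,linorder}, 'k::field) mpoly"
  assumes E: "up_closed E" and keys: "\<And>k. k \<in> keys g \<Longrightarrow> \<exists>N\<ge>1. nmul N k \<in> sumset_pow E N"
  shows "g \<in> integral_closure mpoly_ring (mono_span E)"
proof -
  from keys have "\<forall>k\<in>keys g. \<exists>N. N \<ge> 1 \<and> nmul N k \<in> sumset_pow E N" by blast
  from bchoice[OF this] obtain Nk where Nk: "\<And>k. k \<in> keys g \<Longrightarrow> Nk k \<ge> 1 \<and> nmul (Nk k) k \<in> sumset_pow E (Nk k)" by blast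
  define N where "N = (\<Prod>k\<in>keys g. Nk k)"
  have N1: "N \<ge> 1" unfolding N_def using Nk by (simp add: Suc_le_eq prod_pos)
  have N: "nmul N k \<in> sumset_pow E N" if k: "k \<in> keys g" for k
  proof -
    have "N = (\<Prod>k\<in>keys g - {k}. Nk k) * Nk k" unfolding N_def by (simp add: prod.remove[OF _ k] mult.commute)
    thus ?thesis using nmul_sumset_pow_mult[OF E] Nk[OF k] by metis
  qed
  define T where "T = PiE (keys g) (\<lambda>_. {..<N})"
  have T: "finite T" unfolding T_def by (simp add: finite_PiE)
  define M where "M = card T"
  obtain h where h: "bij_betw h {0..<M} T" using ex_bij_betw_nat_finite[OF T] by (auto simp: M_def)
  have hT: "h i \<in> T" if "i < M" for i using h that by (auto simp: bij_betw_def)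
  have "(\<lambda>k\<in>keys g. 0) \<in> T" using N1 by (auto simp: T_def)
  hence M0: "0 < M" unfolding M_def using T card_gt_0_iff by blast
  define succ where "succ k e = e(k := if Suc (e k) < N then Suc (e k) else 0)" for k and e :: "('n \<Rightarrow>\<^sub>0 nat) \<Rightarrow> nat"
  define carry where "carry k e = (if Suc (e k) < N then 0 else nmul N k)" for k and e :: "('n \<Rightarrow>\<^sub>0 nat) \<Rightarrow> nat"
  define wT where "wT e = (\<Sum>k\<in>keys g. int (e k))" for e
  define ex where "ex e = (\<Sum>k\<in>keys g. nmul (e k) k)" for e
  have succT: "succ k e \<in> T" if "k \<in> keys g" "e \<in> T" for k e
    using that N1 by (auto simp: T_def succ_def PiE_def extensional_def)
  have eN: "e k < N" if "k \<in> keys g" "e \<in> T" for k e using that by (auto simp: T_def)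
  have ex_succ: "k + ex e = carry k e + ex (succ k e)" if "k \<in> keys g" "e \<in> T" for k e
  proof -
    have 1: "ex e = nmul (e k) k + (\<Sum>l\<in>keys g - {k}. nmul (e l) l)"
      unfolding ex_def by (rule sum.remove) (use that in auto)
    have 2: "ex (succ k e) = nmul (if Suc (e k) < N then Suc (e k) else 0) k + (\<Sum>l\<in>keys g - {k}. nmul (e l) l)"
    proof -
      have "(\<Sum>l\<in>keys g - {k}. nmul (succ k e l) l) = (\<Sum>l\<in>keys g - {k}. nmul (e l) l)"
        by (rule sum.cong) (auto simp: succ_def)
      thus ?thesis unfolding ex_def using sum.remove[OF finite_keys that(1), of "\<lambda>l. nmul (succ k e l) l"]
        by (simp add: succ_def)
    qed
    show ?thesis
    proof (cases "Suc (e k) < N")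
      case True thus ?thesis unfolding 1 2 by (simp add: carry_def nmul_Suc add.assoc)
    next
      case False
      hence "N = Suc (e k)" using eN[OF that] by simp
      thus ?thesis unfolding 1 2 using False by (simp add: carry_def nmul_Suc add.assoc)
    qed
  qed
  have wT_succ: "1 + wT e - wT (succ k e) = (if Suc (e k) < N then 0 else int N)" if "k \<in> keys g" "e \<in> T" for k e
  proof -
    have "(\<Sum>l\<in>keys g - {k}. int (succ k e l)) = (\<Sum>l\<in>keys g - {k}. int (e l))"
      by (rule sum.cong) (auto simp: succ_def)
    hence "wT (succ k e) = int (if Suc (e k) < N then Suc (e k) else 0) + (\<Sum>l\<in>keys g - {k}. int (e l))"
      unfolding wT_def using sum.remove[OF finite_keys that(1), of "\<lambda>l. int (succ k e l)"] by (simp add: succ_def)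
    moreover have "wT e = int (e k) + (\<Sum>l\<in>keys g - {k}. int (e l))"
      unfolding wT_def by (rule sum.remove) (use that in auto)
    ultimately show ?thesis using eN[OF that] by auto
  qed
  define B where "B i j = (\<Sum>k\<in>keys g. if succ k (h i) = h j then Poly_Mapping.single (carry k (h i)) (lookup g k) else 0)" for i j
  define A where "A = mat M M (\<lambda>(i, j). B i j)"
  show ?thesis
  proof (rule integral_closureI_matrix[OF E _ M0, where A = A and d = "\<lambda>i. wT (h i)" and v = "\<lambda>i. xpow (ex (h i))"])
    show "A \<in> carrier_mat M M" by (simp add: A_def)
    show "(xpow (ex (h 0)) :: ('n, 'k) mpoly) \<noteq> 0" by (metis keys_single keys_zero insert_not_empty zero_neq_one)
  next
    fix i j assume ij: "i < M" "j < M"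
    have "(if succ k (h i) = h j then Poly_Mapping.single (carry k (h i)) (lookup g k) else 0) \<in> graded_part E (1 + wT (h i) - wT (h j))"
      if k: "k \<in> keys g" for k
    proof (cases "succ k (h i) = h j")
      case True
      have "1 + wT (h i) - wT (h j) = (if Suc (h i k) < N then 0 else int N)"
        using wT_succ[OF k hT[OF ij(1)]] True by simp
      thus ?thesis using True N[OF k] by (auto simp: graded_part_def carry_def intro: single_mono_span)
    qed simp
    thus "A $$ (i, j) \<in> graded_part E (1 + wT (h i) - wT (h j))"
      using ij unfolding A_def B_def graded_part_def by (auto intro: mono_span_sum)
  next
    fix i assume i: "i < M"
    have sj: "(\<Sum>j<M. (if succ k (h i) = h j then x * xpow (ex (h j)) else 0)) = x * xpow (ex (succ k (h i)))"
      if k: "k \<in> keys g" for k and x :: "('n, 'k) mpoly"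
    proof -
      have "succ k (h i) \<in> h ` {0..<M}" using succT[OF k hT[OF i]] h by (simp add: bij_betw_def)
      then obtain j0 where j0: "j0 < M" "h j0 = succ k (h i)" by auto
      have "succ k (h i) = h j \<longleftrightarrow> j = j0" if "j < M" for j
        using j0 that h by (auto simp: bij_betw_def inj_on_def)
      hence "(\<Sum>j<M. (if succ k (h i) = h j then x * xpow (ex (h j)) else 0)) = (\<Sum>j<M. if j = j0 then x * xpow (ex (h j)) else 0)"
        by (intro sum.cong) auto
      thus ?thesis using j0 by simp
    qed
    have "g * xpow (ex (h i)) = (\<Sum>k\<in>keys g. Poly_Mapping.single k (lookup g k) * xpow (ex (h i)))"
      by (subst poly_mapping_sum_single[of g]) (simp add: sum_distrib_right)
    also have "\<dots> = (\<Sum>k\<in>keys g. Poly_Mapping.single (carry k (h i)) (lookup g k) * xpow (ex (succ k (h i))))"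
      by (rule sum.cong) (simp_all add: mult_single ex_succ[OF _ hT[OF i]])
    also have "\<dots> = (\<Sum>k\<in>keys g. \<Sum>j<M. (if succ k (h i) = h j then Poly_Mapping.single (carry k (h i)) (lookup g k) * xpow (ex (h j)) else 0))"
      by (rule sum.cong) (simp_all add: sj)
    also have "\<dots> = (\<Sum>j<M. A $$ (i, j) * xpow (ex (h j)))"
      by (subst sum.swap) (use i in \<open>auto simp: A_def B_def sum_distrib_right intro!: sum.cong\<close>)
    finally show "g * xpow (ex (h i)) = (\<Sum>j<M. A $$ (i, j) * xpow (ex (h j)))" .
  qed
qed

section \<open>Rational powers of monomial ideals\<close>

lemma sumset_pow_split:
  fixes D :: "('n \<Rightarrow>\<^sub>0 nat) set"
  shows "x \<in> sumset_pow D (m + m') \<Longrightarrow> \<exists>a\<in>sumset_pow D m. \<exists>b\<in>sumset_pow D m'. x = a + b"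
proof (induction m arbitrary: x)
  case 0 thus ?case by (intro bexI[of _ 0] bexI[of _ x]) auto
next
  case (Suc m)
  then obtain a b where x: "x = a + b" "a \<in> D" "b \<in> sumset_pow D (m + m')" by auto
  then obtain c d where "c \<in> sumset_pow D m" "d \<in> sumset_pow D m'" "b = c + d" using Suc.IH by blast
  thus ?case using x by (intro bexI[of _ "a + c"] bexI[of _ d]) (auto simp: add.assoc)
qed

lemma sumset_pow_sumset_pow: "sumset_pow D (m * p) \<subseteq> sumset_pow (sumset_pow D p) m"
proof (induction m)
  case (Suc m)
  show ?case
  proof
    fix x assume "x \<in> sumset_pow D (Suc m * p)"
    then obtain a b where "a \<in> sumset_pow D p" "b \<in> sumset_pow D (m * p)" "x = a + b"
      using sumset_pow_split[of x D p "m * p"] by auto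
    thus "x \<in> sumset_pow (sumset_pow D p) (Suc m)" using Suc by auto
  qed
qed simp

lemma nmul_mem_sumset_pow: "a \<in> D \<Longrightarrow> nmul L a \<in> sumset_pow D L"
  by (induction L) (auto simp: nmul_Suc)

lemma sum_nmul_mem_sumset_pow:
  fixes D :: "('n \<Rightarrow>\<^sub>0 nat) set"
  assumes "up_closed D" "finite A" "A \<subseteq> D"
  shows "(\<Sum>a\<in>A. nmul (L a) a) \<in> sumset_pow D (\<Sum>a\<in>A. L a)"
  using assms(2,3)
proof (induction A rule: finite_induct)
  case (insert a A)
  thus ?case by (simp add: sumset_pow_mult[OF nmul_mem_sumset_pow _ assms(1)])
qed simp

text \<open>
  In the coordinates \<open>(b, u)\<close>, with \<open>None\<close> as the index of \<open>u\<close>, the cone over the Newton polyhedron is generated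
  by the vectors \<open>(a, 1)\<close>, for generators \<open>x\<^sup>a\<close> of the ideal, and the vectors \<open>(e\<^sub>i, 0)\<close>.
\<close>

definition lift_gen :: "('n \<Rightarrow>\<^sub>0 nat) \<Rightarrow> 'n option \<Rightarrow> int" where
  "lift_gen a v = (case v of None \<Rightarrow> 1 | Some i \<Rightarrow> int (lookup a i))"

definition lift_unit :: "'n \<Rightarrow> 'n option \<Rightarrow> int" where
  "lift_unit i v = (if v = Some i then 1 else 0)"

definition lift_pt :: "('n \<Rightarrow>\<^sub>0 nat) \<Rightarrow> 'a \<Rightarrow> 'n option \<Rightarrow> 'a::linordered_field" where
  "lift_pt b u v = (case v of None \<Rightarrow> u | Some i \<Rightarrow> of_nat (lookup b i))"

lemma sum_option: "(\<Sum>v\<in>(UNIV :: 'n::finite option set). f v) = f None + (\<Sum>i\<in>UNIV. f (Some i))"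
  by (simp add: UNIV_option_conv sum.reindex)

lemma ev_lift_pt: "ev \<omega> (lift_pt b u) = of_int (wt (\<lambda>i. \<omega> (Some i)) b) + of_int (\<omega> None) * u"
  by (simp add: ev_def sum_option lift_pt_def wt_def)

lemma lift_inj: "inj_on lift_gen A" "inj_on lift_unit B"
  by (auto simp: inj_on_def lift_gen_def lift_unit_def fun_eq_iff intro!: poly_mapping_eqI split: option.splits)

text \<open>
  A common denominator \<open>N\<close> of the coefficients exhibits \<open>N k\<close> as a sum of at least \<open>N p\<close> exponents of the ideal.
\<close>

lemma in_cone_lift_imp_sumset_pow:
  fixes k :: "'n::finite \<Rightarrow>\<^sub>0 nat"
  assumes D: "up_closed D" and A: "finite A" "A \<subseteq> D"
    and c: "in_cone (lift_gen ` A \<union> range lift_unit) (lift_pt k (of_nat p :: rat))"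
  shows "\<exists>N\<ge>1. nmul N k \<in> sumset_pow (sumset_pow D p) N"
proof -
  let ?G = "lift_gen ` A \<union> range (lift_unit :: 'n \<Rightarrow> _)"
  obtain l where l: "\<forall>g\<in>?G. 0 \<le> l g" "\<And>v. lift_pt k (of_nat p :: rat) v = (\<Sum>g\<in>?G. l g * of_int (g v))"
    using c by (auto simp: in_cone_def)
  have disj: "lift_gen ` A \<inter> range lift_unit = {}"
  proof -
    have "lift_gen a None \<noteq> lift_unit i None" for a and i :: 'n by (simp add: lift_gen_def lift_unit_def)
    hence "lift_gen a \<noteq> lift_unit i" for a and i :: 'n by metis
    thus ?thesis by auto
  qed
  have split: "(\<Sum>g\<in>?G. F g) = (\<Sum>a\<in>A. F (lift_gen a)) + (\<Sum>i\<in>UNIV. F (lift_unit i))" for F :: "('n option \<Rightarrow> int) \<Rightarrow> rat"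
    using A(1) disj by (subst sum.union_disjoint) (auto simp: sum.reindex[OF lift_inj(1)] sum.reindex[OF lift_inj(2)])
  have p: "of_nat p = (\<Sum>a\<in>A. l (lift_gen a))"
    using l(2)[of None] by (simp add: split lift_pt_def lift_gen_def lift_unit_def)
  have k: "of_nat (lookup k i) = (\<Sum>a\<in>A. l (lift_gen a) * of_nat (lookup a i)) + l (lift_unit i)" for i
    using l(2)[of "Some i"] by (simp add: split lift_pt_def lift_gen_def lift_unit_def if_distrib cong: if_cong)
  have "\<exists>N::nat. N \<ge> 1 \<and> (\<forall>g\<in>S. \<exists>m::nat. of_nat N * l g = of_nat m)" if "finite S" "S \<subseteq> ?G" for S
    using that
  proof (induction S rule: finite_induct)
    case (insert g S)
    then obtain N where N: "N \<ge> 1" "\<And>g. g \<in> S \<Longrightarrow> \<exists>m::nat. of_nat N * l g = of_nat m" by auto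
    obtain x y where xy: "quotient_of (l g) = (x, y)" by (cases "quotient_of (l g)")
    have y: "y > 0" by (rule quotient_of_denom_pos[OF xy])
    have lg: "l g = of_int x / of_int y" by (rule quotient_of_div[OF xy])
    have "0 \<le> l g" using l(1) insert.prems by auto
    hence x: "0 \<le> x" using y by (simp add: lg zero_le_divide_iff)
    have e1: "\<exists>m::nat. of_nat (N * nat y) * l g = of_nat m"
      using x y by (intro exI[of _ "N * nat x"]) (simp add: lg)
    have e2: "\<exists>m::nat. of_nat (N * nat y) * l h = of_nat m" if h: "h \<in> S" for h
    proof -
      obtain m :: nat where m: "of_nat N * l h = of_nat m" using N(2)[OF h] by blast
      have "of_nat (N * nat y) * l h = of_nat (nat y) * (of_nat N * l h)" by simp
      also have "\<dots> = of_nat (nat y * m)" unfolding m by simp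
      finally show ?thesis ..
    qed
    have "N * nat y \<ge> 1" using N(1) y by (simp add: Suc_le_eq)
    thus ?case using e1 e2 by (intro exI[of _ "N * nat y"]) auto
  qed (auto intro: exI[of _ 1])
  from this[OF _ subset_refl] obtain N :: nat where N: "N \<ge> 1" "\<forall>g\<in>?G. \<exists>m::nat. of_nat N * l g = of_nat m"
    using A(1) by auto
  from bchoice[OF N(2)] obtain L :: "_ \<Rightarrow> nat" where L: "\<And>g. g \<in> ?G \<Longrightarrow> of_nat N * l g = of_nat (L g)" by blast
  have "of_nat (N * p) = (of_nat (\<Sum>a\<in>A. L (lift_gen a)) :: rat)"
  proof -
    have "of_nat (N * p) = (\<Sum>a\<in>A. of_nat N * l (lift_gen a))" by (simp add: p sum_distrib_left)
    also have "\<dots> = (\<Sum>a\<in>A. of_nat (L (lift_gen a)))" by (rule sum.cong) (auto simp: L)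
    finally show ?thesis by simp
  qed
  hence Np: "(\<Sum>a\<in>A. L (lift_gen a)) = N * p" by (simp only: of_nat_eq_iff)
  have Nk: "N * lookup k i = (\<Sum>a\<in>A. L (lift_gen a) * lookup a i) + L (lift_unit i)" for i
  proof -
    have "of_nat (N * lookup k i) = (\<Sum>a\<in>A. (of_nat N * l (lift_gen a)) * of_nat (lookup a i)) + of_nat N * l (lift_unit i)"
      by (simp add: k sum_distrib_left ring_distribs mult.assoc)
    also have "(\<Sum>a\<in>A. (of_nat N * l (lift_gen a)) * of_nat (lookup a i)) = (\<Sum>a\<in>A. of_nat (L (lift_gen a)) * of_nat (lookup a i))"
      by (rule sum.cong) (auto simp: L)
    also have "of_nat N * l (lift_unit i) = of_nat (L (lift_unit i))" by (rule L) auto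
    finally have "(of_nat (N * lookup k i) :: rat) = of_nat ((\<Sum>a\<in>A. L (lift_gen a) * lookup a i) + L (lift_unit i))" by simp
    thus ?thesis by (simp only: of_nat_eq_iff)
  qed
  define s where "s = (\<Sum>a\<in>A. nmul (L (lift_gen a)) a)"
  have s: "lookup s i = (\<Sum>a\<in>A. L (lift_gen a) * lookup a i)" for i by (simp add: s_def lookup_sum lookup_nmul)
  have "nmul N k = s + (nmul N k - s)"
    by (rule poly_mapping_eqI) (simp add: lookup_add lookup_minus lookup_nmul s Nk)
  moreover have "s \<in> sumset_pow D (N * p)" unfolding s_def Np[symmetric] by (rule sum_nmul_mem_sumset_pow[OF D A])
  ultimately have "nmul N k \<in> sumset_pow D (N * p)"
    using sumset_pow_up_closed[OF D, of "N * p"] unfolding up_closed_def by metis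
  thus ?thesis using N(1) sumset_pow_sumset_pow[of D N p] by blast
qed

text \<open>
  A form \<open>\<omega>\<close> that is nonnegative on the cone over the Newton polyhedron gives a monomial valuation with
  value at least \<open>- \<omega> None\<close> on the ideal, which bounds the rational powers.  Conversely,
  if these bounds hold for \<open>f\<close> at \<open>u = p/q\<close>, they hold for \<open>f\<^sup>q\<close> at \<open>p\<close>, so the exponents
  of \<open>f\<^sup>q\<close> lie in the cone, and some power of each of its monomials lies in the corresponding power of
  \<open>I\<^sup>p\<close>.
\<close>

theorem rational_power_mono_span:
  fixes D :: "('n::{finite,linorder} \<Rightarrow>\<^sub>0 nat) set"
  assumes D: "up_closed D"
  obtains W :: "('n option \<Rightarrow> int) set" where "finite W" "\<And>\<omega> i. \<omega> \<in> W \<Longrightarrow> 0 \<le> \<omega> (Some i)"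
    "\<And>u. 0 < u \<Longrightarrow> rational_power mpoly_ring (mono_span D :: ('n, 'k::field) mpoly set) u
       = mono_span {b. \<forall>\<omega>\<in>W. 0 \<le> ev \<omega> (lift_pt b u)}"
proof -
  obtain A where A: "finite A" "D = {a + c | a c. a \<in> A}" using dickson[OF D] by blast
  have AD: "A \<subseteq> D" 
  proof
    fix a assume "a \<in> A"
    moreover have "a = a + 0" by simp
    ultimately show "a \<in> D" unfolding A(2) by blast
  qed
  let ?G = "lift_gen ` A \<union> range (lift_unit :: 'n \<Rightarrow> _)"
  have finG: "finite ?G" using A(1) by simp
  obtain W where W: "finite W" "\<And>x :: 'n option \<Rightarrow> rat. in_cone ?G x \<longleftrightarrow> (\<forall>\<omega>\<in>W. 0 \<le> ev \<omega> x)"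
    by (rule weyl[OF finG]) (rule that)
  have dotW: "0 \<le> dot \<omega> g" if "\<omega> \<in> W" "g \<in> ?G" for \<omega> g
    using W(2)[of "\<lambda>v. of_int (g v)"] in_coneI[OF finG that(2), where 'b = rat] that(1) by (simp add: ev_of_int)
  have W0: "0 \<le> \<omega> (Some i)" if "\<omega> \<in> W" for \<omega> i
  proof -
    have "dot \<omega> (lift_unit i) = \<omega> (Some i)" by (simp add: dot_def lift_unit_def sum_option if_distrib cong: if_cong)
    thus ?thesis using dotW[OF that, of "lift_unit i"] by simp
  qed
  have WA: "- \<omega> None \<le> wt (\<lambda>i. \<omega> (Some i)) a" if "\<omega> \<in> W" and aD: "a \<in> D" for \<omega> a
  proof -
    obtain a' c where a: "a = a' + c" "a' \<in> A" using aD A(2) by blast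
    have "dot \<omega> (lift_gen a') = \<omega> None + wt (\<lambda>i. \<omega> (Some i)) a'"
      by (simp add: dot_def lift_gen_def sum_option wt_def)
    hence "- \<omega> None \<le> wt (\<lambda>i. \<omega> (Some i)) a'" using dotW[OF \<open>\<omega> \<in> W\<close>, of "lift_gen a'"] a(2) by simp
    also have "\<dots> \<le> wt (\<lambda>i. \<omega> (Some i)) a" using wt_nonneg[of "\<lambda>i. \<omega> (Some i)" c] W0[OF \<open>\<omega> \<in> W\<close>] by (simp add: a(1) wt_add)
    finally show ?thesis .
  qed
  have "rational_power mpoly_ring (mono_span D :: ('n, 'k) mpoly set) u = mono_span {b. \<forall>\<omega>\<in>W. 0 \<le> ev \<omega> (lift_pt b u)}"
    if u: "0 < u" for u :: rat
  proof -
    obtain p' q' where pq': "quotient_of u = (p', q')" by (cases "quotient_of u")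
    have q'0: "q' > 0" by (rule quotient_of_denom_pos[OF pq'])
    have up: "u = of_int p' / of_int q'" by (rule quotient_of_div[OF pq'])
    have p'0: "p' > 0" using u q'0 by (simp add: up zero_less_divide_iff)
    define p where "p = nat p'"
    define q where "q = nat q'"
    have pq: "u * of_nat q = of_nat p" "q > 0" using q'0 p'0 by (simp_all add: up p_def q_def)
    let ?E = "sumset_pow D p"
    have E: "up_closed ?E" by (rule sumset_pow_up_closed[OF D])
    have rp: "rational_power mpoly_ring (mono_span D :: ('n, 'k) mpoly set) u = {f. f ^ q \<in> integral_closure mpoly_ring (mono_span ?E)}"
      by (simp add: rational_power_def pq' p_def q_def ideal_power_mono_span[OF D])
    show ?thesis unfolding rp
    proof (intro equalityI subsetI)
      fix f :: "('n, 'k) mpoly" assume "f \<in> {f. f ^ q \<in> integral_closure mpoly_ring (mono_span ?E)}"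
      hence f: "f ^ q \<in> integral_closure mpoly_ring (mono_span ?E)" by simp
      have "0 \<le> ev \<omega> (lift_pt b u)" if b: "b \<in> keys f" and \<omega>: "\<omega> \<in> W" for b \<omega>
      proof -
        let ?w = "\<lambda>i. \<omega> (Some i)"
        obtain m where m: "initial ?w f m" using ex_initial[of f ?w] b by (metis empty_iff keys_zero)
        have mq: "nmul q m \<in> keys (f ^ q)" using initial_power[OF m, of q] by (simp add: initial_def)
        have "int p * (- \<omega> None) \<le> wt ?w (nmul q m)"
          by (rule integral_closure_wt[OF E _ _ f mq])
             (use W0[OF \<omega>] sumset_pow_wt[of D "- \<omega> None" ?w _ p] WA[OF \<omega>] in auto)
        also have "\<dots> \<le> int q * wt ?w b" unfolding wt_nmul
          by (intro mult_left_mono initial_wt_le[OF m b]) simp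
        finally have "(of_int (int p * (- \<omega> None)) :: rat) \<le> of_int (int q * wt ?w b)" by (simp only: of_int_le_iff)
        hence "0 \<le> of_nat q * of_int (wt ?w b) + of_int (\<omega> None) * (of_nat p :: rat)"
          by (simp add: mult.commute)
        also have "\<dots> = of_nat q * (of_int (wt ?w b) + of_int (\<omega> None) * u)"
          unfolding pq(1)[symmetric] by (simp add: algebra_simps)
        finally show ?thesis using pq(2) by (simp add: ev_lift_pt zero_le_mult_iff)
      qed
      thus "f \<in> mono_span {b. \<forall>\<omega>\<in>W. 0 \<le> ev \<omega> (lift_pt b u)}" by (auto simp: mono_span_def)
    next
      fix f :: "('n, 'k) mpoly" assume f: "f \<in> mono_span {b. \<forall>\<omega>\<in>W. 0 \<le> ev \<omega> (lift_pt b u)}"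
      have "\<exists>N\<ge>1. nmul N k \<in> sumset_pow ?E N" if k: "k \<in> keys (f ^ q)" for k
      proof (rule in_cone_lift_imp_sumset_pow[OF D A(1) AD])
        show "in_cone ?G (lift_pt k (of_nat p :: rat))"
          unfolding W(2)
        proof
          fix \<omega> assume \<omega>: "\<omega> \<in> W"
          have "of_nat q * (- of_int (\<omega> None) * u) \<le> of_int (wt (\<lambda>i. \<omega> (Some i)) k)"
            by (rule keys_power_wt[OF _ k]) (use f \<omega> in \<open>force simp: mono_span_def ev_lift_pt\<close>)
          thus "0 \<le> ev \<omega> (lift_pt k (of_nat p :: rat))"
            unfolding ev_lift_pt pq(1)[symmetric] by (simp add: algebra_simps)
        qed
      qed
      thus "f \<in> {f. f ^ q \<in> integral_closure mpoly_ring (mono_span ?E)}"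
        using integral_closureI_monomials[OF E] by blast
    qed
  qed
  thus ?thesis using that W(1) W0 by blast
qed

section \<open>Contractions from localizations at primes\<close>

lemma primeideal_ring_of_type_algebraD:
  fixes P :: "'a::comm_ring_1 set"
  assumes "primeideal P ring_of_type_algebra"
  shows "1 \<notin> P" "x * y \<in> P \<Longrightarrow> x \<in> P \<or> y \<in> P" "ideal P ring_of_type_algebra"
proof -
  interpret primeideal P "ring_of_type_algebra :: 'a ring" by fact
  show "ideal P ring_of_type_algebra" by (rule is_ideal)
  show "1 \<notin> P" using I_notcarr one_imp_carrier by auto
  show "x * y \<in> P \<Longrightarrow> x \<in> P \<or> y \<in> P" using I_prime[of x y] by simp
qed

lemma prime_power_mem:
  fixes P :: "'a::comm_ring_1 set"
  assumes "primeideal P ring_of_type_algebra" "x ^ m \<in> P"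
  shows "x \<in> P"
  using assms(2) by (induction m) (use primeideal_ring_of_type_algebraD[OF assms(1)] in auto)

lemma prime_prod_mem:
  fixes P :: "'a::comm_ring_1 set"
  assumes "primeideal P ring_of_type_algebra" "finite A" "(\<Prod>i\<in>A. f i) \<in> P"
  shows "\<exists>i\<in>A. f i \<in> P"
  using assms(2,3) by (induction A rule: finite_induct) (use primeideal_ring_of_type_algebraD[OF assms(1)] in auto)

lemma xpow_prime_mem:
  fixes P :: "('n::{finite,linorder}, 'k::field) mpoly set"
  assumes P: "primeideal P mpoly_ring" and "xpow c \<in> P"
  shows "\<exists>i\<in>keys c. mpoly_var i \<in> P"
proof -
  have "c = (\<Sum>i\<in>keys c. Poly_Mapping.single i (lookup c i))" by (rule poly_mapping_eqI) (auto simp: lookup_sum lookup_single when_def in_keys_iff)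
  hence "xpow c = (\<Prod>i\<in>keys c. mpoly_var i ^ lookup c i :: ('n, 'k) mpoly)"
    by (metis (no_types, lifting) finite_keys mpoly_var_power prod.cong prod_xpow)
  then obtain i where "i \<in> keys c" "(mpoly_var i ^ lookup c i :: ('n, 'k) mpoly) \<in> P"
    using prime_prod_mem[OF P finite_keys, of "\<lambda>i. mpoly_var i ^ lookup c i" c] assms(2) by auto
  thus ?thesis using prime_power_mem[OF P] by blast
qed

text \<open>
  In a domain, \<open>f/1 = g/s\<close> means \<open>s f = g\<close>.
\<close>

lemma local_contraction_idom:
  fixes J P :: "'a::idom set"
  assumes P: "primeideal P ring_of_type_algebra"
  shows "local_contraction ring_of_type_algebra J P = {f. \<exists>s. s \<notin> P \<and> s * f \<in> J}"
proof -
  have P0: "0 \<in> P" by (rule ideal_ring_of_type_algebraD(1)[OF primeideal_ring_of_type_algebraD(3)[OF P]])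
  have fr: "fraction (ring_of_type_algebra :: 'a ring) (self_module ring_of_type_algebra) (UNIV - P) m s
     = {(m', s'). s' \<notin> P \<and> s' * m = s * m'}" for m s
    using P0 primeideal_ring_of_type_algebraD(1)[OF P] unfolding fraction_def by auto
  have "(\<exists>g\<in>J. \<exists>s\<in>UNIV - P. {(m', s'). s' \<notin> P \<and> s' * f = 1 * m'} = {(m', s'). s' \<notin> P \<and> s' * g = s * m'}) \<longleftrightarrow>
      (\<exists>s. s \<notin> P \<and> s * f \<in> J)" for f
  proof
    assume "\<exists>g\<in>J. \<exists>s\<in>UNIV - P. {(m', s'). s' \<notin> P \<and> s' * f = 1 * m'} = {(m', s'). s' \<notin> P \<and> s' * g = s * m'}"
    then obtain g s where gs: "g \<in> J" "s \<notin> P" "{(m', s'). s' \<notin> P \<and> s' * f = 1 * m'} = {(m', s'). s' \<notin> P \<and> s' * g = s * m'}"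
      by blast
    have "(f, 1) \<in> {(m', s'). s' \<notin> P \<and> s' * f = 1 * m'}" using primeideal_ring_of_type_algebraD(1)[OF P] by simp
    hence "g = s * f" unfolding gs(3) by simp
    thus "\<exists>s. s \<notin> P \<and> s * f \<in> J" using gs by blast
  next
    assume "\<exists>s. s \<notin> P \<and> s * f \<in> J"
    then obtain s where s: "s \<notin> P" "s * f \<in> J" by blast
    have "s \<noteq> 0" using s(1) P0 by blast
    hence "s' * f = 1 * m' \<longleftrightarrow> s' * (s * f) = s * m'" for s' m'
      by (metis mult.left_commute mult_1 mult_cancel_left)
    thus "\<exists>g\<in>J. \<exists>s\<in>UNIV - P. {(m', s'). s' \<notin> P \<and> s' * f = 1 * m'} = {(m', s'). s' \<notin> P \<and> s' * g = s * m'}"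
      using s by (intro bexI[of _ "s * f"] bexI[of _ s]) auto
  qed
  thus ?thesis unfolding local_contraction_def by (simp add: fr)
qed

text \<open>
  The exponents that are carried into \<open>E\<close> by a monomial in the variables outside \<open>F\<close>.
\<close>

definition saturate :: "'n set \<Rightarrow> ('n \<Rightarrow>\<^sub>0 nat) set \<Rightarrow> ('n \<Rightarrow>\<^sub>0 nat) set" where
  "saturate F E = {b. \<exists>c. keys c \<inter> F = {} \<and> b + c \<in> E}"

lemma saturate_up_closed: "up_closed E \<Longrightarrow> up_closed (saturate F E)"
  unfolding up_closed_def
proof (intro ballI allI)
  fix b d assume E: "\<forall>b\<in>E. \<forall>c. b + c \<in> E" and "b \<in> saturate F E"
  then obtain c where c: "keys c \<inter> F = {}" "b + c \<in> E" by (auto simp: saturate_def)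
  have "(b + c) + d \<in> E" using E c by blast
  thus "b + d \<in> saturate F E" using c unfolding saturate_def by (auto simp: add_ac)
qed

lemma keys_add_nat: "keys (a + b) = keys a \<union> keys (b :: 'n \<Rightarrow>\<^sub>0 nat)"
  by (auto simp: in_keys_iff lookup_add)

text \<open>
  A monomial in variables outside \<open>P\<close> is not in \<open>P\<close>, which gives one inclusion.
  For the other, let \<open>s f \<in> J\<close> with \<open>s \<notin> P\<close>, and let \<open>w\<close> be the degree in the variables of \<open>P\<close>.
  Then \<open>s\<close> has a monomial of weight \<open>0\<close>.  If \<open>f\<^sub>2\<close> is the part of \<open>f\<close> outside the saturation, then the
  initial exponent of \<open>s f\<^sub>2\<close> lies in the saturation and differs from that of \<open>f\<^sub>2\<close> by a
  monomial in variables outside \<open>P\<close>, which is absurd.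
\<close>

lemma local_contraction_mono_span:
  fixes P :: "('n::{finite,linorder}, 'k::field) mpoly set"
  assumes E: "up_closed E" and P: "primeideal P mpoly_ring"
  shows "local_contraction mpoly_ring (mono_span E) P = mono_span (saturate {i. mpoly_var i \<in> P} E)"
proof -
  define F where "F = {i. (mpoly_var i :: ('n, 'k) mpoly) \<in> P}"
  let ?E = "saturate F E"
  have E': "up_closed ?E" by (rule saturate_up_closed[OF E])
  have PI: "ideal P mpoly_ring" by (rule primeideal_ring_of_type_algebraD(3)[OF P])
  have "(\<exists>s. s \<notin> P \<and> s * f \<in> mono_span E) \<longleftrightarrow> f \<in> mono_span ?E" for f
  proof
    assume "\<exists>s. s \<notin> P \<and> s * f \<in> mono_span E"
    then obtain s where s: "s \<notin> P" "s * f \<in> mono_span E" by blast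
    define w :: "'n \<Rightarrow> int" where "w = (\<lambda>i. if i \<in> F then 1 else 0)"
    have wt0: "wt w b = 0 \<longleftrightarrow> keys b \<inter> F = {}" for b
    proof -
      have "wt w b = (\<Sum>i\<in>F. int (lookup b i))" unfolding wt_def w_def
        by (simp add: if_distrib[of "\<lambda>z. z * _"] sum.If_cases cong: if_cong)
      hence "wt w b = 0 \<longleftrightarrow> (\<forall>i\<in>F. lookup b i = 0)" by (simp add: sum_nonneg_eq_0_iff)
      thus ?thesis by (auto simp: in_keys_iff)
    qed
    have "\<exists>k\<in>keys s. wt w k = 0"
    proof (rule ccontr)
      assume *: "\<not> (\<exists>k\<in>keys s. wt w k = 0)"
      have "Poly_Mapping.single k (lookup s k) \<in> P" if k: "k \<in> keys s" for k
      proof -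
        obtain i where i: "i \<in> keys k" "i \<in> F" using * k wt0 by blast
        have "k = Poly_Mapping.single i 1 + (k - Poly_Mapping.single i 1)"
          using i(1) by (intro poly_mapping_eqI) (auto simp: lookup_add lookup_minus lookup_single when_def in_keys_iff)
        hence "Poly_Mapping.single k (lookup s k) = Poly_Mapping.single (k - Poly_Mapping.single i 1) (lookup s k) * mpoly_var i"
          by (simp add: mpoly_var_def mult_single add.commute)
        thus ?thesis using i(2) ideal_ring_of_type_algebraD(3)[OF PI] by (simp add: F_def)
      qed
      hence "(\<Sum>k\<in>keys s. Poly_Mapping.single k (lookup s k)) \<in> P" by (rule ideal_ring_of_type_algebraD(4)[OF PI])
      thus False using s(1) by (simp add: poly_mapping_sum_single[symmetric])
    qed
    then obtain k where k: "k \<in> keys s" "wt w k = 0" by blast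
    hence "s \<noteq> 0" by auto
    then obtain ms where ms: "initial w s ms" by (rule ex_initial)
    have "wt w ms = 0" using initial_wt_le[OF ms k(1)] k(2) wt_nonneg[of w ms] by (simp add: w_def)
    hence ms0: "keys ms \<inter> F = {}" using wt0 by simp
    define f2 where "f2 = (\<Sum>b\<in>keys f - ?E. Poly_Mapping.single b (lookup f b))"
    have f2: "lookup f2 b = (if b \<in> ?E then 0 else lookup f b)" for b
      unfolding f2_def by (auto simp: lookup_sum lookup_single when_def in_keys_iff)
    have "f2 = 0"
    proof (rule ccontr)
      assume "f2 \<noteq> 0"
      then obtain m2 where m2: "initial w f2 m2" by (rule ex_initial)
      have "f - f2 \<in> mono_span ?E" by (auto simp: mono_span_def in_keys_iff lookup_minus f2 split: if_splits)
      hence "s * (f - f2) \<in> mono_span ?E" by (rule mono_span_times[OF E'])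
      moreover have "E \<subseteq> ?E" unfolding saturate_def by (auto intro!: exI[of _ 0])
      hence "s * f \<in> mono_span ?E" using s(2) by (auto simp: mono_span_def)
      ultimately have "s * f - s * (f - f2) \<in> mono_span ?E" by (intro mono_span_diff)
      hence "s * f2 \<in> mono_span ?E" by (simp add: algebra_simps)
      moreover have "ms + m2 \<in> keys (s * f2)" using initial_mult[OF ms m2] by (simp add: initial_def)
      ultimately have "ms + m2 \<in> ?E" by (auto simp: mono_span_def)
      then obtain c where c: "keys c \<inter> F = {}" "(ms + m2) + c \<in> E" by (auto simp: saturate_def)
      have "m2 + (ms + c) \<in> E" using c(2) by (simp add: add_ac)
      moreover have "keys (ms + c) \<inter> F = {}" using c(1) ms0 by (auto simp: keys_add_nat)
      ultimately have "m2 \<in> ?E" unfolding saturate_def by blast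
      moreover have "m2 \<in> keys f2" using m2 by (simp add: initial_def)
      ultimately show False using f2[of m2] by (simp add: in_keys_iff)
    qed
    hence "b \<in> ?E" if "b \<in> keys f" for b using f2[of b] that by (auto simp: in_keys_iff split: if_splits)
    thus "f \<in> mono_span ?E" by (auto simp: mono_span_def)
  next
    assume f: "f \<in> mono_span ?E"
    hence "\<forall>b\<in>keys f. \<exists>c. keys c \<inter> F = {} \<and> b + c \<in> E" unfolding mono_span_def saturate_def by blast
    from bchoice[OF this] obtain c where c: "\<And>b. b \<in> keys f \<Longrightarrow> keys (c b) \<inter> F = {} \<and> b + c b \<in> E" by blast
    define C where "C = (\<Sum>b\<in>keys f. c b)"
    have "keys C \<inter> F = {}" using keys_sum[of c "keys f"] c unfolding C_def by blast
    hence "(xpow C :: ('n, 'k) mpoly) \<notin> P" using xpow_prime_mem[OF P, of C] by (auto simp: F_def)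
    moreover have "xpow C * f \<in> mono_span E"
    proof -
      have "C + b \<in> E" if "b \<in> keys f" for b
      proof -
        have "C + b = (b + c b) + (\<Sum>b\<in>keys f - {b}. c b)"
          unfolding C_def using that by (simp add: sum.remove[of _ b] algebra_simps)
        thus ?thesis using c[OF that] E by (auto simp: up_closed_def)
      qed
      thus ?thesis using keys_single_times[of C 1 f] by (auto simp: mono_span_def)
    qed
    ultimately show "\<exists>s. s \<notin> P \<and> s * f \<in> mono_span E" by blast
  qed
  thus ?thesis unfolding local_contraction_idom[OF P] F_def by blast
qed

section \<open>Rational symbolic powers\<close>

definition zlift :: "('n \<Rightarrow> int) \<Rightarrow> 'a \<Rightarrow> 'n option \<Rightarrow> 'a::linordered_field" where
  "zlift a u v = (case v of None \<Rightarrow> u | Some i \<Rightarrow> of_int (a i))"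

lemma zlift_expo: "zlift (expo b) u = lift_pt b u"
  by (auto simp: zlift_def lift_pt_def expo_def fun_eq_iff split: option.splits)

lemma ev_zlift: "ev \<omega> (zlift a u) = of_int (\<Sum>i\<in>UNIV. \<omega> (Some i) * a i) + of_int (\<omega> None) * u"
  by (simp add: ev_def sum_option zlift_def)

lemma ev_zlift_add: "ev \<omega> (zlift (a + c) u) = ev \<omega> (zlift a u) + of_int (\<Sum>i\<in>UNIV. \<omega> (Some i) * c i)"
  by (simp add: ev_zlift ring_distribs sum.distrib)

text \<open>
  Moving far enough in the directions of \<open>S\<close> makes all the forms nonnegative that do not vanish on \<open>S\<close>.
\<close>

lemma ex_shift:
  fixes W :: "('n::finite option \<Rightarrow> int) set" and u :: rat
  assumes W: "finite W" and W0: "\<forall>\<omega>\<in>W. \<forall>i. 0 \<le> \<omega> (Some i)"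
  obtains N :: nat where "\<And>i. 0 \<le> a i + int N"
    "\<And>\<omega>. \<omega> \<in> W \<Longrightarrow> \<exists>i\<in>S. \<omega> (Some i) \<noteq> 0 \<Longrightarrow> 0 \<le> ev \<omega> (zlift (a + (\<lambda>i. if i \<in> S then int N else 0)) u)"
proof -
  define z where "z \<omega> = \<lceil>\<bar>ev \<omega> (zlift a u)\<bar>\<rceil>" for \<omega>
  have z0: "0 \<le> z \<omega>" for \<omega> unfolding z_def by simp
  define N where "N = nat ((\<Sum>i\<in>UNIV. \<bar>a i\<bar>) + (\<Sum>\<omega>\<in>W. z \<omega>))"
  have NZ: "int N = (\<Sum>i\<in>UNIV. \<bar>a i\<bar>) + (\<Sum>\<omega>\<in>W. z \<omega>)" unfolding N_def using z0 by (simp add: sum_nonneg)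
  show ?thesis
  proof (rule that[of N])
    fix i
    have "\<bar>a i\<bar> \<le> (\<Sum>i\<in>UNIV. \<bar>a i\<bar>)" by (rule member_le_sum) auto
    moreover have "0 \<le> (\<Sum>\<omega>\<in>W. z \<omega>)" using z0 by (simp add: sum_nonneg)
    ultimately show "0 \<le> a i + int N" unfolding NZ by linarith
  next
    fix \<omega> assume \<omega>: "\<omega> \<in> W" "\<exists>i\<in>S. \<omega> (Some i) \<noteq> 0"
    then obtain i where i: "i \<in> S" "1 \<le> \<omega> (Some i)" using W0 by (metis int_one_le_iff_zero_less less_le)
    have "z \<omega> \<le> (\<Sum>\<omega>\<in>W. z \<omega>)" using z0 \<omega>(1) W by (intro member_le_sum) auto
    moreover have "0 \<le> (\<Sum>i\<in>UNIV. \<bar>a i\<bar>)" by (simp add: sum_nonneg)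
    ultimately have zN: "z \<omega> \<le> int N" unfolding NZ by linarith
    have "int N \<le> \<omega> (Some i) * (if i \<in> S then int N else 0)" using i mult_right_mono[of 1 "\<omega> (Some i)" "int N"] by simp
    also have "\<dots> \<le> (\<Sum>i\<in>UNIV. \<omega> (Some i) * (if i \<in> S then int N else 0))"
      by (rule member_le_sum) (use W0 \<omega>(1) in auto)
    finally have "z \<omega> \<le> (\<Sum>i\<in>UNIV. \<omega> (Some i) * (if i \<in> S then int N else 0))" using zN by linarith
    hence "(of_int (z \<omega>) :: rat) \<le> of_int (\<Sum>i\<in>UNIV. \<omega> (Some i) * (if i \<in> S then int N else 0))" by (simp only: of_int_le_iff)
    moreover have "\<bar>ev \<omega> (zlift a u)\<bar> \<le> of_int (z \<omega>)" unfolding z_def by (rule le_of_int_ceiling)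
    ultimately show "0 \<le> ev \<omega> (zlift (a + (\<lambda>i. if i \<in> S then int N else 0)) u)" unfolding ev_zlift_add by linarith
  qed
qed

lemma ev_zlift_shift_unchanged:
  assumes "\<And>i. i \<in> S \<Longrightarrow> \<omega> (Some i) = 0" "\<And>i. i \<notin> S \<Longrightarrow> c i = 0"
  shows "ev \<omega> (zlift (a + c) u) = ev \<omega> (zlift a u)"
proof -
  have "\<omega> (Some i) * c i = 0" for i using assms by (cases "i \<in> S") auto
  hence "(\<Sum>i\<in>UNIV. \<omega> (Some i) * c i) = 0" by (intro sum.neutral) blast
  thus ?thesis by (simp only: ev_zlift_add) simp
qed

text \<open>
  Multiplication by variables outside \<open>F\<close> changes only the forms that involve them, and makes these forms
  nonnegative eventually.
\<close>

lemma saturate_halfspaces: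
  fixes W :: "('n::finite option \<Rightarrow> int) set" and u :: rat
  assumes W: "finite W" and W0: "\<forall>\<omega>\<in>W. \<forall>i. 0 \<le> \<omega> (Some i)"
  shows "saturate F {b. \<forall>\<omega>\<in>W. 0 \<le> ev \<omega> (lift_pt b u)} =
    {b. \<forall>\<omega>\<in>W. (\<forall>i. i \<notin> F \<longrightarrow> \<omega> (Some i) = 0) \<longrightarrow> 0 \<le> ev \<omega> (lift_pt b u)}"
proof (intro Set.set_eqI iffI)
  fix b assume "b \<in> saturate F {b. \<forall>\<omega>\<in>W. 0 \<le> ev \<omega> (lift_pt b u)}"
  then obtain c where c: "keys c \<inter> F = {}" "\<And>\<omega>. \<omega> \<in> W \<Longrightarrow> 0 \<le> ev \<omega> (lift_pt (b + c) u)"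
    by (auto simp: saturate_def)
  have "0 \<le> ev \<omega> (lift_pt b u)" if \<omega>: "\<omega> \<in> W" "\<forall>i. i \<notin> F \<longrightarrow> \<omega> (Some i) = 0" for \<omega>
  proof -
    have "ev \<omega> (zlift (expo b + expo c) u) = ev \<omega> (zlift (expo b) u)"
      by (rule ev_zlift_shift_unchanged[of "- F"]) (use \<omega>(2) c(1) in \<open>auto simp: expo_def in_keys_iff\<close>)
    thus ?thesis using c(2)[OF \<omega>(1)] by (simp add: expo_add[symmetric] zlift_expo)
  qed
  thus "b \<in> {b. \<forall>\<omega>\<in>W. (\<forall>i. i \<notin> F \<longrightarrow> \<omega> (Some i) = 0) \<longrightarrow> 0 \<le> ev \<omega> (lift_pt b u)}" by blast
next
  fix b assume b: "b \<in> {b. \<forall>\<omega>\<in>W. (\<forall>i. i \<notin> F \<longrightarrow> \<omega> (Some i) = 0) \<longrightarrow> 0 \<le> ev \<omega> (lift_pt b u)}"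
  obtain N :: nat where N: "\<And>\<omega>. \<omega> \<in> W \<Longrightarrow> \<exists>i\<in>- F. \<omega> (Some i) \<noteq> 0 \<Longrightarrow> 0 \<le> ev \<omega> (zlift (expo b + (\<lambda>i. if i \<in> - F then int N else 0)) u)"
    by (rule ex_shift[OF W W0, of "expo b" "- F" u]) (rule that)
  define c :: "'n \<Rightarrow>\<^sub>0 nat" where "c = Abs_poly_mapping (\<lambda>i. if i \<in> - F then N else 0)"
  have c: "lookup c i = (if i \<in> - F then N else 0)" for i by (simp add: c_def)
  have ec: "expo c = (\<lambda>i. if i \<in> - F then int N else 0)" by (auto simp: expo_def c)
  have "0 \<le> ev \<omega> (lift_pt (b + c) u)" if \<omega>: "\<omega> \<in> W" for \<omega>
  proof (cases "\<exists>i\<in>- F. \<omega> (Some i) \<noteq> 0")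
    case True
    thus ?thesis using N[OF \<omega>] by (simp only: zlift_expo[symmetric] expo_add ec)
  next
    case False
    have "ev \<omega> (zlift (expo b + expo c) u) = ev \<omega> (zlift (expo b) u)"
      by (rule ev_zlift_shift_unchanged[of "- F"]) (use False in \<open>auto simp: ec\<close>)
    moreover have "0 \<le> ev \<omega> (lift_pt b u)" using b \<omega> False by auto
    ultimately show ?thesis by (simp add: expo_add[symmetric] zlift_expo)
  qed
  moreover have "keys c \<inter> F = {}" by (auto simp: in_keys_iff c)
  ultimately show "b \<in> saturate F {b. \<forall>\<omega>\<in>W. 0 \<le> ev \<omega> (lift_pt b u)}" unfolding saturate_def by blast
qed

lemma surviving_halfspaces:
  fixes W :: "('n::finite option \<Rightarrow> int) set" and u :: rat
  assumes W: "finite W" and W0: "\<forall>\<omega>\<in>W. \<forall>i. 0 \<le> \<omega> (Some i)"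
    and D: "D = {b. \<forall>F\<in>\<F>. \<forall>\<omega>\<in>W. (\<forall>i. i \<notin> F \<longrightarrow> \<omega> (Some i) = 0) \<longrightarrow> 0 \<le> ev \<omega> (lift_pt b u)}"
  shows "S \<in> surviving D a \<longleftrightarrow> {i. a i < 0} \<subseteq> S \<and>
    (\<exists>F\<in>\<F>. \<exists>\<omega>\<in>W. (\<forall>i. i \<notin> F \<or> i \<in> S \<longrightarrow> \<omega> (Some i) = 0) \<and> ev \<omega> (zlift a u) < 0)"
proof -
  have eq1: "(\<exists>b\<in>D. \<exists>c. keys c \<subseteq> S \<and> expo b = a + expo c) \<longleftrightarrow>
     (\<forall>F\<in>\<F>. \<forall>\<omega>\<in>W. (\<forall>i. i \<notin> F \<or> i \<in> S \<longrightarrow> \<omega> (Some i) = 0) \<longrightarrow> 0 \<le> ev \<omega> (zlift a u))" (is "?L \<longleftrightarrow> ?R")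
    if neg: "{i. a i < 0} \<subseteq> S"
  proof
    assume ?L
    then obtain b c where b: "b \<in> D" "keys c \<subseteq> S" "expo b = a + expo c" by blast
    show ?R
    proof (intro ballI impI)
      fix F \<omega> assume F: "F \<in> \<F>" "\<omega> \<in> W" "\<forall>i. i \<notin> F \<or> i \<in> S \<longrightarrow> \<omega> (Some i) = 0"
      have "ev \<omega> (zlift (a + expo c) u) = ev \<omega> (zlift a u)"
        by (rule ev_zlift_shift_unchanged[of S]) (use F(3) b(2) in \<open>auto simp: keys_expo\<close>)
      moreover have "0 \<le> ev \<omega> (lift_pt b u)" using b(1) F unfolding D by auto
      ultimately show "0 \<le> ev \<omega> (zlift a u)" by (simp add: zlift_expo[symmetric] b(3))
    qed
  next
    assume R: ?R
    obtain N :: nat where N: "\<And>i. 0 \<le> a i + int N" "\<And>\<omega>. \<omega> \<in> W \<Longrightarrow> \<exists>i\<in>S. \<omega> (Some i) \<noteq> 0 \<Longrightarrow> 0 \<le> ev \<omega> (zlift (a + (\<lambda>i. if i \<in> S then int N else 0)) u)"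
      by (rule ex_shift[OF W W0, of a S u]) (rule that)
    define c :: "'n \<Rightarrow>\<^sub>0 nat" where "c = Abs_poly_mapping (\<lambda>i. if i \<in> S then N else 0)"
    have c: "lookup c i = (if i \<in> S then N else 0)" for i by (simp add: c_def)
    have ec: "expo c = (\<lambda>i. if i \<in> S then int N else 0)" by (auto simp: expo_def c)
    have "0 \<le> (a + expo c) i" for i
      using N(1)[of i] neg by (cases "i \<in> S") (auto simp: ec not_less[symmetric])
    then obtain b where b: "expo b = a + expo c" using ex_expo by metis
    have "b \<in> D" unfolding D
    proof (intro CollectI ballI impI)
      fix F \<omega> assume F: "F \<in> \<F>" "\<omega> \<in> W" "\<forall>i. i \<notin> F \<longrightarrow> \<omega> (Some i) = 0"
      show "0 \<le> ev \<omega> (lift_pt b u)"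
      proof (cases "\<exists>i\<in>S. \<omega> (Some i) \<noteq> 0")
        case True
        thus ?thesis using N(2)[OF F(2)] by (simp only: zlift_expo[symmetric] b ec)
      next
        case False
        have "ev \<omega> (zlift (a + expo c) u) = ev \<omega> (zlift a u)"
          by (rule ev_zlift_shift_unchanged[of S]) (use False in \<open>auto simp: ec\<close>)
        moreover have "0 \<le> ev \<omega> (zlift a u)" using R F False by blast
        ultimately show ?thesis by (simp only: zlift_expo[symmetric] b)
      qed
    qed
    moreover have "keys c \<subseteq> S" by (auto simp: in_keys_iff c split: if_splits)
    ultimately show ?L using b by blast
  qed
  have eq2: "S \<in> surviving D a \<longleftrightarrow> {i. a i < 0} \<subseteq> S \<and> \<not> (\<exists>b\<in>D. \<exists>c. keys c \<subseteq> S \<and> expo b = a + expo c)"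
    unfolding surviving_def by blast
  show ?thesis
  proof (cases "{i. a i < 0} \<subseteq> S")
    case True
    show ?thesis unfolding eq2 eq1[OF True] by (simp add: not_le)
  qed (simp add: eq2)
qed

text \<open>
  The unit forms are included in \<open>L\<close>, because they decide which exponents of \<open>a\<close> are negative.
\<close>

theorem rational_symbolic_power_surviving:
  fixes I :: "('n::{finite,linorder}, 'k::field) mpoly set"
  assumes I: "monomial_ideal I"
  obtains L :: "('n option \<Rightarrow> int) set" and \<Psi> where "finite L"
    "\<And>u. 0 < u \<Longrightarrow> \<exists>D. up_closed D \<and> rational_symbolic_power mpoly_ring I u = mono_span D \<and>
       (\<forall>a. surviving D a = \<Psi> {\<omega> \<in> L. 0 \<le> ev \<omega> (zlift a u)})"
proof -
  obtain D0 where D0: "up_closed D0" "I = mono_span D0" using monomial_idealE[OF I] by blast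
  obtain W where W: "finite W" "\<And>\<omega> i. \<omega> \<in> W \<Longrightarrow> 0 \<le> \<omega> (Some i)"
    "\<And>u. 0 < u \<Longrightarrow> rational_power mpoly_ring (mono_span D0 :: ('n, 'k) mpoly set) u
       = mono_span {b. \<forall>\<omega>\<in>W. 0 \<le> ev \<omega> (lift_pt b u)}"
    by (rule rational_power_mono_span[OF D0(1), where 'k = 'k]) (rule that)
  have W0: "\<forall>\<omega>\<in>W. \<forall>i. 0 \<le> \<omega> (Some i)" using W(2) by blast
  define Ass where "Ass = assoc_primes mpoly_ring (quotient_module (self_module mpoly_ring) I)"
  define \<F> where "\<F> = (\<lambda>P. {i. (mpoly_var i :: ('n, 'k) mpoly) \<in> P}) ` Ass"
  define L where "L = W \<union> range lift_unit"
  define \<Psi> where "\<Psi> T = {S. (\<forall>i. lift_unit i \<notin> T \<longrightarrow> i \<in> S) \<and>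
     (\<exists>F\<in>\<F>. \<exists>\<omega>\<in>W. (\<forall>i. i \<notin> F \<or> i \<in> S \<longrightarrow> \<omega> (Some i) = 0) \<and> \<omega> \<notin> T)}" for T :: "('n option \<Rightarrow> int) set"
  have "\<exists>D. up_closed D \<and> rational_symbolic_power mpoly_ring I u = mono_span D \<and>
       (\<forall>a. surviving D a = \<Psi> {\<omega> \<in> L. 0 \<le> ev \<omega> (zlift a u)})" if u: "0 < u" for u :: rat
  proof -
    let ?E = "{b. \<forall>\<omega>\<in>W. 0 \<le> ev \<omega> (lift_pt b u)}"
    define D where "D = {b. \<forall>F\<in>\<F>. \<forall>\<omega>\<in>W. (\<forall>i. i \<notin> F \<longrightarrow> \<omega> (Some i) = 0) \<longrightarrow> 0 \<le> ev \<omega> (lift_pt b u)}"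
    have E: "up_closed ?E" unfolding up_closed_def
    proof (intro ballI allI CollectI)
      fix b c \<omega> assume "b \<in> ?E" "\<omega> \<in> W"
      moreover have "0 \<le> wt (\<lambda>i. \<omega> (Some i)) c" using W(2)[OF \<open>\<omega> \<in> W\<close>] by (rule wt_nonneg)
      ultimately show "0 \<le> ev \<omega> (lift_pt (b + c) u)" by (force simp: ev_lift_pt wt_add)
    qed
    have D: "D = (\<Inter>F\<in>\<F>. saturate F ?E)" unfolding D_def saturate_halfspaces[OF W(1) W0] by auto
    have "up_closed D" using saturate_up_closed[OF E] unfolding D up_closed_def by blast
    moreover have "rational_symbolic_power mpoly_ring I u = mono_span D"
    proof -
      have "local_contraction mpoly_ring (rational_power mpoly_ring I u) P = mono_span (saturate {i. mpoly_var i \<in> P} ?E)"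
        if "P \<in> Ass" for P
      proof -
        have "primeideal P mpoly_ring" using that by (simp add: Ass_def assoc_primes_def)
        thus ?thesis unfolding D0(2) W(3)[OF u] by (rule local_contraction_mono_span[OF E])
      qed
      hence "rational_symbolic_power mpoly_ring I u = (\<Inter>F\<in>\<F>. mono_span (saturate F ?E))"
        unfolding rational_symbolic_power_def Ass_def[symmetric] \<F>_def by auto
      also have "\<dots> = mono_span D" unfolding D mono_span_def by auto
      finally show ?thesis .
    qed
    moreover have "surviving D a = \<Psi> {\<omega> \<in> L. 0 \<le> ev \<omega> (zlift a u)}" for a
    proof -
      have unit: "ev (lift_unit i) (zlift a u) = of_int (a i)" for i
        by (simp add: ev_zlift lift_unit_def if_distrib[of "\<lambda>z. z * _"] cong: if_cong)
      have "S \<in> surviving D a \<longleftrightarrow> S \<in> \<Psi> {\<omega> \<in> L. 0 \<le> ev \<omega> (zlift a u)}" for S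
        unfolding surviving_halfspaces[OF W(1) W0 D_def]
        unfolding \<Psi>_def by (auto simp: L_def unit not_le)
      thus ?thesis by blast
    qed
    ultimately show ?thesis by blast
  qed
  moreover have "finite L" using W(1) by (simp add: L_def)
  ultimately show ?thesis using that by blast
qed

section \<open>Integrals of rational piecewise polynomial functions\<close>

definition rat_affine :: "(('n::finite \<Rightarrow> real) \<Rightarrow> real) \<Rightarrow> bool" where
  "rat_affine a \<longleftrightarrow> (\<exists>r s. (\<forall>j. r j \<in> \<rat>) \<and> s \<in> \<rat> \<and> a = (\<lambda>x. s + (\<Sum>j\<in>UNIV. r j * x j)))"

text \<open>
  Rational piecewise polynomial functions: the pieces are cut out by rational half-spaces.
\<close>

inductive rat_pp :: "(('n::finite \<Rightarrow> real) \<Rightarrow> real) \<Rightarrow> bool" where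
  rat_const: "c \<in> \<rat> \<Longrightarrow> rat_pp (\<lambda>x. c)"
| rat_coord: "rat_pp (\<lambda>x. x i)"
| rat_add: "rat_pp f \<Longrightarrow> rat_pp g \<Longrightarrow> rat_pp (\<lambda>x. f x + g x)"
| rat_mult: "rat_pp f \<Longrightarrow> rat_pp g \<Longrightarrow> rat_pp (\<lambda>x. f x * g x)"
| rat_ind: "rat_affine a \<Longrightarrow> rat_pp (\<lambda>x. if 0 \<le> a x then 1 else 0)"

definition indep :: "'n \<Rightarrow> (('n \<Rightarrow> real) \<Rightarrow> real) \<Rightarrow> bool" where
  "indep i f \<longleftrightarrow> (\<forall>x y. f (x(i := y)) = f x)"

lemma rat_pp_sum: "finite A \<Longrightarrow> (\<And>j. j \<in> A \<Longrightarrow> rat_pp (f j)) \<Longrightarrow> rat_pp (\<lambda>x. \<Sum>j\<in>A. f j x)"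
  by (induction A rule: finite_induct) (auto intro: rat_pp.intros)

lemma rat_pp_prod: "finite A \<Longrightarrow> (\<And>j. j \<in> A \<Longrightarrow> rat_pp (f j)) \<Longrightarrow> rat_pp (\<lambda>x. \<Prod>j\<in>A. f j x)"
  by (induction A rule: finite_induct) (auto intro: rat_pp.intros)

lemma rat_pp_power: "rat_pp f \<Longrightarrow> rat_pp (\<lambda>x. f x ^ m)"
  by (induction m) (auto intro: rat_pp.intros)

lemma rat_pp_diff: "rat_pp f \<Longrightarrow> rat_pp g \<Longrightarrow> rat_pp (\<lambda>x. f x - g x)"
  using rat_add[of f "\<lambda>x. - 1 * g x"] rat_mult[OF rat_const[of "- 1"], of g] by simp

lemma rat_affineI: "(\<And>j. r j \<in> \<rat>) \<Longrightarrow> s \<in> \<rat> \<Longrightarrow> rat_affine (\<lambda>x. s + (\<Sum>j\<in>UNIV. r j * x j))"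
  unfolding rat_affine_def by blast

lemma rat_affine_const: "c \<in> \<rat> \<Longrightarrow> rat_affine (\<lambda>x. c)"
  using rat_affineI[of "\<lambda>_. 0" c] by simp

lemma rat_affine_linear:
  assumes "rat_affine a" "rat_affine b" "p \<in> \<rat>" "q \<in> \<rat>"
  shows "rat_affine (\<lambda>x. p * a x + q * b x)"
proof -
  obtain r s r' s' where "\<forall>j. r j \<in> \<rat>" "s \<in> \<rat>" "a = (\<lambda>x. s + (\<Sum>j\<in>UNIV. r j * x j))"
    "\<forall>j. r' j \<in> \<rat>" "s' \<in> \<rat>" "b = (\<lambda>x. s' + (\<Sum>j\<in>UNIV. r' j * x j))"
    using assms(1,2) unfolding rat_affine_def by blast
  moreover from this have "(\<lambda>x. p * a x + q * b x) = (\<lambda>x. (p * s + q * s') + (\<Sum>j\<in>UNIV. (p * r j + q * r' j) * x j))"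
    by (auto simp: fun_eq_iff ring_distribs sum.distrib sum_distrib_left mult.assoc)
  ultimately show ?thesis using assms(3,4) by (auto intro!: rat_affineI)
qed

lemma rat_affine_diff: "rat_affine a \<Longrightarrow> rat_affine b \<Longrightarrow> rat_affine (\<lambda>x. a x - b x)"
  using rat_affine_linear[of a b 1 "- 1"] by simp

lemma rat_affine_pp: "rat_affine a \<Longrightarrow> rat_pp a"
  unfolding rat_affine_def by (auto intro!: rat_pp.intros rat_pp_sum)

lemma rat_pp_le: "rat_affine a \<Longrightarrow> rat_affine b \<Longrightarrow> rat_pp (\<lambda>x. if a x \<le> b x then 1 else 0)"
  using rat_ind[OF rat_affine_diff[of b a]] by simp

lemma rat_pp_rational:
  assumes "rat_pp f" "\<And>i. x i \<in> \<rat>"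
  shows "f x \<in> \<rat>"
  using assms by induction (auto simp: rat_affine_def)

abbreviation cube :: "real \<Rightarrow> real measure" where
  "cube M \<equiv> restrict_space lborel {- M .. M}"

lemma rat_pp_measurable:
  assumes "rat_pp f"
  shows "f \<in> borel_measurable (Pi\<^sub>M V (\<lambda>_. cube M))"
proof -
  have id: "(\<lambda>x. x) \<in> borel_measurable (cube M)"
    by (auto intro: measurable_restrict_space1)
  have coord: "(\<lambda>x. x i) \<in> borel_measurable (Pi\<^sub>M V (\<lambda>_. cube M))" for i
  proof (cases "i \<in> V")
    case True
    show ?thesis by (rule measurable_compose[OF measurable_component_singleton[OF True] id])
  next
    case False
    have "(\<lambda>x. x i) \<in> borel_measurable (Pi\<^sub>M V (\<lambda>_. cube M)) \<longleftrightarrow> (\<lambda>x. undefined :: real) \<in> borel_measurable (Pi\<^sub>M V (\<lambda>_. cube M))"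
      by (rule measurable_cong) (use False in \<open>auto simp: space_PiM PiE_def extensional_def\<close>)
    thus ?thesis by simp
  qed
  show ?thesis using assms
  proof induction
    case (rat_ind a)
    then obtain r s where a: "a = (\<lambda>x. s + (\<Sum>j\<in>UNIV. r j * x j))" unfolding rat_affine_def by blast
    note coord[measurable]
    show ?case unfolding a by measurable
  qed (use coord in auto)
qed

lemma rat_pp_bounded:
  assumes "rat_pp f"
  shows "\<exists>B. \<forall>x. (\<forall>i. \<bar>x i\<bar> \<le> K) \<longrightarrow> \<bar>f x\<bar> \<le> B"
  using assms
proof induction
  case (rat_const c) thus ?case by auto
next
  case (rat_coord i) thus ?case by auto
next
  case (rat_add f g)
  then obtain B B' where "\<forall>x. (\<forall>i. \<bar>x i\<bar> \<le> K) \<longrightarrow> \<bar>f x\<bar> \<le> B" "\<forall>x. (\<forall>i. \<bar>x i\<bar> \<le> K) \<longrightarrow> \<bar>g x\<bar> \<le> B'" by blast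
  thus ?case by (intro exI[of _ "B + B'"]) (meson abs_triangle_ineq add_mono order_trans)
next
  case (rat_mult f g)
  then obtain B B' where "\<forall>x. (\<forall>i. \<bar>x i\<bar> \<le> K) \<longrightarrow> \<bar>f x\<bar> \<le> B" "\<forall>x. (\<forall>i. \<bar>x i\<bar> \<le> K) \<longrightarrow> \<bar>g x\<bar> \<le> B'" by blast
  thus ?case by (intro exI[of _ "B * B'"]) (auto simp: abs_mult intro!: mult_mono' )
next
  case (rat_ind a) thus ?case by (intro exI[of _ 1]) auto
qed

subsection \<open>Integration in one variable\<close>

text \<open>
  Normal forms with respect to the variable \<open>y\<close> in place of the \<open>i\<close>-th coordinate: sums of monomials in \<open>y\<close>
  on half-lines \<open>y \<ge> a x\<close>, with coefficients and endpoints that depend on the other coordinates.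
\<close>

inductive sectional :: "'n \<Rightarrow> (('n::finite \<Rightarrow> real) \<Rightarrow> real \<Rightarrow> real) \<Rightarrow> bool" for i where
  sec_term: "rat_pp c \<Longrightarrow> indep i c \<Longrightarrow> rat_affine a \<Longrightarrow> indep i a \<Longrightarrow>
    sectional i (\<lambda>x y. c x * y ^ m * (if a x \<le> y then 1 else 0))"
| sec_add: "sectional i g \<Longrightarrow> sectional i h \<Longrightarrow> sectional i (\<lambda>x y. g x y + h x y)"

text \<open>
  The intersection of the half-lines for \<open>a\<close> and \<open>a'\<close> is the one with the larger endpoint, and which one this
  is depends piecewise on \<open>x\<close>.
\<close>

lemma sectional_mult:
  assumes "sectional i g" "sectional i h"
  shows "sectional i (\<lambda>x y. g x y * h x y)"
  using assms(1)
proof induction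
  case (sec_term c a m)
  from assms(2) show ?case
  proof induction
    case (sec_term c' a' m')
    let ?I = "\<lambda>x. if a' x \<le> a x then 1 else (0::real)"
    have "sectional i (\<lambda>x y. (c x * c' x * ?I x) * y ^ (m + m') * (if a x \<le> y then 1 else 0)
        + (c x * c' x * (1 - ?I x)) * y ^ (m + m') * (if a' x \<le> y then 1 else 0))"
      using sec_term \<open>rat_pp c\<close> \<open>indep i c\<close> \<open>rat_affine a\<close> \<open>indep i a\<close>
      by (intro sectional.intros rat_pp.intros rat_pp_le rat_pp_diff) (auto simp: indep_def)
    also have "(\<lambda>x y. (c x * c' x * ?I x) * y ^ (m + m') * (if a x \<le> y then 1 else 0)
        + (c x * c' x * (1 - ?I x)) * y ^ (m + m') * (if a' x \<le> y then 1 else 0)) =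
       (\<lambda>x y. (c x * y ^ m * (if a x \<le> y then 1 else 0)) * (c' x * y ^ m' * (if a' x \<le> y then 1 else 0)))"
      by (auto simp: fun_eq_iff power_add)
    finally show ?case .
  next
    case (sec_add g h)
    have "sectional i (\<lambda>x y. (c x * y ^ m * (if a x \<le> y then 1 else 0)) * g x y + (c x * y ^ m * (if a x \<le> y then 1 else 0)) * h x y)"
      by (rule sectional.sec_add) (use sec_add in auto)
    thus ?case by (simp add: distrib_left)
  qed
next
  case (sec_add g' h')
  have "sectional i (\<lambda>x y. g' x y * h x y + h' x y * h x y)" by (rule sectional.sec_add) (use sec_add in auto)
  thus ?case by (simp add: distrib_right)
qed

text \<open>
  Finitely many exceptions are allowed for each \<open>x\<close>, because a half-line \<open>y \<le> a x\<close> is the complement of \<open>y \<ge> a x\<close> up to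
  its endpoint.  Below \<open>- M\<close> nothing is required; so the constant \<open>1\<close> is represented by the half-line
  \<open>y \<ge> - M\<close>.
\<close>

definition sectional_ae :: "'n \<Rightarrow> real \<Rightarrow> (('n::finite \<Rightarrow> real) \<Rightarrow> real) \<Rightarrow> bool" where
  "sectional_ae i M f \<longleftrightarrow> (\<exists>g. sectional i g \<and> (\<forall>x. \<exists>E. finite E \<and> (\<forall>y. - M \<le> y \<longrightarrow> y \<notin> E \<longrightarrow> f (x(i := y)) = g x y)))"

lemma sectional_aeI: "sectional i g \<Longrightarrow> (\<And>x y. - M \<le> y \<Longrightarrow> f (x(i := y)) = g x y) \<Longrightarrow> sectional_ae i M f"
  unfolding sectional_ae_def by (intro exI[of _ g]) (auto intro: exI[of _ "{}"])

lemma rat_pp_sectional_ae: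
  assumes "rat_pp f" and M: "M \<in> \<rat>"
  shows "sectional_ae i M f"
  using assms(1)
proof induction
  case (rat_const c)
  show ?case
    by (rule sectional_aeI[OF sec_term[of "\<lambda>_. c" i "\<lambda>_. - M" 0]])
       (use rat_const M in \<open>auto intro: rat_pp.rat_const rat_affine_const simp: indep_def\<close>)
next
  case (rat_coord j)
  show ?case
  proof (cases "j = i")
    case True
    show ?thesis
      by (rule sectional_aeI[OF sec_term[of "\<lambda>_. 1" i "\<lambda>_. - M" 1]])
         (use True M in \<open>auto intro: rat_pp.rat_const rat_affine_const simp: indep_def\<close>)
  next
    case False
    show ?thesis
      by (rule sectional_aeI[OF sec_term[of "\<lambda>x. x j" i "\<lambda>_. - M" 0]])
         (use False M in \<open>auto intro: rat_pp.rat_coord rat_affine_const simp: indep_def\<close>)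
  qed
next
  case (rat_add f1 f2)
  then obtain g1 g2 where g: "sectional i g1" "\<forall>x. \<exists>E. finite E \<and> (\<forall>y. - M \<le> y \<longrightarrow> y \<notin> E \<longrightarrow> f1 (x(i := y)) = g1 x y)"
     "sectional i g2" "\<forall>x. \<exists>E. finite E \<and> (\<forall>y. - M \<le> y \<longrightarrow> y \<notin> E \<longrightarrow> f2 (x(i := y)) = g2 x y)"
    unfolding sectional_ae_def by blast
  show ?case unfolding sectional_ae_def
  proof (intro exI[of _ "\<lambda>x y. g1 x y + g2 x y"] conjI allI)
    show "sectional i (\<lambda>x y. g1 x y + g2 x y)" by (rule sec_add[OF g(1,3)])
    fix x
    obtain E Y where "finite E" "\<forall>y. - M \<le> y \<longrightarrow> y \<notin> E \<longrightarrow> f1 (x(i := y)) = g1 x y"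
      "finite Y" "\<forall>y. - M \<le> y \<longrightarrow> y \<notin> Y \<longrightarrow> f2 (x(i := y)) = g2 x y" using g(2)[rule_format, of x] g(4)[rule_format, of x] by blast
    thus "\<exists>E. finite E \<and> (\<forall>y. - M \<le> y \<longrightarrow> y \<notin> E \<longrightarrow> f1 (x(i := y)) + f2 (x(i := y)) = g1 x y + g2 x y)"
      by (intro exI[of _ "E \<union> Y"]) auto
  qed
next
  case (rat_mult f1 f2)
  then obtain g1 g2 where g: "sectional i g1" "\<forall>x. \<exists>E. finite E \<and> (\<forall>y. - M \<le> y \<longrightarrow> y \<notin> E \<longrightarrow> f1 (x(i := y)) = g1 x y)"
     "sectional i g2" "\<forall>x. \<exists>E. finite E \<and> (\<forall>y. - M \<le> y \<longrightarrow> y \<notin> E \<longrightarrow> f2 (x(i := y)) = g2 x y)"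
    unfolding sectional_ae_def by blast
  show ?case unfolding sectional_ae_def
  proof (intro exI[of _ "\<lambda>x y. g1 x y * g2 x y"] conjI allI)
    show "sectional i (\<lambda>x y. g1 x y * g2 x y)" by (rule sectional_mult[OF g(1,3)])
    fix x
    obtain E Y where "finite E" "\<forall>y. - M \<le> y \<longrightarrow> y \<notin> E \<longrightarrow> f1 (x(i := y)) = g1 x y"
      "finite Y" "\<forall>y. - M \<le> y \<longrightarrow> y \<notin> Y \<longrightarrow> f2 (x(i := y)) = g2 x y" using g(2)[rule_format, of x] g(4)[rule_format, of x] by blast
    thus "\<exists>E. finite E \<and> (\<forall>y. - M \<le> y \<longrightarrow> y \<notin> E \<longrightarrow> f1 (x(i := y)) * f2 (x(i := y)) = g1 x y * g2 x y)"
      by (intro exI[of _ "E \<union> Y"]) auto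
  qed
next
  case (rat_ind a)
  then obtain r s where a: "\<And>j. r j \<in> \<rat>" "s \<in> \<rat>" "a = (\<lambda>x. s + (\<Sum>j\<in>UNIV. r j * x j))"
    unfolding rat_affine_def by blast
  define b where "b x = s + (\<Sum>j\<in>UNIV. (if j = i then 0 else r j) * x j)" for x
  have b: "rat_affine b" unfolding b_def by (rule rat_affineI) (use a in auto)
  have bi: "indep i b" unfolding indep_def b_def by (auto intro!: sum.cong)
  have ab: "a (x(i := y)) = r i * y + b x" for x y
  proof -
    have "(\<Sum>j\<in>UNIV. r j * (x(i := y)) j) = r i * y + (\<Sum>j\<in>UNIV - {i}. r j * (x(i := y)) j)"
      by (simp add: sum.remove[of UNIV i])
    also have "(\<Sum>j\<in>UNIV - {i}. r j * (x(i := y)) j) = (\<Sum>j\<in>UNIV - {i}. (if j = i then 0 else r j) * x j)"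
      by (rule sum.cong) auto
    also have "\<dots> = (\<Sum>j\<in>UNIV. (if j = i then 0 else r j) * x j)"
      by (simp add: sum.remove[of UNIV i])
    finally show ?thesis by (simp add: a(3) b_def)
  qed
  show ?case
  proof (cases "r i = 0")
    case True
    have eq: "0 \<le> a (x(i := y)) \<longleftrightarrow> 0 \<le> b x" for x y using ab[of x y] True by simp
    show ?thesis
    proof (rule sectional_aeI[OF sec_term[of "\<lambda>x. if 0 \<le> b x then 1 else 0" i "\<lambda>_. - M" 0]])
      fix x and y :: real assume "- M \<le> y"
      thus "(if 0 \<le> a (x(i := y)) then 1 else 0) = (if 0 \<le> b x then 1 else 0) * y ^ 0 * (if - M \<le> y then 1 else 0)"
        unfolding eq by simp
    qed (use M bi in \<open>auto intro: rat_pp.rat_ind[OF b] rat_affine_const simp: indep_def\<close>)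
  next
    case False
    define c where "c = (\<lambda>x. - (1 / r i) * b x)"
    have c: "rat_affine c" unfolding c_def using rat_affine_linear[OF b b, of "- (1 / r i)" 0] a(1)[of i] by simp
    have ci: "indep i c" using bi unfolding c_def indep_def by simp
    show ?thesis
    proof (cases "0 < r i")
      case True
      have eq: "0 \<le> a (x(i := y)) \<longleftrightarrow> c x \<le> y" for x y
        unfolding ab c_def using True by (auto simp: field_simps)
      show ?thesis
      proof (rule sectional_aeI[OF sec_term[of "\<lambda>_. 1" i c 0]])
        fix x and y :: real
        show "(if 0 \<le> a (x(i := y)) then 1 else 0) = 1 * y ^ 0 * (if c x \<le> y then 1 else 0)"
          unfolding eq by simp
      qed (use c ci in \<open>auto simp: indep_def intro: rat_pp.rat_const\<close>)
    next
      case F2: False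
      hence neg: "r i < 0" using False by simp
      have eq: "0 \<le> a (x(i := y)) \<longleftrightarrow> y \<le> c x" for x y
        unfolding ab c_def using neg by (auto simp: field_simps)
      let ?g = "\<lambda>x y. 1 * y ^ 0 * (if - M \<le> y then 1 else 0) + (- 1) * y ^ 0 * (if c x \<le> y then 1 else 0)"
      have "sectional i ?g"
        using c ci M by (intro sectional.intros rat_pp.rat_const rat_affine_const) (auto simp: indep_def)
      moreover have "\<exists>E. finite E \<and> (\<forall>y. - M \<le> y \<longrightarrow> y \<notin> E \<longrightarrow> (if 0 \<le> a (x(i := y)) then 1 else 0) = ?g x y)" for x
        by (intro exI[of _ "{c x}"]) (unfold eq, auto)
      ultimately show ?thesis unfolding sectional_ae_def by blast
    qed
  qed
qed

lemma finite_measure_cube: "finite_measure (cube M)"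
  by (rule finite_measureI) (simp add: space_restrict_space emeasure_restrict_space ennreal_mult_less_top emeasure_lborel_Icc_eq)

text \<open>
  Here \<open>q\<close> is the endpoint \<open>t\<close> clamped to the interval \<open>[- M, M]\<close>.
\<close>

lemma cube_power_integral:
  assumes "0 \<le> M"
  shows "integrable (cube M) (\<lambda>y. y ^ m * (if t \<le> y then 1 else 0 :: real))"
    and "(LINT y|cube M. y ^ m * (if t \<le> y then 1 else 0)) = (M ^ Suc m - (min M (max (- M) t)) ^ Suc m) / real (Suc m)"
proof -
  define q where "q = min M (max (- M) t)"
  have q: "- M \<le> q" "q \<le> M" using assms by (auto simp: q_def)
  have AE: "AE y in lborel. indicator {- M..M} y * (y ^ m * (if t \<le> y then 1 else 0 :: real)) = indicator {q..M} y * y ^ m"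
  proof (rule AE_mp[OF AE_lborel_singleton[of M]], intro AE_I2 impI)
    fix y assume "y \<noteq> M"
    thus "indicator {- M..M} y * (y ^ m * (if t \<le> y then 1 else 0 :: real)) = indicator {q..M} y * y ^ m"
      by (auto simp: q_def indicator_def min_def max_def split: if_splits)
  qed
  have int: "integrable lborel (\<lambda>y. indicator {q..M} y * y ^ m)" 
    using borel_integrable_atLeastAtMost[of q M "\<lambda>y. y ^ m"] by (simp add: indicator_def mult.commute)
  have FTC: "(LINT y|lborel. y ^ m * indicator {q..M} y) = M ^ Suc m / real (Suc m) - q ^ Suc m / real (Suc m)"
    by (rule integral_FTC_Icc_real) (use q in \<open>auto intro!: derivative_eq_intros simp del: of_nat_Suc power_Suc\<close>)
  have meas: "(\<lambda>y. indicator {- M..M} y * (y ^ m * (if t \<le> y then 1 else 0 :: real))) \<in> borel_measurable lborel" by measurable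
  have "integrable lborel (\<lambda>y. indicator {- M..M} y * (y ^ m * (if t \<le> y then 1 else 0 :: real)))"
    using integrable_cong_AE[THEN iffD2, OF meas _ AE int] by (simp add: borel_measurable_integrable[OF int])
  thus "integrable (cube M) (\<lambda>y. y ^ m * (if t \<le> y then 1 else 0 :: real))"
    by (subst integrable_restrict_space) auto
  have "(LINT y|cube M. y ^ m * (if t \<le> y then 1 else 0)) = (LINT y|lborel. indicator {- M..M} y * (y ^ m * (if t \<le> y then 1 else 0)))"
    by (subst integral_restrict_space) auto
  also have "\<dots> = (LINT y|lborel. indicator {q..M} y * y ^ m)"
    by (rule integral_cong_AE[OF meas _ AE]) (simp add: borel_measurable_integrable[OF int])
  also have "\<dots> = (LINT y|lborel. y ^ m * indicator {q..M} y)" by (simp add: mult.commute)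
  finally show "(LINT y|cube M. y ^ m * (if t \<le> y then 1 else 0)) = (M ^ Suc m - (min M (max (- M) t)) ^ Suc m) / real (Suc m)"
    unfolding FTC q_def[symmetric] by (simp only: diff_divide_distrib)
qed

lemma sectional_integral:
  assumes "sectional i g" and M: "M \<in> \<rat>" "0 \<le> M"
  shows "(\<forall>x. integrable (cube M) (g x)) \<and> rat_pp (\<lambda>x. LINT y|cube M. g x y)"
  using assms(1)
proof induction
  case (sec_term c a m)
  have int: "integrable (cube M) (\<lambda>y. c x * y ^ m * (if a x \<le> y then 1 else 0))" for x
    using integrable_mult_right[OF cube_power_integral(1)[OF M(2), of m "a x"], of "c x"] by (simp add: mult.assoc)
  let ?le = "\<lambda>x b b'. if b x \<le> b' x then 1 else (0::real)"
  define t where "t x = (?le x a (\<lambda>_. - M)) * (- M) + (1 - ?le x a (\<lambda>_. - M)) * (?le x a (\<lambda>_. M) * a x + (1 - ?le x a (\<lambda>_. M)) * M)" for x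
  have t: "min M (max (- M) (a x)) = t x" for x using M(2) by (auto simp: t_def)
  have "rat_pp t" unfolding t_def
    by (intro rat_pp.intros rat_pp_diff rat_pp_le rat_affine_pp rat_affine_const) (use M sec_term in auto)
  moreover have "(LINT y|cube M. c x * y ^ m * (if a x \<le> y then 1 else 0)) = c x * ((M ^ Suc m - t x ^ Suc m) * (1 / real (Suc m)))" for x
  proof -
    have "(LINT y|cube M. c x * y ^ m * (if a x \<le> y then 1 else 0)) = c x * (LINT y|cube M. y ^ m * (if a x \<le> y then 1 else 0))"
      by (simp only: mult.assoc integral_mult_right_zero)
    thus ?thesis unfolding cube_power_integral(2)[OF M(2)] t by simp
  qed
  moreover have "rat_pp (\<lambda>x. c x * ((M ^ Suc m - t x ^ Suc m) * (1 / real (Suc m))))"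
    by (intro rat_pp.rat_mult rat_pp_diff rat_pp_power rat_pp.rat_const) (use M sec_term(1) \<open>rat_pp t\<close> in auto)
  ultimately show ?case using int by presburger
next
  case (sec_add g h)
  thus ?case by (auto intro: rat_pp.rat_add)
qed

lemma AE_cube_finite: "finite E \<Longrightarrow> AE y in cube M. y \<notin> E \<and> - M \<le> y"
proof -
  assume E: "finite E"
  have "AE y in lborel. y \<notin> E" by (rule AE_not_in) (use E in \<open>simp add: finite_imp_null_set_lborel\<close>)
  thus ?thesis by (subst AE_restrict_space_iff) auto
qed

text \<open>
  The integral of a normal form is computed by the fundamental theorem of calculus, and clamping the
  endpoints of the half-lines is again piecewise linear.
\<close>

lemma rat_pp_integral:
  assumes f: "rat_pp f" and M: "M \<in> \<rat>" "0 \<le> M"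
  shows "rat_pp (\<lambda>x. LINT y|cube M. f (x(i := y)))"
proof -
  obtain g where g: "sectional i g" "\<forall>x. \<exists>E. finite E \<and> (\<forall>y. - M \<le> y \<longrightarrow> y \<notin> E \<longrightarrow> f (x(i := y)) = g x y)"
    using rat_pp_sectional_ae[OF f M(1), of i] unfolding sectional_ae_def by blast
  note gi = sectional_integral[OF g(1) M]
  have meas: "(\<lambda>y. f (x(i := y))) \<in> borel_measurable (cube M)" for x
    using f
  proof induction
    case (rat_coord j)
    show ?case by (cases "j = i") (auto intro: measurable_restrict_space1)
  next
    case (rat_ind a)
    then obtain r s where a: "a = (\<lambda>x. s + (\<Sum>j\<in>UNIV. r j * x j))" unfolding rat_affine_def by blast
    have [measurable]: "(\<lambda>y. (x(i := y)) j) \<in> borel_measurable (cube M)" for j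
      by (cases "j = i") (auto intro: measurable_restrict_space1)
    show ?case unfolding a by measurable
  qed auto
  have "(LINT y|cube M. f (x(i := y))) = (LINT y|cube M. g x y)" for x
  proof (rule integral_cong_AE[OF meas])
    show "g x \<in> borel_measurable (cube M)" using gi by (auto intro: borel_measurable_integrable)
    obtain E where "finite E" "\<forall>y. - M \<le> y \<longrightarrow> y \<notin> E \<longrightarrow> f (x(i := y)) = g x y" using g(2) by blast
    thus "AE y in cube M. f (x(i := y)) = g x y" using AE_cube_finite[of E M] by (auto elim: AE_mp)
  qed
  thus ?thesis using gi by simp
qed

interpretation cube: product_sigma_finite "\<lambda>_ :: 'n. cube M" for M
  by (rule product_sigma_finite.intro) 
     (metis finite_measure.axioms(1) finite_measure_cube)

lemma finite_measure_PiM_cube: "finite V \<Longrightarrow> finite_measure (Pi\<^sub>M V (\<lambda>_. cube M))"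
proof (rule finite_measureI)
  assume V: "finite V"
  have "emeasure (Pi\<^sub>M V (\<lambda>_. cube M)) (space (Pi\<^sub>M V (\<lambda>_. cube M))) = (\<Prod>i\<in>V. emeasure (cube M) (space (cube M)))"
    unfolding space_PiM by (rule cube.emeasure_PiM[OF V]) (rule sets.top)
  also have "\<dots> \<noteq> \<infinity>" using finite_measure.emeasure_finite[OF finite_measure_cube, of M]
    by (simp add: ennreal_prod_eq_top power_eq_top_ennreal)
  finally show "emeasure (Pi\<^sub>M V (\<lambda>_. cube M)) (space (Pi\<^sub>M V (\<lambda>_. cube M))) \<noteq> \<infinity>" .
qed

lemma rat_pp_integrable:
  fixes f :: "('n::finite \<Rightarrow> real) \<Rightarrow> real"
  assumes f: "rat_pp f"
  shows "integrable (Pi\<^sub>M V (\<lambda>_. cube M)) f"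
proof -
  interpret finite_measure "Pi\<^sub>M V (\<lambda>_. cube M)" by (rule finite_measure_PiM_cube) simp
  obtain B where B: "\<And>x. (\<forall>i. \<bar>x i\<bar> \<le> max M \<bar>undefined\<bar>) \<Longrightarrow> \<bar>f x\<bar> \<le> B"
    using rat_pp_bounded[OF f] by meson
  show ?thesis
  proof (rule integrable_const_bound[of _ B])
    show "AE x in Pi\<^sub>M V (\<lambda>_. cube M). norm (f x) \<le> B"
    proof (rule AE_I2)
      fix x assume x: "x \<in> space (Pi\<^sub>M V (\<lambda>_. cube M))"
      have "\<bar>x i\<bar> \<le> max M \<bar>undefined\<bar>" for i
        using x by (cases "i \<in> V") (fastforce simp: space_PiM space_restrict_space PiE_def extensional_def Pi_def)+
      thus "norm (f x) \<le> B" using B by simp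
    qed
    show "f \<in> borel_measurable (Pi\<^sub>M V (\<lambda>_. cube M))" by (rule rat_pp_measurable[OF f])
  qed
qed

text \<open>
  By Fubini's theorem the coordinates are integrated out one by one; what remains is a constant, namely
  a value at the rational point \<open>0\<close>.
\<close>

theorem rat_pp_integral_rational:
  fixes f :: "('n::finite \<Rightarrow> real) \<Rightarrow> real"
  assumes f: "rat_pp f" and M: "M \<in> \<rat>" "0 \<le> M" and ind: "\<And>j. j \<notin> V \<Longrightarrow> indep j f"
  shows "integral\<^sup>L (Pi\<^sub>M V (\<lambda>_. cube M)) f \<in> \<rat>"
proof -
  have "finite V" by simp
  thus ?thesis using f ind
  proof (induction V arbitrary: f rule: finite_induct)
    case empty
    have "f x = f y" for x y :: "'n \<Rightarrow> real"
    proof -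
      have "f (\<lambda>i. if i \<in> A then x i else y i) = f y" if "finite A" for A
        using that
      proof (induction A rule: finite_induct)
        case (insert j A)
        have "(\<lambda>i. if i \<in> insert j A then x i else y i) = (\<lambda>i. if i \<in> A then x i else y i)(j := x j)" by auto
        thus ?case using empty.prems(2)[of j] insert.IH unfolding indep_def by simp
      qed simp
      from this[of UNIV] show ?thesis by simp
    qed
    hence "f undefined = f (\<lambda>_. 0)" .
    moreover have "f (\<lambda>_. 0) \<in> \<rat>" by (rule rat_pp_rational[OF empty.prems(1)]) simp
    moreover have "integral\<^sup>L (Pi\<^sub>M {} (\<lambda>_. cube M)) f = f (\<lambda>_. undefined)"
      by (simp add: PiM_empty lebesgue_integral_count_space_finite)
    ultimately show ?case using \<open>\<And>x y. f x = f y\<close> by metis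
  next
    case (insert i V)
    have "integral\<^sup>L (Pi\<^sub>M (insert i V) (\<lambda>_. cube M)) f = (LINT x|Pi\<^sub>M V (\<lambda>_. cube M). LINT y|cube M. f (x(i := y)))"
      by (rule cube.product_integral_insert) (use insert rat_pp_integrable in auto)
    also have "\<dots> \<in> \<rat>"
    proof (rule insert.IH)
      show "rat_pp (\<lambda>x. LINT y|cube M. f (x(i := y)))" by (rule rat_pp_integral[OF insert.prems(1) M])
      fix j assume j: "j \<notin> V"
      show "indep j (\<lambda>x. LINT y|cube M. f (x(i := y)))"
      proof (cases "j = i")
        case False
        hence "f ((x(j := z))(i := y)) = f (x(i := y))" for x y z
          using insert.prems(2)[of j] j unfolding indep_def by (simp add: fun_upd_twist)
        thus ?thesis by (simp add: indep_def)
      qed (simp add: indep_def)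
    qed
    finally show ?case .
  qed
qed

section \<open>Lattice points in dilations of rational polyhedra\<close>

definition affpt :: "('n \<Rightarrow> 'a) \<Rightarrow> 'n option \<Rightarrow> 'a::linordered_field" where
  "affpt y v = (case v of None \<Rightarrow> 1 | Some i \<Rightarrow> y i)"

lemma ev_affpt: "ev \<omega> (affpt y) = (\<Sum>i\<in>UNIV. of_int (\<omega> (Some i)) * y i) + of_int (\<omega> None)"
  by (simp add: ev_def sum_option affpt_def)

text \<open>
  The cells of the arrangement of the hyperplanes \<open>\<omega> (y, 1) = 0\<close> are the fibres of this function.
\<close>

definition nonneg_forms :: "('n::finite option \<Rightarrow> int) set \<Rightarrow> ('n \<Rightarrow> real) \<Rightarrow> ('n option \<Rightarrow> int) set" where
  "nonneg_forms L y = {\<omega> \<in> L. 0 \<le> ev \<omega> (affpt y)}"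

lemma nonneg_forms_zlift:
  assumes u: "0 < u"
  shows "nonneg_forms L (\<lambda>i. of_int (a i) / u) = {\<omega> \<in> L. 0 \<le> ev \<omega> (zlift a u)}"
proof -
  have "ev \<omega> (zlift a u) = u * ev \<omega> (affpt (\<lambda>i. of_int (a i) / u))" for \<omega>
    using u by (simp add: ev_zlift ev_affpt distrib_left sum_distrib_left mult.commute)
  thus ?thesis using u by (simp add: nonneg_forms_def zero_le_mult_iff)
qed

lemma ev_zlift_of_rat: "ev \<omega> (zlift a (of_rat u)) = of_rat (ev \<omega> (zlift a u))"
  by (simp add: ev_zlift of_rat_add of_rat_mult del: of_int_sum of_int_mult)

lemma nonneg_forms_zlift_rat:
  assumes u: "0 < (u :: rat)"
  shows "{\<omega> \<in> L. 0 \<le> ev \<omega> (zlift a u)} = nonneg_forms L (\<lambda>i. of_int (a i) / of_rat u)"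
  using nonneg_forms_zlift[of "of_rat u" L a] u by (simp add: ev_zlift_of_rat)

text \<open>
  Generators of the closed cone over the cell with last coordinate \<open>0\<close> are recession directions.  If all of
  them vanish, the coefficients of the other generators are at most \<open>1\<close> in a representation of
  \<open>(y, 1)\<close>, which bounds the cell.  Otherwise, let \<open>z\<close> be the sum of the generators that occur with a
  positive coefficient at some point of the cell: it satisfies the same strict inequalities as
  that point, so it is an integral point of the cone over the cell.
\<close>

lemma cell_bounded_or_recession:
  fixes L T :: "('n::finite option \<Rightarrow> int) set"
  assumes L: "finite L" and T: "T \<subseteq> L"
  shows "(\<exists>K. \<forall>y. nonneg_forms L y = T \<longrightarrow> (\<forall>i. \<bar>y i\<bar> \<le> K)) \<or>
    (\<exists>z v. (\<forall>\<omega>\<in>T. 0 \<le> dot \<omega> z \<and> 0 \<le> dot \<omega> v) \<and> (\<forall>\<omega>\<in>L - T. dot \<omega> z < 0 \<and> dot \<omega> v \<le> 0) \<and>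
       0 < z None \<and> v None = 0 \<and> (\<exists>i. v (Some i) \<noteq> 0))"
proof -
  define e0 :: "'n option \<Rightarrow> int" where "e0 v = (if v = None then 1 else 0)" for v
  have e0: "dot e0 g = g None" for g
    by (simp add: dot_def e0_def sum_option)
  define W where "W = T \<union> (\<lambda>\<omega> v. - \<omega> v) ` (L - T) \<union> {e0}"
  have finW: "finite W" using L T by (auto simp: W_def intro: finite_subset)
  obtain G where G: "finite G" "\<And>x :: 'n option \<Rightarrow> real. in_cone G x \<longleftrightarrow> (\<forall>w\<in>W. 0 \<le> ev w x)"
    by (rule minkowski[OF finW]) (rule that)
  have dotW: "0 \<le> dot w g" if "w \<in> W" "g \<in> G" for w g
    using G(2)[of "\<lambda>v. of_int (g v)"] in_coneI[OF G(1) that(2), where 'b = real] that(1) by (simp add: ev_of_int)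
  have dneg: "dot (\<lambda>v. - \<omega> v) g = - dot \<omega> g" for \<omega> g by (simp add: dot_def sum_negf)
  have gT: "0 \<le> dot \<omega> g" if "\<omega> \<in> T" "g \<in> G" for \<omega> g using dotW[of \<omega> g] that by (simp add: W_def)
  have gN: "dot \<omega> g \<le> 0" if "\<omega> \<in> L - T" "g \<in> G" for \<omega> g using dotW[of "\<lambda>v. - \<omega> v" g] that by (simp add: W_def dneg)
  have g0: "0 \<le> g None" if "g \<in> G" for g using dotW[of e0 g] that by (simp add: W_def e0)
  have repr: "\<exists>l. (\<forall>g\<in>G. (0::real) \<le> l g) \<and> (\<forall>v. affpt y v = (\<Sum>g\<in>G. l g * of_int (g v)))" if y: "nonneg_forms L y = T" for y
  proof -
    have "0 \<le> ev w (affpt y)" if w: "w \<in> W" for w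
    proof -
      from w consider "w \<in> T" | \<omega> where "w = (\<lambda>v. - \<omega> v)" "\<omega> \<in> L - T" | "w = e0" by (auto simp: W_def)
      thus ?thesis
      proof cases
        case 1 thus ?thesis using y by (auto simp: nonneg_forms_def)
      next
        case 2
        have "ev \<omega> (affpt y) < 0" using 2(2) y by (auto simp: nonneg_forms_def not_le)
        moreover have "ev w (affpt y) = - ev \<omega> (affpt y)" by (simp add: 2(1) ev_def sum_negf)
        ultimately show ?thesis by simp
      next
        case 3
        thus ?thesis by (simp add: ev_affpt e0_def)
      qed
    qed
    thus ?thesis using G(2)[of "affpt y"] unfolding in_cone_def by blast
  qed
  show ?thesis
  proof (cases "\<exists>y. nonneg_forms L y = T")
    case False
    hence "\<forall>y. nonneg_forms L y = T \<longrightarrow> (\<forall>i. \<bar>y i\<bar> \<le> 0)" by blast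
    thus ?thesis by (intro disjI1 exI)
  next
    case True
    then obtain y0 where y0: "nonneg_forms L y0 = T" by blast
    show ?thesis
    proof (cases "\<exists>v\<in>G. v None = 0 \<and> (\<exists>i. v (Some i) \<noteq> 0)")
      case True
      then obtain v where v: "v \<in> G" "v None = 0" "\<exists>i. v (Some i) \<noteq> 0" by blast
      obtain l where l: "\<And>g. g \<in> G \<Longrightarrow> (0::real) \<le> l g" "\<And>v. affpt y0 v = (\<Sum>g\<in>G. l g * of_int (g v))"
        using repr[OF y0] by blast
      define H where "H = {g \<in> G. 0 < l g}"
      have H: "finite H" "H \<subseteq> G" using G(1) by (auto simp: H_def)
      define z where "z v = (\<Sum>g\<in>H. g v)" for v
      have dz: "dot \<omega> z = (\<Sum>g\<in>H. dot \<omega> g)" for \<omega>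
        unfolding dot_def z_def sum_distrib_left by (rule sum.swap)
      have evy: "ev \<omega> (affpt y0) = (\<Sum>g\<in>H. l g * of_int (dot \<omega> g))" for \<omega>
      proof -
        have "affpt y0 = (\<lambda>v. \<Sum>g\<in>G. l g * of_int (g v))" using l(2) by blast
        hence "ev \<omega> (affpt y0) = (\<Sum>g\<in>G. l g * of_int (dot \<omega> g))" by (simp add: ev_combination)
        also have "\<dots> = (\<Sum>g\<in>H. l g * of_int (dot \<omega> g))"
          by (rule sum.mono_neutral_right) (use G(1) l(1) in \<open>auto simp: H_def less_le\<close>)
        finally show ?thesis .
      qed
      have "0 \<le> dot \<omega> z" if "\<omega> \<in> T" for \<omega>
        unfolding dz by (rule sum_nonneg) (use gT[OF that] H in auto)
      moreover have "dot \<omega> z < 0" if \<omega>: "\<omega> \<in> L - T" for \<omega>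
      proof -
        have "(\<Sum>g\<in>H. l g * of_int (dot \<omega> g)) < 0" using \<omega> y0 evy[of \<omega>] by (auto simp: nonneg_forms_def not_le)
        then obtain g where g: "g \<in> H" "l g * of_int (dot \<omega> g) < 0" by (meson not_le sum_nonneg)
        have "dot \<omega> g < 0" using g by (simp add: H_def mult_less_0_iff)
        have "(\<Sum>g\<in>H. dot \<omega> g) < (\<Sum>g\<in>H. 0)"
          by (rule sum_strict_mono_ex1) (use H gN[OF \<omega>] g(1) \<open>dot \<omega> g < 0\<close> in auto)
        thus ?thesis unfolding dz by simp
      qed
      moreover have "0 < z None"
      proof -
        have "(\<Sum>g\<in>H. l g * of_int (dot e0 g)) = 1" using evy[of e0] by (simp add: ev_affpt e0_def)
        hence "(\<Sum>g\<in>H. l g * of_int (dot e0 g)) \<noteq> 0" by simp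
        then obtain g where g: "g \<in> H" "l g * of_int (dot e0 g) \<noteq> 0"
          by (rule sum.not_neutral_contains_not_neutral)
        have "g None \<noteq> 0" using g(2) by (auto simp: e0)
        moreover have "0 \<le> g None" using g0 g(1) H(2) by blast
        ultimately have "0 < g None" by simp
        also have "g None \<le> (\<Sum>g\<in>H. g None)" by (rule member_le_sum) (use g H g0 in auto)
        finally show ?thesis by (simp add: z_def)
      qed
      ultimately have "\<exists>z v. (\<forall>\<omega>\<in>T. 0 \<le> dot \<omega> z \<and> 0 \<le> dot \<omega> v) \<and> (\<forall>\<omega>\<in>L - T. dot \<omega> z < 0 \<and> dot \<omega> v \<le> 0) \<and>
         0 < z None \<and> v None = 0 \<and> (\<exists>i. v (Some i) \<noteq> 0)"
        using gT[OF _ v(1)] gN[OF _ v(1)] v(2,3) by (intro exI[of _ z] exI[of _ v] conjI ballI) simp_all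
      thus ?thesis ..
    next
      case False
      define K where "K = (\<Sum>g\<in>G. \<Sum>i\<in>UNIV. \<bar>of_int (g (Some i)) :: real\<bar>)"
      have "\<bar>y i\<bar> \<le> K" if y: "nonneg_forms L y = T" for y i
      proof -
        obtain l where l: "\<And>g. g \<in> G \<Longrightarrow> (0::real) \<le> l g" "\<And>v. affpt y v = (\<Sum>g\<in>G. l g * of_int (g v))"
          using repr[OF y] by blast
        have "\<bar>l g * of_int (g (Some i))\<bar> \<le> (\<Sum>i\<in>UNIV. \<bar>of_int (g (Some i))\<bar>)" if g: "g \<in> G" for g
        proof (cases "g None = 0")
          case True
          hence "g (Some i) = 0" using False g by blast
          thus ?thesis by (simp add: sum_nonneg)
        next
          case n: False
          hence n1: "1 \<le> g None" using g0[OF g] by simp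
          have "l g * 1 \<le> l g * of_int (g None)" using l(1)[OF g] n1 by (intro mult_left_mono) auto
          also have "\<dots> \<le> (\<Sum>g\<in>G. l g * of_int (g None))"
            by (rule member_le_sum) (use g G(1) l(1) g0 in auto)
          also have "\<dots> = 1" using l(2)[of None] by (simp add: affpt_def)
          finally have "l g \<le> 1" by simp
          hence "\<bar>l g * of_int (g (Some i))\<bar> \<le> 1 * \<bar>of_int (g (Some i))\<bar>"
            unfolding abs_mult using l(1)[OF g] by (intro mult_right_mono) auto
          also have "\<dots> \<le> (\<Sum>i\<in>UNIV. \<bar>of_int (g (Some i))\<bar>)"
            using member_le_sum[of i UNIV "\<lambda>i. \<bar>of_int (g (Some i)) :: real\<bar>"] by simp
          finally show ?thesis .
        qed
        hence "(\<Sum>g\<in>G. \<bar>l g * of_int (g (Some i))\<bar>) \<le> K" unfolding K_def by (rule sum_mono)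
        moreover have "\<bar>y i\<bar> \<le> (\<Sum>g\<in>G. \<bar>l g * of_int (g (Some i))\<bar>)"
          using l(2)[of "Some i"] sum_abs[of "\<lambda>g. l g * of_int (g (Some i))" G] by (simp add: affpt_def)
        ultimately show ?thesis by simp
      qed
      hence "\<forall>y. nonneg_forms L y = T \<longrightarrow> (\<forall>i. \<bar>y i\<bar> \<le> K)" by blast
      thus ?thesis by (intro disjI1 exI)
    qed
  qed
qed

text \<open>
  Otherwise let \<open>z\<close> and \<open>v\<close> be an integral point of the cone and an integral recession direction.
  Then all the points \<open>m z + t v\<close> lie in the dilation of the cell by \<open>u = m * z None\<close>.
\<close>

lemma cell_bounded:
  fixes L T :: "('n::finite option \<Rightarrow> int) set"
  assumes L: "finite L" and T: "T \<subseteq> L"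
    and fin: "\<And>u. u \<ge> u0 \<Longrightarrow> 0 < u \<Longrightarrow> finite {a. {\<omega> \<in> L. 0 \<le> ev \<omega> (zlift a (u::rat))} = T}"
  shows "\<exists>K. \<forall>y. nonneg_forms L y = T \<longrightarrow> (\<forall>i. \<bar>y i\<bar> \<le> K)"
proof (rule ccontr)
  assume "\<not> ?thesis"
  then obtain z v i where zv: "\<And>\<omega>. \<omega> \<in> T \<Longrightarrow> 0 \<le> dot \<omega> z \<and> 0 \<le> dot \<omega> v"
    "\<And>\<omega>. \<omega> \<in> L - T \<Longrightarrow> dot \<omega> z < 0 \<and> dot \<omega> v \<le> 0" "0 < z None" "v None = 0" "v (Some i) \<noteq> 0"
    using cell_bounded_or_recession[OF L T] by blast
  define m where "m = max 1 \<lceil>u0\<rceil>"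
  have m: "1 \<le> m" "u0 \<le> of_int m" unfolding m_def by (auto simp: le_max_iff_disj) (use le_of_int_ceiling[of u0] in linarith)
  define u :: rat where "u = of_int (m * z None)"
  have "m * 1 \<le> m * z None" using m zv(3) by (intro mult_left_mono) auto
  hence mz: "m \<le> m * z None" by simp
  have u: "u0 \<le> u" "0 < u"
  proof -
    have "(of_int m :: rat) \<le> u" unfolding u_def using mz by (simp only: of_int_le_iff)
    thus "u0 \<le> u" using m(2) by linarith
    show "0 < u" unfolding u_def using m(1) mz by (simp only: of_int_0_less_iff)
  qed
  define p where "p t = (\<lambda>j. m * z (Some j) + int t * v (Some j))" for t
  have ev: "ev \<omega> (zlift (p t) u) = of_int (m * dot \<omega> z + int t * dot \<omega> v)" for \<omega> t
    unfolding ev_zlift u_def p_def dot_def sum_option using zv(4)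
    by (simp add: distrib_left sum.distrib sum_distrib_left mult_ac)
  have "{\<omega> \<in> L. 0 \<le> ev \<omega> (zlift (p t) u)} = T" for t
  proof -
    have "0 \<le> ev \<omega> (zlift (p t) u) \<longleftrightarrow> \<omega> \<in> T" if \<omega>: "\<omega> \<in> L" for \<omega>
    proof (cases "\<omega> \<in> T")
      case True
      have "0 \<le> m * dot \<omega> z + int t * dot \<omega> v" using zv(1)[OF True] m(1) by simp
      thus ?thesis unfolding ev using True by (simp only: of_int_0_le_iff)
    next
      case False
      have "m * dot \<omega> z < 0" "int t * dot \<omega> v \<le> 0" using zv(2)[of \<omega>] \<omega> False m(1)
        by (auto simp: mult_less_0_iff mult_le_0_iff)
      hence "\<not> 0 \<le> m * dot \<omega> z + int t * dot \<omega> v" by linarith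
      thus ?thesis unfolding ev using False by (simp only: of_int_0_le_iff)
    qed
    thus ?thesis using T by blast
  qed
  hence "range p \<subseteq> {a. {\<omega> \<in> L. 0 \<le> ev \<omega> (zlift a u)} = T}" by blast
  hence "finite (range p)" using fin[OF u] finite_subset by blast
  moreover have "inj p"
  proof (rule injI)
    fix s t assume "p s = p t"
    from fun_cong[OF this, of i] show "s = t" using zv(5) by (simp add: p_def)
  qed
  ultimately show False using finite_imageD[of p UNIV] by simp
qed

section \<open>The limit\<close>

definition cell_weight :: "('n::finite option \<Rightarrow> int) set \<Rightarrow> (('n option \<Rightarrow> int) set \<Rightarrow> nat) \<Rightarrow> ('n \<Rightarrow> real) \<Rightarrow> real" where
  "cell_weight L h y = real (h (nonneg_forms L y))"

text \<open>
  The indicator function of a cell is a product of indicators of half-spaces and of their complements.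
\<close>

lemma cell_weight_rat_pp:
  assumes L: "finite L"
  shows "rat_pp (cell_weight L h)"
proof -
  have aff: "rat_affine (\<lambda>y. ev \<omega> (affpt y))" for \<omega> :: "'a option \<Rightarrow> int"
    unfolding ev_affpt using rat_affineI[of "\<lambda>i. of_int (\<omega> (Some i))" "of_int (\<omega> None)"] by (simp add: add.commute)
  let ?ind = "\<lambda>\<omega> y. if 0 \<le> ev \<omega> (affpt y) then 1 else (0::real)"
  have "cell_weight L h y = (\<Sum>T\<in>Pow L. real (h T) * ((\<Prod>\<omega>\<in>T. ?ind \<omega> y) * (\<Prod>\<omega>\<in>L - T. 1 - ?ind \<omega> y)))" for y
  proof -
    have "(\<Prod>\<omega>\<in>T. ?ind \<omega> y) * (\<Prod>\<omega>\<in>L - T. 1 - ?ind \<omega> y) = (if T = nonneg_forms L y then 1 else 0)" if T: "T \<in> Pow L" for T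
    proof (cases "T = nonneg_forms L y")
      case True
      have "(\<Prod>\<omega>\<in>T. ?ind \<omega> y) = 1" by (rule prod.neutral) (auto simp: True nonneg_forms_def)
      moreover have "(\<Prod>\<omega>\<in>L - T. 1 - ?ind \<omega> y) = 1" by (rule prod.neutral) (auto simp: True nonneg_forms_def)
      ultimately show ?thesis using True by simp
    next
      case False
      then consider \<omega> where "\<omega> \<in> T" "\<not> 0 \<le> ev \<omega> (affpt y)" | \<omega> where "\<omega> \<in> L - T" "0 \<le> ev \<omega> (affpt y)"
        using T by (auto simp: nonneg_forms_def)
      hence "(\<Prod>\<omega>\<in>T. ?ind \<omega> y) = 0 \<or> (\<Prod>\<omega>\<in>L - T. 1 - ?ind \<omega> y) = 0"
      proof cases
        case 1
        hence "\<exists>\<omega>\<in>T. ?ind \<omega> y = 0" by (intro bexI[of _ \<omega>]) auto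
        moreover have "finite T" using T L by (auto intro: finite_subset)
        ultimately have "(\<Prod>\<omega>\<in>T. ?ind \<omega> y) = 0" by (intro prod_zero)
        thus ?thesis ..
      next
        case 2
        hence "\<exists>\<omega>\<in>L - T. 1 - ?ind \<omega> y = 0" by (intro bexI[of _ \<omega>]) auto
        moreover have "finite (L - T)" using L by simp
        ultimately have "(\<Prod>\<omega>\<in>L - T. 1 - ?ind \<omega> y) = 0" by (intro prod_zero)
        thus ?thesis ..
      qed
      thus ?thesis using False by auto
    qed
    hence "(\<Sum>T\<in>Pow L. real (h T) * ((\<Prod>\<omega>\<in>T. ?ind \<omega> y) * (\<Prod>\<omega>\<in>L - T. 1 - ?ind \<omega> y))) =
       (\<Sum>T\<in>Pow L. if T = nonneg_forms L y then real (h (nonneg_forms L y)) else 0)"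
      by (intro sum.cong) auto
    also have "\<dots> = real (h (nonneg_forms L y))" using L by (auto simp: nonneg_forms_def)
    finally show ?thesis by (simp add: cell_weight_def)
  qed
  hence "cell_weight L h = (\<lambda>y. \<Sum>T\<in>Pow L. real (h T) * ((\<Prod>\<omega>\<in>T. ?ind \<omega> y) * (\<Prod>\<omega>\<in>L - T. 1 - ?ind \<omega> y)))" by blast
  moreover have "rat_pp \<dots>"
    by (intro rat_pp_sum rat_pp.rat_mult rat_pp_prod rat_pp_diff rat_pp.rat_const rat_pp.rat_ind aff)
       (use L in \<open>auto intro: finite_subset\<close>)
  ultimately show ?thesis by simp
qed

text \<open>
  The indicator function of the hyperplane integrates to \<open>0\<close> already in the \<open>i\<close>-th variable.
\<close>

lemma AE_hyperplane:
  fixes \<omega> :: "'n::finite option \<Rightarrow> int"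
  assumes "\<omega> (Some i) \<noteq> 0"
  shows "AE x in Pi\<^sub>M UNIV (\<lambda>_. cube M). ev \<omega> (affpt x) \<noteq> 0"
proof -
  define f where "f x = (if 0 \<le> ev \<omega> (affpt x) then 1 else 0) * (if 0 \<le> - ev \<omega> (affpt x) then 1 else (0::real))" for x :: "'n \<Rightarrow> real"
  have aff: "rat_affine (\<lambda>y. ev \<omega> (affpt y))"
    unfolding ev_affpt using rat_affineI[of "\<lambda>i. of_int (\<omega> (Some i))" "of_int (\<omega> None)"] by (simp add: add.commute)
  have aff': "rat_affine (\<lambda>y. - ev \<omega> (affpt y))" using rat_affine_diff[OF rat_affine_const[of 0] aff] by simp
  have f: "rat_pp f" unfolding f_def[abs_def] by (intro rat_pp.rat_mult rat_pp.rat_ind aff aff')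
  have f01: "f x = (if ev \<omega> (affpt x) = 0 then 1 else 0)" for x by (auto simp: f_def)
  have "integral\<^sup>L (Pi\<^sub>M (insert i (UNIV - {i})) (\<lambda>_. cube M)) f =
      (LINT x|Pi\<^sub>M (UNIV - {i}) (\<lambda>_. cube M). LINT y|cube M. f (x(i := y)))"
    by (rule cube.product_integral_insert) (auto intro: rat_pp_integrable f)
  moreover have "(LINT y|cube M. f (x(i := y))) = 0" for x
  proof (rule integral_eq_zero_AE)
    define b where "b = (\<Sum>j\<in>UNIV - {i}. of_int (\<omega> (Some j)) * x j) + of_int (\<omega> None)"
    have "ev \<omega> (affpt (x(i := y))) = of_int (\<omega> (Some i)) * y + b" for y
    proof -
      have "(\<Sum>j\<in>UNIV - {i}. of_int (\<omega> (Some j)) * (x(i := y)) j) = (\<Sum>j\<in>UNIV - {i}. of_int (\<omega> (Some j)) * x j)"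
        by (rule sum.cong) auto
      thus ?thesis unfolding ev_affpt b_def by (simp add: sum.remove[of UNIV i])
    qed
    hence f0: "f (x(i := y)) = 0" if "y \<notin> {- b / of_int (\<omega> (Some i))}" for y
      using that assms by (auto simp: f01 field_simps)
    show "AE y in cube M. f (x(i := y)) = 0"
    proof (rule AE_mp[OF AE_cube_finite[of "{- b / of_int (\<omega> (Some i))}" M]])
      show "AE y in cube M. y \<notin> {- b / of_int (\<omega> (Some i))} \<and> - M \<le> y \<longrightarrow> f (x(i := y)) = 0"
        by (rule AE_I2) (use f0 in blast)
    qed simp
  qed
  moreover have "insert i (UNIV - {i}) = UNIV" by auto
  ultimately have "integral\<^sup>L (Pi\<^sub>M UNIV (\<lambda>_. cube M)) f = 0" by simp
  hence "AE x in Pi\<^sub>M UNIV (\<lambda>_. cube M). f x = 0"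
    by (subst (asm) integral_nonneg_eq_0_iff_AE) (auto simp: f01 intro: rat_pp_integrable[OF f])
  thus ?thesis by (rule AE_mp) (rule AE_I2, simp add: f01)
qed

lemma tendsto_floor_div:
  fixes y :: real
  shows "((\<lambda>u. of_int \<lfloor>u * y\<rfloor> / u) \<longlongrightarrow> y) at_top"
proof (rule tendsto_sandwich[where f = "\<lambda>u. y - inverse u" and h = "\<lambda>_. y"])
  show "\<forall>\<^sub>F u in at_top. y - inverse u \<le> of_int \<lfloor>u * y\<rfloor> / u"
    using eventually_gt_at_top[of 0]
  proof eventually_elim
    case (elim u)
    have "u * (y - inverse u) = u * y - 1" using elim by (simp add: right_diff_distrib)
    also have "\<dots> \<le> of_int \<lfloor>u * y\<rfloor>" by linarith
    finally show ?case using elim by (simp add: pos_le_divide_eq mult.commute)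
  qed
  show "\<forall>\<^sub>F u in at_top. of_int \<lfloor>u * y\<rfloor> / u \<le> y"
    using eventually_gt_at_top[of 0] by eventually_elim (simp add: pos_divide_le_eq mult.commute)
  have "((\<lambda>u. y - inverse u) \<longlongrightarrow> y - 0) at_top"
    by (intro tendsto_diff tendsto_const tendsto_inverse_0_at_top filterlim_ident)
  thus "((\<lambda>u. y - inverse u) \<longlongrightarrow> y) at_top" by simp
qed simp

definition lattice_box :: "real \<Rightarrow> ('n \<Rightarrow> int) set" where
  "lattice_box r = {a. \<forall>i. \<bar>real_of_int (a i)\<bar> \<le> r}"

lemma finite_lattice_box: "finite (lattice_box r :: ('n::finite \<Rightarrow> int) set)"
proof (rule finite_subset)
  show "(lattice_box r :: ('n \<Rightarrow> int) set) \<subseteq> PiE UNIV (\<lambda>_. {- \<lceil>\<bar>r\<bar>\<rceil>..\<lceil>\<bar>r\<bar>\<rceil>})"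
  proof
    fix a :: "'n \<Rightarrow> int" assume a: "a \<in> lattice_box r"
    have "a i \<in> {- \<lceil>\<bar>r\<bar>\<rceil>..\<lceil>\<bar>r\<bar>\<rceil>}" for i
    proof -
      have "\<bar>real_of_int (a i)\<bar> \<le> \<bar>r\<bar>" using a by (auto simp: lattice_box_def intro: order_trans[OF _ abs_ge_self])
      hence "real_of_int \<bar>a i\<bar> \<le> of_int \<lceil>\<bar>r\<bar>\<rceil>" using le_of_int_ceiling[of "\<bar>r\<bar>"] by linarith
      hence "\<bar>a i\<bar> \<le> \<lceil>\<bar>r\<bar>\<rceil>" by (simp only: of_int_le_iff)
      thus ?thesis by (auto simp: abs_le_iff)
    qed
    thus "a \<in> PiE UNIV (\<lambda>_. {- \<lceil>\<bar>r\<bar>\<rceil>..\<lceil>\<bar>r\<bar>\<rceil>})" by blast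
  qed
qed (simp add: finite_PiE)

text \<open>
  The sum divided by \<open>u\<^sup>n\<close> is the integral of the step function \<open>f (\<lfloor>u x\<rfloor> / u)\<close>, which is constant on cubes
  of side \<open>1/u\<close>.  Off the hyperplanes it converges to \<open>f\<close>, since the signs of the forms at
  \<open>\<lfloor>u x\<rfloor> / u\<close> are eventually those at \<open>x\<close>.
\<close>

lemma tendsto_lattice_sum:
  fixes L :: "('n::finite option \<Rightarrow> int) set"
  assumes L: "finite L" and K: "0 \<le> K" "\<forall>y i. h (nonneg_forms L y) \<noteq> 0 \<longrightarrow> \<bar>y i\<bar> \<le> K"
  obtains q where "q \<in> \<rat>"
    "((\<lambda>u. (\<Sum>a\<in>lattice_box (K * u). cell_weight L h (\<lambda>i. of_int (a i) / u)) / u ^ CARD('n)) \<longlongrightarrow> q) at_top"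
proof -
  \<comment> \<open>for \<open>u \<ge> 1\<close>, the cubes of side \<open>1/u\<close> at the points of \<open>[- K, K]\<^sup>n\<close> fit into \<open>[- M, M]\<^sup>n\<close>\<close>
  define M where "M = real (nat \<lceil>K\<rceil> + 1)"
  have M: "M \<in> \<rat>" "0 \<le> M" "K + 1 \<le> M"
  proof -
    show "M \<in> \<rat>" "0 \<le> M" by (simp_all add: M_def)
    show "K + 1 \<le> M" unfolding M_def using K(1) by (simp add: of_nat_nat)
  qed
  let ?P = "Pi\<^sub>M (UNIV :: 'n set) (\<lambda>_. cube M)"
  interpret P: finite_measure ?P by (rule finite_measure_PiM_cube) simp
  define f where "f = cell_weight L h"
  have f: "rat_pp f" unfolding f_def by (rule cell_weight_rat_pp[OF L])
  have sp: "x \<in> space ?P \<longleftrightarrow> (\<forall>i. x i \<in> {- M..M})" for x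
    by (auto simp: space_PiM space_restrict_space PiE_def extensional_def)
  define B where "B u a = PiE UNIV (\<lambda>i. {y \<in> {- M..M}. \<lfloor>u * y\<rfloor> = a i})" for u :: real and a :: "'n \<Rightarrow> int"
  have Bmem: "x \<in> B u a \<longleftrightarrow> (\<lambda>i. \<lfloor>u * x i\<rfloor>) = a" if "x \<in> space ?P" for x u a
    using that by (auto simp: B_def sp fun_eq_iff PiE_iff)
  have Bi: "{y \<in> {- M..M}. \<lfloor>u * y\<rfloor> = k} \<in> sets (cube M)" for u :: real and k
  proof -
    have "{y. \<lfloor>u * y\<rfloor> = k} \<in> sets borel" by measurable
    hence "{- M..M} \<inter> {y. \<lfloor>u * y\<rfloor> = k} \<in> sets borel" by (intro sets.Int) auto
    moreover have "{y \<in> {- M..M}. \<lfloor>u * y\<rfloor> = k} = {- M..M} \<inter> {y. \<lfloor>u * y\<rfloor> = k}" by auto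
    ultimately show ?thesis by (simp add: sets_restrict_space_iff)
  qed
  have Bsets: "B u a \<in> sets ?P" for u a
    unfolding B_def by (rule sets_PiM_I_finite) (use Bi in auto)
  define s where "s u x = (\<Sum>a\<in>lattice_box (K * u). f (\<lambda>i. of_int (a i) / u) * indicator (B u a) x)" for u x
  have s_eq: "s u x = f (\<lambda>i. of_int \<lfloor>u * x i\<rfloor> / u)" if u: "0 < u" and x: "x \<in> space ?P" for u x
  proof -
    let ?a = "\<lambda>i. \<lfloor>u * x i\<rfloor>"
    have "s u x = (\<Sum>a\<in>lattice_box (K * u). if a = ?a then f (\<lambda>i. of_int (?a i) / u) else 0)"
      unfolding s_def by (rule sum.cong) (auto simp: indicator_def Bmem[OF x])
    also have "\<dots> = (if ?a \<in> lattice_box (K * u) then f (\<lambda>i. of_int (?a i) / u) else 0)"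
      by (simp add: finite_lattice_box)
    also have "\<dots> = f (\<lambda>i. of_int (?a i) / u)"
    proof -
      have "?a \<in> lattice_box (K * u)" if "f (\<lambda>i. of_int (?a i) / u) \<noteq> 0"
      proof -
        have "\<bar>of_int (?a i) / u\<bar> \<le> K" for i using K(2)[rule_format, of "\<lambda>i. of_int (?a i) / u" i] that by (simp add: f_def cell_weight_def)
        thus ?thesis using u by (auto simp: lattice_box_def abs_divide pos_divide_le_eq)
      qed
      thus ?thesis by auto
    qed
    finally show ?thesis .
  qed
  have meas: "s u \<in> borel_measurable ?P" for u
    unfolding s_def[abs_def] using Bsets by (intro borel_measurable_sum borel_measurable_times) auto
  define C where "C = (\<Sum>T\<in>Pow L. real (h T))"
  have fC: "norm (f y) \<le> C" for y
  proof -
    have "real (h (nonneg_forms L y)) \<le> C" unfolding C_def by (rule member_le_sum) (use L in \<open>auto simp: nonneg_forms_def\<close>)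
    thus ?thesis by (simp add: f_def cell_weight_def)
  qed
  have conv: "AE x in ?P. ((\<lambda>u. s u x) \<longlongrightarrow> f x) at_top"
  proof -
    have "AE x in ?P. \<forall>\<omega>\<in>L. (\<exists>i. \<omega> (Some i) \<noteq> 0) \<longrightarrow> ev \<omega> (affpt x) \<noteq> 0"
    proof (rule AE_finite_allI[OF L])
      fix \<omega> :: "'n option \<Rightarrow> int"
      show "AE x in ?P. (\<exists>i. \<omega> (Some i) \<noteq> 0) \<longrightarrow> ev \<omega> (affpt x) \<noteq> 0"
        by (cases "\<exists>i. \<omega> (Some i) \<noteq> 0") (use AE_hyperplane[of \<omega> _ M] in auto)
    qed
    thus ?thesis
    proof (rule AE_mp, intro AE_I2 impI)
      fix x assume x: "x \<in> space ?P" and nz: "\<forall>\<omega>\<in>L. (\<exists>i. \<omega> (Some i) \<noteq> 0) \<longrightarrow> ev \<omega> (affpt x) \<noteq> 0"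
      let ?y = "\<lambda>u i. of_int \<lfloor>u * x i\<rfloor> / u"
      have "\<forall>\<^sub>F u in at_top. 0 \<le> ev \<omega> (affpt (?y u)) \<longleftrightarrow> 0 \<le> ev \<omega> (affpt x)" if \<omega>: "\<omega> \<in> L" for \<omega>
      proof (cases "\<exists>i. \<omega> (Some i) \<noteq> 0")
        case True
        have lim: "((\<lambda>u. ev \<omega> (affpt (?y u))) \<longlongrightarrow> ev \<omega> (affpt x)) at_top"
          unfolding ev_affpt by (intro tendsto_add tendsto_sum tendsto_mult tendsto_const tendsto_floor_div)
        show ?thesis
        proof (cases "0 < ev \<omega> (affpt x)")
          case True
          from order_tendstoD(1)[OF lim this] show ?thesis by eventually_elim (use True in auto)
        next
          case False
          hence neg: "ev \<omega> (affpt x) < 0" using nz \<omega> \<open>\<exists>i. \<omega> (Some i) \<noteq> 0\<close> by force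
          from order_tendstoD(2)[OF lim neg] show ?thesis by eventually_elim (use neg in auto)
        qed
      qed (simp add: ev_affpt)
      hence "\<forall>\<^sub>F u in at_top. \<forall>\<omega>\<in>L. 0 \<le> ev \<omega> (affpt (?y u)) \<longleftrightarrow> 0 \<le> ev \<omega> (affpt x)"
        using L by (intro eventually_ball_finite) auto
      hence "\<forall>\<^sub>F u in at_top. s u x = f x"
        using eventually_gt_at_top[of 0]
      proof eventually_elim
        case (elim u)
        hence "nonneg_forms L (?y u) = nonneg_forms L x" by (auto simp: nonneg_forms_def)
        thus ?case using s_eq[OF elim(2) x] by (simp add: f_def cell_weight_def)
      qed
      thus "((\<lambda>u. s u x) \<longlongrightarrow> f x) at_top" by (rule tendsto_eventually)
    qed
  qed
  have lim: "((\<lambda>u. integral\<^sup>L ?P (s u)) \<longlongrightarrow> integral\<^sup>L ?P f) at_top"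
  proof (rule integral_dominated_convergence_at_top[where w = "\<lambda>_. C"])
    show "f \<in> borel_measurable ?P" by (rule rat_pp_measurable[OF f])
    show "\<forall>\<^sub>F u in at_top. AE x in ?P. norm (s u x) \<le> C"
      using eventually_gt_at_top[of 0]
    proof eventually_elim
      case (elim u)
      show ?case by (rule AE_I2) (simp only: s_eq[OF elim] fC)
    qed
  qed (use meas conv in auto)
  have int: "integral\<^sup>L ?P (s u) = (\<Sum>a\<in>lattice_box (K * u). cell_weight L h (\<lambda>i. of_int (a i) / u)) / u ^ CARD('n)" if u: "1 \<le> u" for u
  proof -
    have mB: "measure ?P (B u a) = (1 / u) ^ CARD('n)" if a: "a \<in> lattice_box (K * u)" for a
    proof -
      have em: "emeasure (cube M) {y \<in> {- M..M}. \<lfloor>u * y\<rfloor> = a i} = ennreal (1 / u)" for i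
      proof -
        have ai: "\<bar>real_of_int (a i)\<bar> \<le> K * u" using a by (simp add: lattice_box_def)
        have bnd: "- K \<le> of_int (a i) / u" "of_int (a i) / u \<le> K" 
          using ai u by (auto simp: pos_le_divide_eq pos_divide_le_eq abs_le_iff)
        have iu: "1 / u \<le> 1" using u by simp
        have eq: "{y \<in> {- M..M}. \<lfloor>u * y\<rfloor> = a i} = {of_int (a i) / u ..< of_int (a i) / u + 1 / u}"
        proof (intro Set.set_eqI iffI)
          fix y assume "y \<in> {y \<in> {- M..M}. \<lfloor>u * y\<rfloor> = a i}"
          hence "of_int (a i) \<le> u * y" "u * y < of_int (a i) + 1" by (auto simp: floor_eq_iff)
          thus "y \<in> {of_int (a i) / u ..< of_int (a i) / u + 1 / u}"
            using u by (simp add: add_divide_distrib[symmetric] pos_divide_le_eq pos_less_divide_eq mult.commute)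
        next
          fix y assume y: "y \<in> {of_int (a i) / u ..< of_int (a i) / u + 1 / u}"
          hence "of_int (a i) \<le> u * y" "u * y < of_int (a i) + 1"
            using u by (simp_all add: add_divide_distrib[symmetric] pos_divide_le_eq pos_less_divide_eq mult.commute)
          moreover have "- M \<le> y" "y \<le> M" using y bnd iu M(3) by auto
          ultimately show "y \<in> {y \<in> {- M..M}. \<lfloor>u * y\<rfloor> = a i}" by (simp add: floor_eq_iff)
        qed
        have "emeasure (cube M) {y \<in> {- M..M}. \<lfloor>u * y\<rfloor> = a i} = emeasure lborel {y \<in> {- M..M}. \<lfloor>u * y\<rfloor> = a i}"
          by (rule emeasure_restrict_space) auto
        also have "\<dots> = ennreal (1 / u)" unfolding eq using u by simp
        finally show ?thesis .
      qed
      have "emeasure ?P (B u a) = (\<Prod>i\<in>(UNIV :: 'n set). emeasure (cube M) {y \<in> {- M..M}. \<lfloor>u * y\<rfloor> = a i})"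
        unfolding B_def by (rule cube.emeasure_PiM) (use Bi in auto)
      also have "\<dots> = ennreal ((1 / u) ^ CARD('n))" unfolding em using u by (simp add: ennreal_power)
      finally show ?thesis using u by (simp add: measure_def)
    qed
    have "integral\<^sup>L ?P (s u) = (\<Sum>a\<in>lattice_box (K * u). f (\<lambda>i. of_int (a i) / u) * measure ?P (B u a))"
    proof -
      have "integrable ?P (indicator (B u a) :: _ \<Rightarrow> real)" for a
        by (rule integrable_real_indicator[OF Bsets]) (simp add: less_top[symmetric])
      thus ?thesis unfolding s_def[abs_def] using Bsets
        by (subst Bochner_Integration.integral_sum) auto
    qed
    also have "\<dots> = (\<Sum>a\<in>lattice_box (K * u). f (\<lambda>i. of_int (a i) / u) * (1 / u) ^ CARD('n))"
      by (rule sum.cong) (simp_all add: mB)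
    finally show ?thesis by (simp add: f_def sum_divide_distrib power_one_over)
  qed
  have "\<forall>\<^sub>F u in at_top. integral\<^sup>L ?P (s u) = (\<Sum>a\<in>lattice_box (K * u). cell_weight L h (\<lambda>i. of_int (a i) / u)) / u ^ CARD('n)"
    using eventually_ge_at_top[of 1] by eventually_elim (rule int)
  from Lim_transform_eventually[OF lim this] rat_pp_integral_rational[OF f M(1,2), of UNIV] that show ?thesis by auto
qed

lemma filterlim_of_rat_at_top: "filterlim (of_rat :: rat \<Rightarrow> real) at_top at_top"
  unfolding filterlim_at_top
proof
  fix z :: real
  have "z \<le> of_rat u" if "of_int \<lceil>z\<rceil> \<le> u" for u
  proof -
    have "(of_rat (of_int \<lceil>z\<rceil>) :: real) \<le> of_rat u" using that by (simp only: of_rat_less_eq)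
    hence "real_of_int \<lceil>z\<rceil> \<le> of_rat u" by simp
    thus ?thesis using le_of_int_ceiling[of z] by (rule order_trans[rotated])
  qed
  thus "\<forall>\<^sub>F u in at_top. z \<le> of_rat u" unfolding eventually_at_top_linorder by blast
qed

section \<open>The limit of the normalized lengths\<close>

theorem theorem4p12:
  fixes I :: "('n::{finite,linorder}, 'k::field) mpoly set"
    and i :: nat
  assumes "monomial_ideal I"
    and "\<forall>\<^sub>F u :: rat in at_top.
           local_cohomology_length i (rational_symbolic_power mpoly_ring I u) < \<infinity>"
  shows "\<exists>L :: rat.
           ((\<lambda>u :: rat.
               real (the_enat (local_cohomology_length i (rational_symbolic_power mpoly_ring I u)))
                 / (real_of_rat u) ^ CARD('n))
             \<longlongrightarrow> real_of_rat L) at_top"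
proof -
  let ?len = "\<lambda>u. local_cohomology_length i (rational_symbolic_power mpoly_ring I u)"
  obtain L :: "('n option \<Rightarrow> int) set" and \<Psi> where L: "finite L"
    "\<And>u. 0 < u \<Longrightarrow> \<exists>D. up_closed D \<and> rational_symbolic_power mpoly_ring I u = mono_span D \<and>
       (\<forall>a. surviving D a = \<Psi> {\<omega> \<in> L. 0 \<le> ev \<omega> (zlift a u)})"
    by (rule rational_symbolic_power_surviving[OF assms(1)]) (rule that)
  define E :: "('n option \<Rightarrow> int) set \<Rightarrow> ('n set \<Rightarrow> 'k) set" where "E T = cohom_basis i (\<Psi> T)" for T
  define h where "h T = card (E T)" for T
  have finE: "finite (E T)" for T unfolding E_def by (rule cohom_basis_finite)
  have hE: "h T \<noteq> 0" if "e \<in> E T" for e T using that finE[of T] by (auto simp: h_def)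
  define sg where "sg u a = {\<omega> \<in> L. 0 \<le> ev \<omega> (zlift a u)}" for u :: rat and a :: "'n \<Rightarrow> int"
  define C where "C u = {(a, e). e \<in> E (sg u a)}" for u
  have len: "?len u = (if finite (C u) then enat (card (C u)) else \<infinity>)" if u: "0 < u" for u
  proof -
    obtain D where D: "up_closed D" "rational_symbolic_power mpoly_ring I u = mono_span D"
      "\<And>a. surviving D a = \<Psi> (sg u a)" using L(2)[OF u] unfolding sg_def by blast
    have "cohom_index D i = C u" by (simp add: cohom_index_def C_def E_def D(3))
    thus ?thesis using local_cohomology_length_mono_span[OF D(1), of i, where 'k = 'k] by (simp add: D(2))
  qed
  obtain u0 where u0: "\<And>u. u0 \<le> u \<Longrightarrow> ?len u < \<infinity>"
    using assms(2) unfolding eventually_at_top_linorder by blast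
  have finC: "finite (C u)" if "u0 \<le> u" "0 < u" for u
    using u0[OF that(1)] len[OF that(2)] by (auto split: if_splits)
  have "\<exists>K. \<forall>y. nonneg_forms L y = T \<longrightarrow> (\<forall>i. \<bar>y i\<bar> \<le> K)" if T: "T \<in> Pow L" and hT: "h T \<noteq> 0" for T
  proof (rule cell_bounded[OF L(1)])
    show "T \<subseteq> L" using T by simp
    fix u :: rat assume u: "u0 \<le> u" "0 < u"
    obtain e where e: "e \<in> E T" using hT by (auto simp: h_def card_eq_0_iff)
    have "{a. {\<omega> \<in> L. 0 \<le> ev \<omega> (zlift a u)} = T} \<subseteq> fst ` C u"
    proof
      fix a assume "a \<in> {a. {\<omega> \<in> L. 0 \<le> ev \<omega> (zlift a u)} = T}"
      hence "(a, e) \<in> C u" using e by (simp add: C_def sg_def)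
      thus "a \<in> fst ` C u" by force
    qed
    thus "finite {a. {\<omega> \<in> L. 0 \<le> ev \<omega> (zlift a u)} = T}" using finC[OF u] by (rule finite_subset[OF _ finite_imageI])
  qed
  hence "\<forall>T\<in>Pow L. \<exists>K. h T \<noteq> 0 \<longrightarrow> (\<forall>y. nonneg_forms L y = T \<longrightarrow> (\<forall>i. \<bar>y i\<bar> \<le> K))" by blast
  from bchoice[OF this] obtain KT where KT: "\<forall>T\<in>Pow L. h T \<noteq> 0 \<longrightarrow> (\<forall>y. nonneg_forms L y = T \<longrightarrow> (\<forall>i. \<bar>y i\<bar> \<le> KT T))" ..
  define K where "K = (\<Sum>T\<in>Pow L. \<bar>KT T\<bar>)"
  have K0: "0 \<le> K" by (simp add: K_def sum_nonneg)
  have K: "\<bar>y i\<bar> \<le> K" if "h (nonneg_forms L y) \<noteq> 0" for y i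
  proof -
    have T: "nonneg_forms L y \<in> Pow L" by (auto simp: nonneg_forms_def)
    have "\<bar>y i\<bar> \<le> KT (nonneg_forms L y)" using KT T that by blast
    also have "\<dots> \<le> \<bar>KT (nonneg_forms L y)\<bar>" by simp
    also have "\<dots> \<le> K" unfolding K_def by (rule member_le_sum[OF T]) (use L(1) in auto)
    finally show ?thesis .
  qed
  hence K2: "\<forall>y i. h (nonneg_forms L y) \<noteq> 0 \<longrightarrow> \<bar>y i\<bar> \<le> K" by blast
  obtain q where q: "q \<in> \<rat>"
    "((\<lambda>u. (\<Sum>a\<in>lattice_box (K * u). cell_weight L h (\<lambda>i. of_int (a i) / u)) / u ^ CARD('n)) \<longlongrightarrow> q) at_top"
    by (rule tendsto_lattice_sum[OF L(1) K0 K2]) (rule that)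
  obtain r where r: "q = of_rat r" using q(1) by (auto elim: Rats_cases)
  have eq: "real (the_enat (?len u)) = (\<Sum>a\<in>lattice_box (K * of_rat u). cell_weight L h (\<lambda>i. of_int (a i) / of_rat u))"
    if u: "u0 \<le> u" "0 < u" for u
  proof -
    have sg: "sg u a = nonneg_forms L (\<lambda>i. of_int (a i) / of_rat u)" for a
      unfolding sg_def by (rule nonneg_forms_zlift_rat[OF u(2)])
    have "C u = Sigma (lattice_box (K * of_rat u)) (\<lambda>a. E (sg u a))"
    proof (intro Set.set_eqI iffI)
      fix x assume "x \<in> C u"
      then obtain a e where x: "x = (a, e)" "e \<in> E (sg u a)" by (auto simp: C_def)
      have "\<bar>of_int (a j) / real_of_rat u\<bar> \<le> K" for j
        using K[of "\<lambda>i. of_int (a i) / of_rat u" j] hE[OF x(2)] by (simp add: sg)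
      hence "a \<in> lattice_box (K * of_rat u)"
        using u(2) by (auto simp: lattice_box_def abs_divide pos_divide_le_eq)
      thus "x \<in> Sigma (lattice_box (K * of_rat u)) (\<lambda>a. E (sg u a))" using x by blast
    next
      fix x assume "x \<in> Sigma (lattice_box (K * of_rat u)) (\<lambda>a. E (sg u a))"
      thus "x \<in> C u" by (auto simp: C_def)
    qed
    hence "card (C u) = (\<Sum>a\<in>lattice_box (K * of_rat u). card (E (sg u a)))"
      by (simp add: finite_lattice_box finE)
    moreover have "the_enat (?len u) = card (C u)" using len[OF u(2)] finC[OF u] by simp
    ultimately show ?thesis by (simp add: cell_weight_def h_def sg)
  qed
  have "((\<lambda>u. (\<Sum>a\<in>lattice_box (K * of_rat u). cell_weight L h (\<lambda>i. of_int (a i) / of_rat u)) / of_rat u ^ CARD('n)) \<longlongrightarrow> q) at_top"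
    using filterlim_compose[OF q(2) filterlim_of_rat_at_top] .
  moreover have "\<forall>\<^sub>F u in at_top. (\<Sum>a\<in>lattice_box (K * of_rat u). cell_weight L h (\<lambda>i. of_int (a i) / of_rat u)) / of_rat u ^ CARD('n)
      = real (the_enat (?len u)) / real_of_rat u ^ CARD('n)"
    using eventually_ge_at_top[of u0] eventually_gt_at_top[of 0] by eventually_elim (simp add: eq)
  ultimately have "((\<lambda>u. real (the_enat (?len u)) / real_of_rat u ^ CARD('n)) \<longlongrightarrow> q) at_top"
    by (rule Lim_transform_eventually)
  thus ?thesis unfolding r by blast
qed

end
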